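(* Consider the two-user MIMO broadcast channel with transmit correlation described in the context, under CSIR, and let $r_0=\dim\big(\mathrm{Span}(\mathbf U_1)\cap\mathrm{Span}(\mathbf U_2)\big)\ge0$. Every achievable DoF pair $(d_1,d_2)$ satisfies $d_1\le N_1^*$, $d_2\le N_2^*$ and $$d_1+d_2\le\min\{r_1+r_2-r_0,\ N_1+N_2\}.$$ Moreover, if either ($r_1\le N_1$ and $r_2\le N_2$) or ($N_1\le r_1-r_0$ and $N_2\le r_2-r_0$), then the DoF region equals the set of pairs $(d_1,d_2)\in\mathbb R_{\ge0}^2$ satisfying these three inequalities.
   Context: Model: a transmitter with $M$ antennas serves $K$ users; user $k$ has $N_k$ antennas. At each channel use user $k$ receives $\mathbf y_k=\mathbf H_k\mathbf x+\mathbf w_k$, where $\mathbf x\in\mathbb C^M$ is the transmitted vector, $\mathbf w_k$ has i.i.d. $\mathcal{CN}(0,1)$ entries (independent across time), and each codeword of length $J$ satisfies $\frac1J\sum_{j=1}^J\|\mathbf x(j)\|^2\le\rho$. The channel is $\mathbf H_k=\mathbf G_k\boldsymbol\Sigma_k^{1/2}\mathbf U_k^{H}$, where $\mathbf R_k=\frac1{N_k}\mathbb E[\mathbf H_k^H\mathbf H_k]=\mathbf U_k\boldsymbol\Sigma_k\mathbf U_k^H$ is the transmit correlation matrix, of rank $r_k$ and trace $M$, $\mathbf U_k\in\mathbb C^{M\times r_k}$ has orthonormal columns, $\boldsymbol\Sigma_k$ is an $r_k\times r_k$ diagonal matrix with positive diagonal, and $\mathbf G_k\in\mathbb C^{N_k\times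 r_k}$ is random with differential entropy $h(\mathbf G_k)>-\infty$ and $\mathbb E[\mathbf G_k^H\mathbf G_k]=N_k\mathbf I_{r_k}$. The channel statistics are known to the transmitter and to user $k$; the transmitter never knows channel realizations. CSIR means user $k$ knows the realization of $\mathbf H_k$. Users receive independent messages; a DoF tuple $(d_1,\dots,d_K)$ is achievable if there are rate tuples in the capacity region at every SNR $\rho$ with $d_k=\lim_{\rho\to\infty}R_k(\rho)/\log\rho$; the DoF region is the set of achievable DoF tuples. Notation: $N_k^*=\min(N_k,r_k)$. *)

theory Defs
  imports "HOL-Analysis.Analysis" "HOL-Probability.Probability"
begin

text \<open>Complex vectors/matrices with finite index types: C^M is complex^'m, an N x r matrix
  is complex^'r^'n (rows indexed by 'n).\<close>

definition cadj :: "complex^'c^'r \<Rightarrow> complex^'r^'c" where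
  "cadj A = (\<chi> i j. cnj (A $ j $ i))"

definition diagm :: "('n \<Rightarrow> 'a::zero) \<Rightarrow> 'a^'n^'n" where
  "diagm d = (\<chi> i j. if i = j then d i else 0)"

definition chan :: "complex^'r^'n \<Rightarrow> ('r \<Rightarrow> real) \<Rightarrow> complex^'r^'m \<Rightarrow> complex^'m^'n" where
  "chan G \<sigma> U = G ** diagm (\<lambda>i. complex_of_real (sqrt (\<sigma> i))) ** cadj U"

definition corr_mat :: "('r \<Rightarrow> real) \<Rightarrow> complex^'r^'m \<Rightarrow> complex^'m^'m" where
  "corr_mat \<sigma> U = U ** diagm (\<lambda>i. complex_of_real (\<sigma> i)) ** cadj U"

text \<open>Standing assumptions on the statistics of one user: Sigma positive diagonal,
  U with orthonormal columns, trace R = M, G has a density w.r.t. Lebesgue measure with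
  differential entropy h(G) = - int f ln f > -infinity (i.e. the positive part of f ln f
  has finite integral), and E[G^H G] = N I.\<close>
definition valid_stats :: "('r::finite \<Rightarrow> real) \<Rightarrow> complex^'r^'m::finite \<Rightarrow> (complex^'r^'n::finite) measure \<Rightarrow> bool" where
  "valid_stats \<sigma> U PG \<longleftrightarrow>
     (\<forall>i. \<sigma> i > 0) \<and> cadj U ** U = mat 1 \<and>
     trace (corr_mat \<sigma> U) = of_nat CARD('m) \<and>
     prob_space PG \<and>
     (\<exists>f. f \<in> borel_measurable lborel \<and> (\<forall>G. f G \<ge> 0) \<and>
          PG = density lborel (\<lambda>G. ennreal (f G)) \<and>
          (\<integral>\<^sup>+ G. ennreal (f G * ln (f G)) \<partial>lborel) < \<infinity>) \<and>
     has_bochner_integral PG (\<lambda>G. cadj G ** G) (mat (of_nat CARD('n)))"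

definition cgauss :: "complex measure" where
  "cgauss = distr (density lborel (normal_density 0 (sqrt (1/2))) \<Otimes>\<^sub>M
                   density lborel (normal_density 0 (sqrt (1/2)))) borel (\<lambda>(a, b). Complex a b)"

definition cnoise :: "(complex^'n::finite) measure" where
  "cnoise = distr (PiM UNIV (\<lambda>_::'n. cgauss)) borel (\<lambda>w. \<chi> i. w i)"

definition block_space ::
  "(((complex^'r1^'n1) \<times> (complex^'r2^'n2)) measure) \<Rightarrow> nat \<Rightarrow>
   (nat \<Rightarrow> ((complex^'r1^'n1) \<times> (complex^'r2^'n2)) \<times> ((complex^'n1::finite) \<times> (complex^'n2::finite))) measure" where
  "block_space PJ J = PiM {..<J} (\<lambda>_. PJ \<Otimes>\<^sub>M (cnoise \<Otimes>\<^sub>M cnoise))"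

definition code_exists ::
  "('r1::finite \<Rightarrow> real) \<Rightarrow> complex^'r1^'m::finite \<Rightarrow> ('r2::finite \<Rightarrow> real) \<Rightarrow> complex^'r2^'m \<Rightarrow>
   (((complex^'r1^'n1::finite) \<times> (complex^'r2^'n2::finite)) measure) \<Rightarrow>
   real \<Rightarrow> nat \<Rightarrow> nat \<Rightarrow> nat \<Rightarrow> real \<Rightarrow> bool" where
  "code_exists \<sigma>1 U1 \<sigma>2 U2 PJ \<rho> J L1 L2 \<epsilon> \<longleftrightarrow>
     (\<exists>(enc :: nat \<Rightarrow> nat \<Rightarrow> nat \<Rightarrow> complex^'m)
        (dec1 :: (nat \<Rightarrow> (complex^'m^'n1) \<times> (complex^'n1)) \<Rightarrow> nat)
        (dec2 :: (nat \<Rightarrow> (complex^'m^'n2) \<times> (complex^'n2)) \<Rightarrow> nat).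
       (\<forall>m1<L1. \<forall>m2<L2. (\<Sum>j<J. (norm (enc m1 m2 j))\<^sup>2) / real J \<le> \<rho>) \<and>
       dec1 \<in> PiM {..<J} (\<lambda>_. borel) \<rightarrow>\<^sub>M count_space UNIV \<and>
       dec2 \<in> PiM {..<J} (\<lambda>_. borel) \<rightarrow>\<^sub>M count_space UNIV \<and>
       (let \<Omega> = block_space PJ J;
            E = (\<lambda>m1 m2. {\<omega> \<in> space \<Omega>.
                  dec1 (\<lambda>j\<in>{..<J}. (chan (fst (fst (\<omega> j))) \<sigma>1 U1,
                          chan (fst (fst (\<omega> j))) \<sigma>1 U1 *v enc m1 m2 j + fst (snd (\<omega> j)))) \<noteq> m1 \<or>
                  dec2 (\<lambda>j\<in>{..<J}. (chan (snd (fst (\<omega> j))) \<sigma>2 U2,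
                          chan (snd (fst (\<omega> j))) \<sigma>2 U2 *v enc m1 m2 j + snd (snd (\<omega> j)))) \<noteq> m2})
        in (\<forall>m1<L1. \<forall>m2<L2. E m1 m2 \<in> sets \<Omega>) \<and>
           (\<Sum>m1<L1. \<Sum>m2<L2. measure \<Omega> (E m1 m2)) / (real L1 * real L2) \<le> \<epsilon>))"

definition achievable_rate ::
  "('r1::finite \<Rightarrow> real) \<Rightarrow> complex^'r1^'m::finite \<Rightarrow> ('r2::finite \<Rightarrow> real) \<Rightarrow> complex^'r2^'m \<Rightarrow>
   (((complex^'r1^'n1::finite) \<times> (complex^'r2^'n2::finite)) measure) \<Rightarrow> real \<Rightarrow> real \<times> real \<Rightarrow> bool" where
  "achievable_rate \<sigma>1 U1 \<sigma>2 U2 PJ \<rho> R \<longleftrightarrow>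
     fst R \<ge> 0 \<and> snd R \<ge> 0 \<and>
     (\<forall>\<epsilon>>0. \<exists>J0. \<forall>J\<ge>J0. J > 0 \<longrightarrow>
        (\<exists>L1 L2. real L1 \<ge> exp (real J * fst R) \<and> real L2 \<ge> exp (real J * snd R) \<and>
                 code_exists \<sigma>1 U1 \<sigma>2 U2 PJ \<rho> J L1 L2 \<epsilon>))"

definition capacity_region ::
  "('r1::finite \<Rightarrow> real) \<Rightarrow> complex^'r1^'m::finite \<Rightarrow> ('r2::finite \<Rightarrow> real) \<Rightarrow> complex^'r2^'m \<Rightarrow>
   (((complex^'r1^'n1::finite) \<times> (complex^'r2^'n2::finite)) measure) \<Rightarrow> real \<Rightarrow> (real \<times> real) set" where
  "capacity_region \<sigma>1 U1 \<sigma>2 U2 PJ \<rho> = closure {R. achievable_rate \<sigma>1 U1 \<sigma>2 U2 PJ \<rho> R}"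

definition dof_region ::
  "('r1::finite \<Rightarrow> real) \<Rightarrow> complex^'r1^'m::finite \<Rightarrow> ('r2::finite \<Rightarrow> real) \<Rightarrow> complex^'r2^'m \<Rightarrow>
   (((complex^'r1^'n1::finite) \<times> (complex^'r2^'n2::finite)) measure) \<Rightarrow> (real \<times> real) set" where
  "dof_region \<sigma>1 U1 \<sigma>2 U2 PJ =
     {(d1, d2). \<exists>R :: real \<Rightarrow> real \<times> real.
        (\<forall>\<rho>>0. R \<rho> \<in> capacity_region \<sigma>1 U1 \<sigma>2 U2 PJ \<rho>) \<and>
        ((\<lambda>\<rho>. fst (R \<rho>) / ln \<rho>) \<longlongrightarrow> d1) at_top \<and>
        ((\<lambda>\<rho>. snd (R \<rho>) / ln \<rho>) \<longlongrightarrow> d2) at_top}"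

end

theory Submission
  imports Defs
begin

text \<open>
  Converse, without entropy: conditionally on \<open>G\<close>, an output is a real combination of fixed vectors \<open>B i\<close> plus Gaussian
  noise. Rounding the coefficients to integers moves the output by at most the sum of the \<open>norm (B i)\<close>, which has a finite
  second moment. So every output law is dominated, up to a factor \<open>exp (O(1))\<close> per letter on average, by one measure
  that does not depend on the input: the mixture over integer coefficients of size about \<open>sqrt \<rho>\<close>, of total mass \<open>O(\<rho> powr (k / 2))\<close> for \<open>k\<close> real coefficients. Disjoint decoding
  sets then allow at most \<open>exp (J * (O(1) + k / 2 * ln \<rho>))\<close> codewords. Expanding the output in antenna coordinates or in
  a basis adapted to \<open>Span U1\<close>, \<open>Span U2\<close> and their intersection gives the bounds on \<open>d1\<close>, \<open>d2\<close> and \<open>d1 + d2\<close>.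

  Achievability: send one QAM stream along each vector of the dual basis, so that each user sees only the streams from
  its own span, and protect every stream by a Gilbert--Varshamov code of relative distance \<open>2 / n\<close>. A letter is bad if
  the noise is large or \<open>G\<close> is nearly singular on the visible streams; for fixed \<open>n\<close> the QAM spacing can be chosen,
  independently of \<open>\<rho>\<close>, so that the fraction of bad letters is below \<open>1 / n\<close> with high probability. The loss is a factor
  \<open>1 - 2 / n\<close> in the degrees of freedom, and \<open>n\<close> tends to infinity at the end.
\<close>

section \<open>Noise laws and domination by a fixed measure\<close>

text \<open>Only the marginals of the joint fading law are prescribed. The sum bound therefore lets
  both receivers cooperate under whatever \<open>PJ\<close> is given, and achievability reaches the
  marginals through a union bound. The number \<open>r1 + r2 - r0\<close> is the dimension of the
  sum of the two column spans: both outputs depend on the input through that many complex numbers,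
  each worth two real coefficients and so twice half of \<open>ln \<rho>\<close>. The encoder never
  sees the fading, so interference can be avoided only by fixed directions: the dual vector of a
  basis element outside the span of the other user is invisible to that user. A stream in the
  intersection reaches both users and both decode it; it carries a pair of messages and can be split
  in any proportion. This needs each receiver to invert the fading on its visible streams: either on
  all \<open>r1\<close> and \<open>r2\<close> of them, or on \<open>N1\<close> and \<open>N2\<close>
  private ones, of which \<open>r1 - r0\<close> and \<open>r2 - r0\<close> exist. These are the two
  cases of the theorem. The density of \<open>G\<close> makes failure of this inversion an event of
  small probability.\<close>

text \<open>Dominations multiply over independent coordinates: Fubini separates one coordinate, and
  its bound is applied with the others frozen. Used over the antennas in
  \<open>tame_noise_cnoise\<close> and over the letters of a block in
  \<open>converse_core\<close>.\<close>

lemma nn_integral_PiM_le: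
  fixes P :: "'i \<Rightarrow> 'a measure" and \<mu> :: "'i \<Rightarrow> 'b measure"
  assumes fin: "finite I"
    and P: "\<And>i. sigma_finite_measure (P i)" and \<mu>: "\<And>i. sigma_finite_measure (\<mu> i)"
    and T: "\<And>i. T i \<in> P i \<rightarrow>\<^sub>M \<mu> i" and k: "\<And>i. k i \<in> borel_measurable (P i)"
    and le: "\<And>i f. i \<in> I \<Longrightarrow> f \<in> borel_measurable (\<mu> i) \<Longrightarrow>
      (\<integral>\<^sup>+x. f (T i x) * k i x \<partial>P i) \<le> (\<integral>\<^sup>+y. f y \<partial>\<mu> i)"
    and F: "F \<in> borel_measurable (PiM I \<mu>)"
  shows "(\<integral>\<^sup>+x. F (\<lambda>i\<in>I. T i (x i)) * (\<Prod>i\<in>I. k i (x i)) \<partial>PiM I P) \<le> (\<integral>\<^sup>+y. F y \<partial>PiM I \<mu>)"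
  using fin le F
proof (induction I arbitrary: F rule: finite_induct)
  case empty
  show ?case by (simp add: PiM_empty nn_integral_count_space_finite restrict_def)
next
  case (insert i I)
  interpret P: product_sigma_finite P using P by unfold_locales (auto simp: sigma_finite_measure_def)
  interpret M: product_sigma_finite \<mu> using \<mu> by unfold_locales (auto simp: sigma_finite_measure_def)
  note [measurable] = T k insert.prems(2)
  interpret Pi: sigma_finite_measure "P i" by (rule P)
  interpret Mi: sigma_finite_measure "\<mu> i" by (rule \<mu>)
  have prod_eq: "(\<Prod>l\<in>insert i I. k l ((x(i := y)) l)) = (\<Prod>l\<in>I. k l (x l)) * k i y" for x y
  proof -
    have "(\<Prod>l\<in>I. k l ((x(i := y)) l)) = (\<Prod>l\<in>I. k l (x l))"
      by (rule prod.cong) (use insert.hyps in auto)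
    then show ?thesis using insert.hyps by (simp add: mult.commute)
  qed
  have res_eq: "(\<lambda>l\<in>insert i I. T l ((x(i := y)) l)) = (\<lambda>l\<in>I. T l (x l))(i := T i y)" for x y
    using insert.hyps by (auto simp: fun_eq_iff)
  have m1: "(\<lambda>(z, y). F (z(i := y))) \<in> borel_measurable (PiM I \<mu> \<Otimes>\<^sub>M \<mu> i)"
    by measurable
  have "(\<integral>\<^sup>+x. F (\<lambda>l\<in>insert i I. T l (x l)) * (\<Prod>l\<in>insert i I. k l (x l)) \<partial>PiM (insert i I) P)
      = (\<integral>\<^sup>+x. \<integral>\<^sup>+y. F (\<lambda>l\<in>insert i I. T l ((x(i:=y)) l)) * (\<Prod>l\<in>insert i I. k l ((x(i:=y)) l)) \<partial>P i \<partial>PiM I P)"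
    by (rule P.product_nn_integral_insert[OF insert.hyps]) measurable
  also have "\<dots> = (\<integral>\<^sup>+x. \<integral>\<^sup>+y. (F ((\<lambda>l\<in>I. T l (x l))(i := T i y)) * k i y) * (\<Prod>l\<in>I. k l (x l)) \<partial>P i \<partial>PiM I P)"
    by (simp only: prod_eq res_eq ac_simps)
  also have "\<dots> = (\<integral>\<^sup>+x. (\<integral>\<^sup>+y. F ((\<lambda>l\<in>I. T l (x l))(i := T i y)) * k i y \<partial>P i) * (\<Prod>l\<in>I. k l (x l)) \<partial>PiM I P)"
  proof (intro nn_integral_cong nn_integral_multc)
    fix x assume "x \<in> space (PiM I P)"
    then have [measurable]: "(\<lambda>l\<in>I. T l (x l)) \<in> space (PiM I \<mu>)"
      using T by (auto simp: space_PiM PiE_iff intro: measurable_space)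
    show "(\<lambda>y. F ((\<lambda>l\<in>I. T l (x l))(i := T i y)) * k i y) \<in> borel_measurable (P i)"
      by measurable
  qed
  also have "\<dots> \<le> (\<integral>\<^sup>+x. (\<integral>\<^sup>+y. F ((\<lambda>l\<in>I. T l (x l))(i := y)) \<partial>\<mu> i) * (\<Prod>l\<in>I. k l (x l)) \<partial>PiM I P)"
  proof (intro nn_integral_mono mult_right_mono)
    fix x assume "x \<in> space (PiM I P)"
    then have [measurable]: "(\<lambda>l\<in>I. T l (x l)) \<in> space (PiM I \<mu>)"
      using T by (auto simp: space_PiM PiE_iff intro: measurable_space)
    show "(\<integral>\<^sup>+y. F ((\<lambda>l\<in>I. T l (x l))(i := T i y)) * k i y \<partial>P i) \<le> (\<integral>\<^sup>+y. F ((\<lambda>l\<in>I. T l (x l))(i := y)) \<partial>\<mu> i)"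
      by (rule insert.prems(1)[where f="\<lambda>y. F ((\<lambda>l\<in>I. T l (x l))(i := y))"]) (simp, measurable)
  qed simp
  also have "\<dots> \<le> (\<integral>\<^sup>+z. (\<integral>\<^sup>+y. F (z(i := y)) \<partial>\<mu> i) \<partial>PiM I \<mu>)"
  proof (rule insert.IH)
    show "(\<lambda>z. \<integral>\<^sup>+y. F (z(i := y)) \<partial>\<mu> i) \<in> borel_measurable (PiM I \<mu>)"
      using m1 by measurable
  qed (use insert.prems in auto)
  also have "\<dots> = (\<integral>\<^sup>+y. F y \<partial>PiM (insert i I) \<mu>)"
    by (rule M.product_nn_integral_insert[OF insert.hyps, symmetric]) measurable
  finally show ?case .
qed

text \<open>For variance \<open>1 / 2\<close> the density is proportional to
  \<open>exp (- y\<^sup>2)\<close>, and the weight squares this factor. The squared Gaussian is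
  narrower than the original one, so any translate of it fits below a constant multiple of the
  original.\<close>

lemma exp_normal_shift:
  fixes f :: "real \<Rightarrow> ennreal"
  assumes [measurable]: "f \<in> borel_measurable borel"
  defines "N \<equiv> density lborel (normal_density 0 (sqrt (1/2)))"
  shows "(\<integral>\<^sup>+w. f (w + a) * ennreal (exp (- w\<^sup>2)) \<partial>N) \<le> ennreal (exp (2 * a\<^sup>2)) * (\<integral>\<^sup>+w. f w \<partial>N)"
proof -
  let ?d = "normal_density 0 (sqrt (1/2))"
  have le: "?d (y - a) * exp (- (y - a)\<^sup>2) \<le> exp (2 * a\<^sup>2) * ?d y" for y
  proof -
    \<comment> \<open>Completing the square: \<open>2 * (y - a)\<^sup>2 + 2 * a\<^sup>2 - y\<^sup>2
      = (y - 2 * a)\<^sup>2\<close>.\<close>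
    have "exp (- (y-a)\<^sup>2) * exp (- (y - a)\<^sup>2) \<le> exp (2 * a\<^sup>2) * exp (- y\<^sup>2)"
      unfolding exp_add[symmetric] exp_le_cancel_iff
      using zero_le_power2[of "y - 2 * a"] by (simp add: power2_eq_square algebra_simps)
    then have "exp (- (y-a)\<^sup>2) * exp (- (y - a)\<^sup>2) / sqrt pi \<le> exp (2 * a\<^sup>2) * exp (- y\<^sup>2) / sqrt pi"
      by (rule divide_right_mono) simp
    then show ?thesis by (simp add: normal_density_def power_divide)
  qed
  have "(\<integral>\<^sup>+w. f (w + a) * ennreal (exp (- w\<^sup>2)) \<partial>N) = (\<integral>\<^sup>+w. ennreal (?d w) * (f (w + a) * ennreal (exp (- w\<^sup>2))) \<partial>lborel)"
    unfolding N_def by (subst nn_integral_density) auto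
  also have "\<dots> = (\<integral>\<^sup>+w. ennreal (?d w) * (f (w + a) * ennreal (exp (- w\<^sup>2))) \<partial>distr lborel borel ((+) (-a)))"
    by (simp only: lborel_distr_plus)
  also have "\<dots> = (\<integral>\<^sup>+y. ennreal (?d (y - a)) * (f y * ennreal (exp (- (y - a)\<^sup>2))) \<partial>lborel)"
    by (subst nn_integral_distr) (auto)
  also have "\<dots> \<le> (\<integral>\<^sup>+y. ennreal (exp (2 * a\<^sup>2)) * (ennreal (?d y) * f y) \<partial>lborel)"
  proof (rule nn_integral_mono)
    fix y
    have "ennreal (?d (y - a)) * (f y * ennreal (exp (- (y - a)\<^sup>2))) = ennreal (?d (y - a) * exp (- (y - a)\<^sup>2)) * f y"
      by (simp add: ennreal_mult ac_simps)
    also have "\<dots> \<le> ennreal (exp (2 * a\<^sup>2) * ?d y) * f y"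
      by (intro mult_right_mono ennreal_leI le) simp
    finally show "ennreal (?d (y - a)) * (f y * ennreal (exp (- (y - a)\<^sup>2))) \<le> ennreal (exp (2 * a\<^sup>2)) * (ennreal (?d y) * f y)"
      by (simp add: ennreal_mult ac_simps)
  qed
  also have "\<dots> = ennreal (exp (2 * a\<^sup>2)) * (\<integral>\<^sup>+w. f w \<partial>N)"
    unfolding N_def by (subst nn_integral_density) (auto simp: nn_integral_cmult)
  finally show ?thesis .
qed

text \<open>The factor \<open>exp (- (norm w)\<^sup>2)\<close> makes a shift by \<open>a\<close> cost only a constant; the Gaussian density itself is not
  comparable with its translates.\<close>
definition tame_noise :: "'e::euclidean_space measure \<Rightarrow> bool" where
  "tame_noise \<nu> \<longleftrightarrow> prob_space \<nu> \<and> sets \<nu> = sets borel \<and>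
     (\<integral>\<^sup>+w. ennreal ((norm w)\<^sup>2) \<partial>\<nu>) < \<infinity> \<and>
     (\<forall>a. \<forall>f \<in> borel_measurable borel.
        (\<integral>\<^sup>+w. f (w + a) * ennreal (exp (- (norm w)\<^sup>2)) \<partial>\<nu>) \<le> ennreal (exp (2 * (norm a)\<^sup>2)) * (\<integral>\<^sup>+w. f w \<partial>\<nu>))"

lemma tame_noiseD:
  assumes "tame_noise \<nu>" "f \<in> borel_measurable borel"
  shows "(\<integral>\<^sup>+w. f (w + a) * ennreal (exp (- (norm w)\<^sup>2)) \<partial>\<nu>) \<le> ennreal (exp (2 * (norm a)\<^sup>2)) * (\<integral>\<^sup>+w. f w \<partial>\<nu>)"
  using assms unfolding tame_noise_def by blast

lemma tame_noise_normal: "tame_noise (density lborel (normal_density 0 (sqrt (1/2))))"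
proof -
  have "has_bochner_integral lborel (\<lambda>x. normal_density 0 (sqrt (1/2)) x * (x - 0) ^ (2 * 1)) (fact (2 * 1) / ((2 / (sqrt (1/2))\<^sup>2) ^ 1 * fact 1))"
    by (rule normal_moment_even) simp
  then have i: "integrable lborel (\<lambda>x. normal_density 0 (sqrt (1/2)) x * x\<^sup>2)"
    by (auto dest: integrable.intros)
  have "(\<integral>\<^sup>+w. ennreal ((norm w)\<^sup>2) \<partial>density lborel (normal_density 0 (sqrt (1/2)))) =
     (\<integral>\<^sup>+x. ennreal (normal_density 0 (sqrt (1/2)) x * x\<^sup>2) \<partial>lborel)"
    by (subst nn_integral_density) (auto simp: ennreal_mult)
  also have "\<dots> < \<infinity>"
    using i by (simp add: integrable_iff_bounded)
  finally show ?thesis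
    unfolding tame_noise_def using exp_normal_shift prob_space_normal_density[of "sqrt (1/2)" 0] by auto
qed

text \<open>The norm of a pair is Euclidean, so the weight and the constant
  \<open>exp (2 * (norm a)\<^sup>2)\<close> both factor over the components; the two shift
  inequalities are applied one after the other under Fubini.\<close>

lemma tame_noise_Pair:
  fixes \<mu> :: "'a::euclidean_space measure" and \<nu> :: "'b::euclidean_space measure"
  assumes \<mu>: "tame_noise \<mu>" and \<nu>: "tame_noise \<nu>"
  shows "tame_noise (\<mu> \<Otimes>\<^sub>M \<nu>)"
proof -
  interpret M: prob_space \<mu> using \<mu> by (simp add: tame_noise_def)
  interpret N: prob_space \<nu> using \<nu> by (simp add: tame_noise_def)
  interpret pair_prob_space \<mu> \<nu> ..
  have [measurable_cong, simp]: "sets \<mu> = sets borel" "sets \<nu> = sets borel"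
    using \<mu> \<nu> by (auto simp: tame_noise_def)
  have sets: "sets (\<mu> \<Otimes>\<^sub>M \<nu>) = sets borel"
    by (simp add: borel_prod[symmetric] cong: sets_pair_measure_cong)
  have nm: "(\<lambda>w :: 'a \<times> 'b. norm w) \<in> borel_measurable (borel \<Otimes>\<^sub>M borel)"
    by (simp add: borel_prod)
  have [measurable]: "(\<lambda>w. norm w) \<in> borel_measurable (\<mu> \<Otimes>\<^sub>M \<nu>)"
    using nm by (simp cong: measurable_cong_sets add: sets)
  have "(\<integral>\<^sup>+w. ennreal ((norm w)\<^sup>2) \<partial>(\<mu> \<Otimes>\<^sub>M \<nu>)) = (\<integral>\<^sup>+x. \<integral>\<^sup>+y. ennreal ((norm x)\<^sup>2) + ennreal ((norm y)\<^sup>2) \<partial>\<nu> \<partial>\<mu>)"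
    by (subst N.nn_integral_fst[symmetric]) (simp_all add: norm_Pair ennreal_plus)
  also have "\<dots> = (\<integral>\<^sup>+x. ennreal ((norm x)\<^sup>2) \<partial>\<mu>) + (\<integral>\<^sup>+y. ennreal ((norm y)\<^sup>2) \<partial>\<nu>)"
    by (simp add: nn_integral_add M.emeasure_space_1 N.emeasure_space_1)
  also have "\<dots> < \<infinity>" using \<mu> \<nu> by (simp add: tame_noise_def)
  finally have 1: "(\<integral>\<^sup>+w. ennreal ((norm w)\<^sup>2) \<partial>(\<mu> \<Otimes>\<^sub>M \<nu>)) < \<infinity>" .
  have 2: "(\<integral>\<^sup>+w. f (w + a) * ennreal (exp (- (norm w)\<^sup>2)) \<partial>(\<mu> \<Otimes>\<^sub>M \<nu>)) \<le> ennreal (exp (2 * (norm a)\<^sup>2)) * (\<integral>\<^sup>+w. f w \<partial>(\<mu> \<Otimes>\<^sub>M \<nu>))"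
    if f: "f \<in> borel_measurable borel" for a and f :: "'a \<times> 'b \<Rightarrow> ennreal"
  proof -
    have [measurable]: "f \<in> borel_measurable (borel \<Otimes>\<^sub>M borel)" using f by (simp add: borel_prod)
    obtain a1 a2 where a: "a = (a1, a2)" by (cases a)
    have "(\<integral>\<^sup>+w. f (w + a) * ennreal (exp (- (norm w)\<^sup>2)) \<partial>(\<mu> \<Otimes>\<^sub>M \<nu>)) =
       (\<integral>\<^sup>+x. \<integral>\<^sup>+y. f (x + a1, y + a2) * ennreal (exp (- (norm y)\<^sup>2)) * ennreal (exp (- (norm x)\<^sup>2)) \<partial>\<nu> \<partial>\<mu>)"
    proof (subst N.nn_integral_fst[symmetric])
      have "(\<lambda>w. f (w + a)) \<in> borel_measurable borel" using f by measurable
      then have [measurable]: "(\<lambda>w. f (w + a)) \<in> borel_measurable (\<mu> \<Otimes>\<^sub>M \<nu>)"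
        by (subst measurable_cong_sets[OF sets refl])
      show "(\<lambda>w. f (w + a) * ennreal (exp (- (norm w)\<^sup>2))) \<in> borel_measurable (\<mu> \<Otimes>\<^sub>M \<nu>)"
        by measurable
    qed (simp add: norm_Pair a exp_add exp_minus ennreal_mult exp_diff divide_inverse ac_simps)
    also have "\<dots> = (\<integral>\<^sup>+x. (\<integral>\<^sup>+y. f (x + a1, y + a2) * ennreal (exp (- (norm y)\<^sup>2)) \<partial>\<nu>) * ennreal (exp (- (norm x)\<^sup>2)) \<partial>\<mu>)"
      by (intro nn_integral_cong nn_integral_multc) measurable
    also have "\<dots> \<le> (\<integral>\<^sup>+x. (ennreal (exp (2 * (norm a2)\<^sup>2)) * (\<integral>\<^sup>+y. f (x + a1, y) \<partial>\<nu>)) * ennreal (exp (- (norm x)\<^sup>2)) \<partial>\<mu>)"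
    proof (intro nn_integral_mono mult_right_mono)
      fix x
      have "(\<lambda>y. f (x + a1, y)) \<in> borel_measurable borel" by measurable
      then show "(\<integral>\<^sup>+y. f (x + a1, y + a2) * ennreal (exp (- (norm y)\<^sup>2)) \<partial>\<nu>) \<le> ennreal (exp (2 * (norm a2)\<^sup>2)) * (\<integral>\<^sup>+y. f (x + a1, y) \<partial>\<nu>)"
        by (rule tame_noiseD[OF \<nu>])
    qed simp
    also have "\<dots> = ennreal (exp (2 * (norm a2)\<^sup>2)) * (\<integral>\<^sup>+x. (\<integral>\<^sup>+y. f (x + a1, y) \<partial>\<nu>) * ennreal (exp (- (norm x)\<^sup>2)) \<partial>\<mu>)"
      by (subst nn_integral_cmult[symmetric]) (measurable, simp add: ac_simps)
    also have "\<dots> \<le> ennreal (exp (2 * (norm a2)\<^sup>2)) * (ennreal (exp (2 * (norm a1)\<^sup>2)) * (\<integral>\<^sup>+x. \<integral>\<^sup>+y. f (x, y) \<partial>\<nu> \<partial>\<mu>))"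
    proof (intro mult_left_mono)
      have "(\<lambda>x. \<integral>\<^sup>+y. f (x, y) \<partial>\<nu>) \<in> borel_measurable borel" by measurable
      then show "(\<integral>\<^sup>+x. (\<integral>\<^sup>+y. f (x + a1, y) \<partial>\<nu>) * ennreal (exp (- (norm x)\<^sup>2)) \<partial>\<mu>) \<le> ennreal (exp (2 * (norm a1)\<^sup>2)) * (\<integral>\<^sup>+x. \<integral>\<^sup>+y. f (x, y) \<partial>\<nu> \<partial>\<mu>)"
        by (rule tame_noiseD[OF \<mu>])
    qed simp
    also have "\<dots> = ennreal (exp (2 * (norm a)\<^sup>2)) * (\<integral>\<^sup>+w. f w \<partial>(\<mu> \<Otimes>\<^sub>M \<nu>))"
      by (subst N.nn_integral_fst) (auto simp: a norm_Pair distrib_left exp_add ennreal_mult ac_simps)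
    finally show ?thesis .
  qed
  show ?thesis unfolding tame_noise_def using sets 1 2 prob_space_axioms by auto
qed

text \<open>Surjectivity pulls a shift of the image back to a shift of the source, and all norms
  involved are preserved. This carries a pair of real normals to \<open>cgauss\<close>.\<close>

lemma tame_noise_distr_isometry:
  fixes \<mu> :: "'a::euclidean_space measure" and h :: "'a \<Rightarrow> 'b::euclidean_space"
  assumes \<mu>: "tame_noise \<mu>" and h: "linear h" "\<And>x. norm (h x) = norm x" "surj h"
  shows "tame_noise (distr \<mu> borel h)"
proof -
  interpret M: prob_space \<mu> using \<mu> by (simp add: tame_noise_def)
  have [measurable_cong, simp]: "sets \<mu> = sets borel" using \<mu> by (auto simp: tame_noise_def)
  have [measurable]: "h \<in> borel_measurable borel"
    by (intro borel_measurable_continuous_onI linear_continuous_on) (simp add: h(1) linear_conv_bounded_linear[symmetric])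
  have "prob_space (distr \<mu> borel h)" by (rule M.prob_space_distr) measurable
  moreover have "(\<integral>\<^sup>+w. ennreal ((norm w)\<^sup>2) \<partial>distr \<mu> borel h) < \<infinity>"
    using \<mu> by (simp add: nn_integral_distr h tame_noise_def)
  moreover have "(\<integral>\<^sup>+w. f (w + a) * ennreal (exp (- (norm w)\<^sup>2)) \<partial>distr \<mu> borel h)
      \<le> ennreal (exp (2 * (norm a)\<^sup>2)) * (\<integral>\<^sup>+w. f w \<partial>distr \<mu> borel h)"
    if [measurable]: "f \<in> borel_measurable borel" for a f
  proof -
    obtain b where b: "a = h b" using h(3) by (metis surjD)
    have "(\<lambda>w. f (h w)) \<in> borel_measurable borel" by measurable
    then have "(\<integral>\<^sup>+w. f (h (w + b)) * ennreal (exp (- (norm w)\<^sup>2)) \<partial>\<mu>) \<le> ennreal (exp (2 * (norm b)\<^sup>2)) * (\<integral>\<^sup>+w. f (h w) \<partial>\<mu>)"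
      by (rule tame_noiseD[OF \<mu>])
    then show ?thesis by (simp add: nn_integral_distr b h linear_add[OF h(1)])
  qed
  ultimately show ?thesis by (simp add: tame_noise_def)
qed

lemma tame_noise_cgauss: "tame_noise cgauss"
  unfolding cgauss_def
  by (intro tame_noise_distr_isometry tame_noise_Pair tame_noise_normal)
     (auto intro!: linearI simp: complex_eq_iff cmod_def norm_Pair surj_def)

text \<open>Squared norms add over the entries, so the inequality for \<open>cgauss\<close> is
  multiplied over the antennas by \<open>nn_integral_PiM_le\<close>.\<close>

lemma tame_noise_cnoise: "tame_noise (cnoise :: (complex^'n::finite) measure)"
proof -
  interpret C: prob_space cgauss using tame_noise_cgauss by (simp add: tame_noise_def)
  have [measurable_cong, simp]: "sets cgauss = sets borel" using tame_noise_cgauss by (auto simp: tame_noise_def)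
  interpret P: product_prob_space "\<lambda>_::'n. cgauss" UNIV ..
  have [measurable]: "(\<lambda>w. \<chi> i. w i) \<in> PiM UNIV (\<lambda>_::'n. cgauss) \<rightarrow>\<^sub>M borel"
    by (subst borel_measurable_euclidean_space) (auto simp: Basis_vec_def inner_axis)
  have nrm: "(norm w)\<^sup>2 = (\<Sum>i\<in>UNIV. (norm (w $ i))\<^sup>2)" for w :: "complex^'n"
    by (simp add: norm_vec_def L2_set_def sum_nonneg)
  have enrm: "ennreal ((norm w)\<^sup>2) = (\<Sum>i\<in>UNIV. ennreal ((norm (w $ i))\<^sup>2))" for w :: "complex^'n"
    by (simp add: nrm)
  have "(\<integral>\<^sup>+w. ennreal ((norm w)\<^sup>2) \<partial>(cnoise :: (complex^'n) measure)) =
     (\<Sum>i\<in>UNIV. \<integral>\<^sup>+w. ennreal ((norm (w i))\<^sup>2) \<partial>PiM UNIV (\<lambda>_::'n. cgauss))"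
    unfolding cnoise_def
    by (subst nn_integral_distr, measurable) (subst enrm, simp add: nn_integral_sum[symmetric])
  also have "\<dots> = (\<Sum>i\<in>(UNIV::'n set). \<integral>\<^sup>+w. ennreal ((norm w)\<^sup>2) \<partial>cgauss)"
  proof (rule sum.cong)
    fix i :: 'n
    have "(\<integral>\<^sup>+w. ennreal ((norm w)\<^sup>2) \<partial>distr (PiM UNIV (\<lambda>_::'n. cgauss)) cgauss (\<lambda>w. w i)) = (\<integral>\<^sup>+w. ennreal ((norm (w i))\<^sup>2) \<partial>PiM UNIV (\<lambda>_::'n. cgauss))"
      by (rule nn_integral_distr) auto
    then show "(\<integral>\<^sup>+w. ennreal ((norm (w i))\<^sup>2) \<partial>PiM UNIV (\<lambda>_::'n. cgauss)) = (\<integral>\<^sup>+w. ennreal ((norm w)\<^sup>2) \<partial>cgauss)"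
      by (simp add: P.PiM_component)
  qed simp
  also have "\<dots> < \<infinity>" using tame_noise_cgauss by (simp add: tame_noise_def ennreal_mult_less_top of_nat_less_top)
  finally have 1: "(\<integral>\<^sup>+w. ennreal ((norm w)\<^sup>2) \<partial>(cnoise :: (complex^'n) measure)) < \<infinity>" .
  have 2: "(\<integral>\<^sup>+w. f (w + a) * ennreal (exp (- (norm w)\<^sup>2)) \<partial>cnoise) \<le> ennreal (exp (2 * (norm a)\<^sup>2)) * (\<integral>\<^sup>+w. f w \<partial>cnoise)"
    if [measurable]: "f \<in> borel_measurable borel" for a and f :: "complex^'n \<Rightarrow> ennreal"
  proof -
    let ?P = "PiM UNIV (\<lambda>_::'n. cgauss)"
    \<comment> \<open>The product lemma asks for a one-coordinate inequality with constant 1, so the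
      cost of the shift of each entry is moved into the weight.\<close>
    have le: "(\<integral>\<^sup>+w. f (\<chi> i. (\<lambda>i\<in>UNIV. w i + a $ i) i) * (\<Prod>i\<in>UNIV. ennreal (exp (- (norm (w i))\<^sup>2 - 2 * (norm (a $ i))\<^sup>2))) \<partial>?P) \<le> (\<integral>\<^sup>+w. f (\<chi> i. w i) \<partial>?P)"
    proof (rule nn_integral_PiM_le[where F="\<lambda>w. f (\<chi> i. w i)" and T="\<lambda>i x. x + a $ i"])
      show "(\<lambda>x. x + a $ i) \<in> cgauss \<rightarrow>\<^sub>M cgauss" for i by measurable
      show "(\<integral>\<^sup>+x. g (x + a $ i) * ennreal (exp (- (norm x)\<^sup>2 - 2 * (norm (a $ i))\<^sup>2)) \<partial>cgauss) \<le> (\<integral>\<^sup>+y. g y \<partial>cgauss)"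
        if "g \<in> borel_measurable cgauss" for i g
      proof -
        have [measurable]: "g \<in> borel_measurable borel" using that by simp
        have "(\<integral>\<^sup>+x. g (x + a $ i) * ennreal (exp (- (norm x)\<^sup>2 - 2 * (norm (a $ i))\<^sup>2)) \<partial>cgauss)
          = (\<integral>\<^sup>+x. (g (x + a $ i) * ennreal (exp (- (norm x)\<^sup>2))) * ennreal (exp (- (2 * (norm (a $ i))\<^sup>2))) \<partial>cgauss)"
          by (simp add: exp_diff exp_minus ennreal_mult divide_inverse ac_simps)
        also have "\<dots> = (\<integral>\<^sup>+x. g (x + a $ i) * ennreal (exp (- (norm x)\<^sup>2)) \<partial>cgauss) * ennreal (exp (- (2 * (norm (a $ i))\<^sup>2)))"
          by (rule nn_integral_multc) measurable
        also have "\<dots> \<le> (ennreal (exp (2 * (norm (a $ i))\<^sup>2)) * (\<integral>\<^sup>+w. g w \<partial>cgauss)) * ennreal (exp (- (2 * (norm (a $ i))\<^sup>2)))"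
          by (intro mult_right_mono tame_noiseD[OF tame_noise_cgauss]) auto
        also have "\<dots> = (ennreal (exp (2 * (norm (a $ i))\<^sup>2) * exp (- (2 * (norm (a $ i))\<^sup>2)))) * (\<integral>\<^sup>+w. g w \<partial>cgauss)"
          by (simp add: ennreal_mult ac_simps)
        finally show ?thesis by (simp add: exp_minus)
      qed
    qed (auto intro: C.sigma_finite_measure_axioms)
    have pr: "(\<Prod>i\<in>UNIV. ennreal (exp (- (norm (w i))\<^sup>2 - 2 * (norm (a $ i))\<^sup>2))) =
       ennreal (exp (- (norm (\<chi> i. w i))\<^sup>2)) * ennreal (exp (- (2 * (norm a)\<^sup>2)))" for w :: "'n \<Rightarrow> complex"
    proof -
      have "(\<Prod>i\<in>UNIV. ennreal (exp (- (norm (w i))\<^sup>2 - 2 * (norm (a $ i))\<^sup>2))) =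
          ennreal (exp (\<Sum>i\<in>UNIV. - (norm (w i))\<^sup>2 - 2 * (norm (a $ i))\<^sup>2))"
        by (simp add: prod_ennreal exp_sum)
      also have "(\<Sum>i\<in>UNIV. - (norm (w i))\<^sup>2 - 2 * (norm (a $ i))\<^sup>2) = - (norm (\<chi> i. w i))\<^sup>2 + - (2 * (norm a)\<^sup>2)"
        by (simp add: nrm sum_subtractf sum_negf sum_distrib_left)
      finally show ?thesis by (simp only: exp_add ennreal_mult exp_ge_zero)
    qed
    have vecadd: "(\<chi> i. (\<lambda>i\<in>UNIV. w i + a $ i) i) = (\<chi> i. w i) + a" for w by (simp add: vec_eq_iff)
    have "(\<integral>\<^sup>+w. f (w + a) * ennreal (exp (- (norm w)\<^sup>2)) \<partial>cnoise) * ennreal (exp (- (2 * (norm a)\<^sup>2)))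
      = (\<integral>\<^sup>+w. f ((\<chi> i. w i) + a) * ennreal (exp (- (norm (\<chi> i. w i))\<^sup>2)) * ennreal (exp (- (2 * (norm a)\<^sup>2))) \<partial>?P)"
      unfolding cnoise_def by (subst nn_integral_distr) (auto simp: nn_integral_multc)
    also have "\<dots> \<le> (\<integral>\<^sup>+w. f w \<partial>cnoise)"
      using le unfolding pr vecadd cnoise_def by (subst nn_integral_distr) (auto simp: ac_simps)
    finally have "ennreal (exp (2 * (norm a)\<^sup>2)) * ((\<integral>\<^sup>+w. f (w + a) * ennreal (exp (- (norm w)\<^sup>2)) \<partial>cnoise) * ennreal (exp (- (2 * (norm a)\<^sup>2)))) \<le> ennreal (exp (2 * (norm a)\<^sup>2)) * (\<integral>\<^sup>+w. f w \<partial>cnoise)"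
      by (rule mult_left_mono) simp
    moreover have "ennreal (exp (2 * (norm a)\<^sup>2)) * (X * ennreal (exp (- (2 * (norm a)\<^sup>2)))) = X" for X
    proof -
      have "ennreal (exp (2 * (norm a)\<^sup>2)) * (X * ennreal (exp (- (2 * (norm a)\<^sup>2)))) = ennreal (exp (2 * (norm a)\<^sup>2) * exp (- (2 * (norm a)\<^sup>2))) * X"
        by (simp add: ennreal_mult ac_simps)
      then show ?thesis by (simp add: exp_minus)
    qed
    ultimately show ?thesis by simp
  qed
  have "prob_space (cnoise :: (complex^'n) measure)" unfolding cnoise_def by (rule P.prob_space_distr) measurable
  moreover have "sets (cnoise :: (complex^'n) measure) = sets borel" by (simp add: cnoise_def)
  ultimately show ?thesis unfolding tame_noise_def using 1 2 by blast
qed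

section \<open>Integer mixtures that dominate every output law\<close>

text \<open>Left unnormalised: what matters is the weight of single atoms and that the total mass is
  of order \<open>\<tau>\<close>.\<close>

definition geom_int :: "real \<Rightarrow> int measure" where
  "geom_int \<tau> = density (count_space UNIV) (\<lambda>n. ennreal (exp (- \<bar>of_int n\<bar> / \<tau>)))"

lemma sets_geom_int [measurable_cong, simp]: "sets (geom_int \<tau>) = sets (count_space UNIV)"
  by (simp add: geom_int_def)

lemma space_geom_int [simp]: "space (geom_int \<tau>) = UNIV"
  by (simp add: geom_int_def)

lemma emeasure_geom_int_singleton: "emeasure (geom_int \<tau>) {n} = ennreal (exp (- \<bar>of_int n\<bar> / \<tau>))"
  by (simp add: geom_int_def emeasure_density nn_integral_count_space_indicator[symmetric])

lemma emeasure_geom_int_UNIV: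
  assumes "\<tau> > 0"
  shows "emeasure (geom_int \<tau>) UNIV \<le> ennreal (2 * (1 + \<tau>))"
proof -
  define f where "f n = ennreal (exp (- \<bar>of_int n\<bar> / \<tau>))" for n :: int
  define q where "q = exp (- 1 / \<tau>)"
  have q: "0 < q" "q < 1" using assms by (auto simp: q_def)
  \<comment> \<open>This elementary bound turns the geometric sum \<open>1 / (1 - q)\<close> into at
    most \<open>1 + \<tau>\<close>.\<close>
  have "1 + 1 / \<tau> \<le> exp (1 / \<tau>)" by simp
  then have "q \<le> 1 / (1 + 1 / \<tau>)"
    using assms by (simp add: q_def exp_minus field_simps)
  also have "\<dots> = 1 - 1 / (1 + \<tau>)" using assms by (simp add: field_simps)
  finally have "1 / (1 + \<tau>) \<le> 1 - q" by simp
  then have q1: "1 / (1 - q) \<le> 1 + \<tau>" using assms q by (simp add: field_simps)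
  have "exp (- real n / \<tau>) = q ^ n" for n
    by (simp add: q_def exp_of_nat_mult[symmetric])
  then have sm: "(\<Sum>n. f (int n)) = ennreal (1 / (1 - q))"
    unfolding f_def using q by (intro suminf_ennreal_eq) (auto intro: geometric_sums)
  have half: "(\<integral>\<^sup>+n. f n * indicator (range g) n \<partial>count_space UNIV) \<le> ennreal (1 + \<tau>)"
    if g: "inj g" "\<And>n. f (g n) = f (int n)" for g :: "nat \<Rightarrow> int"
  proof -
    have "(\<integral>\<^sup>+n. f n * indicator (range g) n \<partial>count_space UNIV) = (\<integral>\<^sup>+n. f n \<partial>count_space (range g))"
      by (simp add: nn_integral_count_space_indicator)
    also have "\<dots> = (\<integral>\<^sup>+n. f (g n) \<partial>count_space UNIV)"
      using g by (intro nn_integral_bij_count_space[symmetric]) (simp add: bij_betw_def)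
    also have "\<dots> = ennreal (1 / (1 - q))" by (simp add: g nn_integral_count_space_nat sm)
    finally show ?thesis using q1 by (simp add: ennreal_leI)
  qed
  have "emeasure (geom_int \<tau>) UNIV = (\<integral>\<^sup>+n. f n \<partial>count_space UNIV)"
    by (simp add: geom_int_def emeasure_density f_def)
  \<comment> \<open>Two half-lines cover the integers; zero is counted twice, hence only an
    inequality.\<close>
  also have "\<dots> \<le> (\<integral>\<^sup>+n. f n * indicator (range int) n + f n * indicator (range (\<lambda>n. - int n)) n \<partial>count_space UNIV)"
  proof (rule nn_integral_mono)
    fix n :: int
    show "f n \<le> f n * indicator (range int) n + f n * indicator (range (\<lambda>n. - int n)) n"
    proof (cases "n \<ge> 0")
      case True then have "n \<in> range int" by (metis rangeI zero_le_imp_eq_int)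
      then show ?thesis by simp
    next
      case False then have "n \<in> range (\<lambda>n. - int n)" by (intro image_eqI[of _ _ "nat (- n)"]) auto
      then show ?thesis by simp
    qed
  qed
  also have "\<dots> = (\<integral>\<^sup>+n. f n * indicator (range int) n \<partial>count_space UNIV) + (\<integral>\<^sup>+n. f n * indicator (range (\<lambda>n. - int n)) n \<partial>count_space UNIV)"
    by (rule nn_integral_add) auto
  also have "\<dots> \<le> ennreal (1 + \<tau>) + ennreal (1 + \<tau>)"
    by (intro add_mono half) (auto simp: f_def inj_def)
  also have "\<dots> = ennreal (2 * (1 + \<tau>))" using assms by (simp flip: ennreal_plus)
  finally show ?thesis .
qed

lemma finite_measure_geom_int: "\<tau> > 0 \<Longrightarrow> finite_measure (geom_int \<tau>)"
  using emeasure_geom_int_UNIV[of \<tau>] by (intro finite_measureI) (auto simp: top_unique)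

lemma le_one_plus_square: "(x::real) \<le> 1 + x\<^sup>2"
proof -
  have "0 \<le> (x - 1)\<^sup>2 + x\<^sup>2 + 1" by (intro add_nonneg_nonneg) auto
  then show ?thesis by (simp add: power2_eq_square algebra_simps)
qed

text \<open>The integer coefficients are drawn from \<open>geom_int\<close> with scale \<open>sqrt \<rho>\<close>; rounding \<open>v i G\<close> towards an integer picks the
  component of the mixture that dominates.\<close>
lemma one_letter_domination:
  fixes PQ :: "'g measure" and \<nu> :: "'e::euclidean_space measure" and I :: "'i set"
  assumes PQ: "prob_space PQ" and \<nu>: "tame_noise \<nu>" and fin: "finite I"
    and B: "\<And>i. B i \<in> PQ \<rightarrow>\<^sub>M borel" and \<rho>: "\<rho> \<ge> 1"
  obtains \<mu> where "sets \<mu> = sets (PQ \<Otimes>\<^sub>M \<nu>)" "emeasure \<mu> (space \<mu>) \<le> ennreal ((4 * sqrt \<rho>) ^ card I)"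
    "\<And>v f. (\<And>i. v i \<in> borel_measurable PQ) \<Longrightarrow> f \<in> borel_measurable (PQ \<Otimes>\<^sub>M \<nu>) \<Longrightarrow>
      (\<integral>\<^sup>+(G, w). f (G, (\<Sum>i\<in>I. v i G *\<^sub>R B i G) + w) *
         ennreal (exp (- ((norm w)\<^sup>2 + 2 * real (card I) * (\<Sum>i\<in>I. (norm (B i G))\<^sup>2) + (\<Sum>i\<in>I. 2 + (v i G)\<^sup>2 / \<rho>)))) \<partial>(PQ \<Otimes>\<^sub>M \<nu>))
      \<le> (\<integral>\<^sup>+z. f z \<partial>\<mu>)"
proof -
  \<comment> \<open>At this scale the atom at the floor of a coefficient \<open>v\<close> weighs at
    least \<open>exp (- (2 + v\<^sup>2 / \<rho>))\<close>, while each coefficient adds only a factor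
    \<open>4 * sqrt \<rho>\<close> to the total mass.\<close>
  define \<tau> where "\<tau> = sqrt \<rho>"
  have \<tau>: "\<tau> \<ge> 1" "\<tau>\<^sup>2 = \<rho>" using \<rho> by (auto simp: \<tau>_def)
  define \<kappa> where "\<kappa> = PiM I (\<lambda>_. geom_int \<tau>)"
  interpret PQ: prob_space PQ by (rule PQ)
  interpret N: prob_space \<nu> using \<nu> by (simp add: tame_noise_def)
  have setsN [measurable_cong, simp]: "sets \<nu> = sets borel" using \<nu> by (simp add: tame_noise_def)
  interpret gi: finite_measure "geom_int \<tau>" using \<tau> by (intro finite_measure_geom_int) auto
  interpret ps: product_sigma_finite "\<lambda>_. geom_int \<tau>" ..
  note [measurable] = B
  have mass\<kappa>: "emeasure \<kappa> (space \<kappa>) \<le> ennreal ((4 * \<tau>) ^ card I)"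
  proof -
    have "emeasure \<kappa> (space \<kappa>) = (\<Prod>i\<in>I. emeasure (geom_int \<tau>) UNIV)"
      unfolding \<kappa>_def space_PiM using fin by (subst ps.emeasure_PiM) auto
    also have "\<dots> \<le> (\<Prod>i\<in>I. ennreal (4 * \<tau>))"
    proof (rule prod_mono_ennreal)
      have "emeasure (geom_int \<tau>) UNIV \<le> ennreal (2 * (1 + \<tau>))" using \<tau> by (intro emeasure_geom_int_UNIV) auto
      also have "\<dots> \<le> ennreal (4 * \<tau>)" using \<tau> by (intro ennreal_leI) auto
      finally show "emeasure (geom_int \<tau>) UNIV \<le> ennreal (4 * \<tau>)" .
    qed
    also have "\<dots> = ennreal ((4 * \<tau>) ^ card I)" using \<tau> by (simp add: ennreal_power)
    finally show ?thesis .
  qed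
  interpret \<kappa>: finite_measure \<kappa> using mass\<kappa> by (intro finite_measureI) (auto simp: top_unique)
  interpret \<kappa>N: pair_sigma_finite \<kappa> \<nu> ..
  \<comment> \<open>\<open>\<mu>\<close> will be the law of fading and output when the true
    coefficients are replaced by integers from \<open>\<kappa>\<close>; no input enters it.\<close>
  define h where "h = (\<lambda>(G, k, w). (G, (\<Sum>i\<in>I. of_int (k i) *\<^sub>R B i G) + w))"
  have cmp [measurable]: "i \<in> I \<Longrightarrow> (\<lambda>k. k i) \<in> \<kappa> \<rightarrow>\<^sub>M count_space UNIV" for i
    unfolding \<kappa>_def using measurable_component_singleton[of i I "\<lambda>_. geom_int \<tau>"] by (simp cong: measurable_cong_sets)
  have hm [measurable]: "h \<in> PQ \<Otimes>\<^sub>M (\<kappa> \<Otimes>\<^sub>M \<nu>) \<rightarrow>\<^sub>M PQ \<Otimes>\<^sub>M \<nu>"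
    unfolding h_def by measurable
  define \<mu> where "\<mu> = distr (PQ \<Otimes>\<^sub>M (\<kappa> \<Otimes>\<^sub>M \<nu>)) (PQ \<Otimes>\<^sub>M \<nu>) h"
  have int\<mu>: "(\<integral>\<^sup>+z. f z \<partial>\<mu>) = (\<integral>\<^sup>+G. \<integral>\<^sup>+k. \<integral>\<^sup>+w. f (G, (\<Sum>i\<in>I. of_int (k i) *\<^sub>R B i G) + w) \<partial>\<nu> \<partial>\<kappa> \<partial>PQ)"
    if [measurable]: "f \<in> borel_measurable (PQ \<Otimes>\<^sub>M \<nu>)" for f
  proof -
    have fh: "(\<lambda>x. f (h x)) \<in> borel_measurable (PQ \<Otimes>\<^sub>M (\<kappa> \<Otimes>\<^sub>M \<nu>))" by measurable
    have "(\<integral>\<^sup>+z. f z \<partial>\<mu>) = (\<integral>\<^sup>+G. \<integral>\<^sup>+y. f (h (G, y)) \<partial>(\<kappa> \<Otimes>\<^sub>M \<nu>) \<partial>PQ)"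
      unfolding \<mu>_def by (simp add: nn_integral_distr sigma_finite_measure.nn_integral_fst[OF \<kappa>N.sigma_finite_measure_axioms fh])
    also have "\<dots> = (\<integral>\<^sup>+G. \<integral>\<^sup>+k. \<integral>\<^sup>+w. f (h (G, k, w)) \<partial>\<nu> \<partial>\<kappa> \<partial>PQ)"
    proof (rule nn_integral_cong)
      fix G assume [measurable]: "G \<in> space PQ"
      show "(\<integral>\<^sup>+y. f (h (G, y)) \<partial>(\<kappa> \<Otimes>\<^sub>M \<nu>)) = (\<integral>\<^sup>+k. \<integral>\<^sup>+w. f (h (G, k, w)) \<partial>\<nu> \<partial>\<kappa>)"
        by (rule N.nn_integral_fst[symmetric]) measurable
    qed
    finally show ?thesis by (simp add: h_def)
  qed
  show ?thesis
  proof (rule that)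
    show "sets \<mu> = sets (PQ \<Otimes>\<^sub>M \<nu>)" by (simp add: \<mu>_def)
    have "emeasure \<mu> (space \<mu>) = (\<integral>\<^sup>+z. 1 \<partial>\<mu>)" by simp
    also have "\<dots> = emeasure \<kappa> (space \<kappa>)"
      by (subst int\<mu>) (auto simp: N.emeasure_space_1 PQ.emeasure_space_1)
    finally show "emeasure \<mu> (space \<mu>) \<le> ennreal ((4 * sqrt \<rho>) ^ card I)" using mass\<kappa> by (simp add: \<tau>_def)
    fix v :: "'i \<Rightarrow> 'g \<Rightarrow> real" and f :: "'g \<times> 'e \<Rightarrow> ennreal"
    assume [measurable]: "\<And>i. v i \<in> borel_measurable PQ" "f \<in> borel_measurable (PQ \<Otimes>\<^sub>M \<nu>)"
    let ?g = "\<lambda>G. 2 * real (card I) * (\<Sum>i\<in>I. (norm (B i G))\<^sup>2) + (\<Sum>i\<in>I. 2 + (v i G)\<^sup>2 / \<rho>)"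
    have "(\<integral>\<^sup>+(G, w). f (G, (\<Sum>i\<in>I. v i G *\<^sub>R B i G) + w) *
         ennreal (exp (- ((norm w)\<^sup>2 + 2 * real (card I) * (\<Sum>i\<in>I. (norm (B i G))\<^sup>2) + (\<Sum>i\<in>I. 2 + (v i G)\<^sup>2 / \<rho>)))) \<partial>(PQ \<Otimes>\<^sub>M \<nu>))
       = (\<integral>\<^sup>+G. \<integral>\<^sup>+w. f (G, (\<Sum>i\<in>I. v i G *\<^sub>R B i G) + w) *
         ennreal (exp (- ((norm w)\<^sup>2 + 2 * real (card I) * (\<Sum>i\<in>I. (norm (B i G))\<^sup>2) + (\<Sum>i\<in>I. 2 + (v i G)\<^sup>2 / \<rho>)))) \<partial>\<nu> \<partial>PQ)"
    proof (subst N.nn_integral_fst[symmetric])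
      have [measurable]: "(\<lambda>(G, w). (\<Sum>i\<in>I. v i G *\<^sub>R B i G) + w) \<in> borel_measurable (PQ \<Otimes>\<^sub>M \<nu>)"
        by measurable
      have [measurable]: "(\<lambda>(G, w). (G, (\<Sum>i\<in>I. v i G *\<^sub>R B i G) + w)) \<in> (PQ \<Otimes>\<^sub>M \<nu>) \<rightarrow>\<^sub>M (PQ \<Otimes>\<^sub>M \<nu>)"
        by measurable
      have [measurable]: "(\<lambda>(G, w). f (G, (\<Sum>i\<in>I. v i G *\<^sub>R B i G) + w)) \<in> borel_measurable (PQ \<Otimes>\<^sub>M \<nu>)"
        by measurable
      have [measurable]: "(\<lambda>(G, w). (norm w)\<^sup>2 + 2 * real (card I) * (\<Sum>i\<in>I. (norm (B i G))\<^sup>2) + (\<Sum>i\<in>I. 2 + (v i G)\<^sup>2 / \<rho>)) \<in> borel_measurable (PQ \<Otimes>\<^sub>M \<nu>)"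
        by measurable
      show "(\<lambda>(G, w). f (G, (\<Sum>i\<in>I. v i G *\<^sub>R B i G) + w) *
         ennreal (exp (- ((norm w)\<^sup>2 + 2 * real (card I) * (\<Sum>i\<in>I. (norm (B i G))\<^sup>2) + (\<Sum>i\<in>I. 2 + (v i G)\<^sup>2 / \<rho>))))) \<in> borel_measurable (PQ \<Otimes>\<^sub>M \<nu>)"
        by measurable
    qed simp
    also have "\<dots> \<le> (\<integral>\<^sup>+G. \<integral>\<^sup>+k. \<integral>\<^sup>+w. f (G, (\<Sum>i\<in>I. of_int (k i) *\<^sub>R B i G) + w) \<partial>\<nu> \<partial>\<kappa> \<partial>PQ)"
    proof (rule nn_integral_mono)
      fix G assume [measurable]: "G \<in> space PQ"
      \<comment> \<open>The restriction to \<open>I\<close> makes \<open>k0\<close> a point of the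
        product space, so that its singleton is a box with computable mass.\<close>
      define k0 where "k0 = (\<lambda>i\<in>I. \<lfloor>v i G\<rfloor>)"
      define y0 where "y0 = (\<Sum>i\<in>I. of_int (k0 i) *\<^sub>R B i G)"
      \<comment> \<open>The rounding error, seen as a shift of the noise that
        \<open>tame_noise\<close> can absorb.\<close>
      define a where "a = (\<Sum>i\<in>I. v i G *\<^sub>R B i G) - y0"
      define F where "F k = (\<integral>\<^sup>+w. f (G, (\<Sum>i\<in>I. of_int (k i) *\<^sub>R B i G) + w) \<partial>\<nu>)" for k
      have [measurable]: "F \<in> borel_measurable \<kappa>" unfolding F_def by measurable
      have "a = (\<Sum>i\<in>I. (v i G - of_int \<lfloor>v i G\<rfloor>) *\<^sub>R B i G)"
        by (simp add: a_def y0_def k0_def scaleR_diff_left sum_subtractf)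
      then have "norm a \<le> (\<Sum>i\<in>I. norm ((v i G - of_int \<lfloor>v i G\<rfloor>) *\<^sub>R B i G))" by (simp only: norm_sum)
      also have "\<dots> \<le> (\<Sum>i\<in>I. 1 * norm (B i G))"
        unfolding norm_scaleR
      proof (intro sum_mono mult_right_mono)
        fix i
        show "\<bar>v i G - of_int \<lfloor>v i G\<rfloor>\<bar> \<le> 1" by linarith
      qed auto
      finally have "(norm a)\<^sup>2 \<le> (\<Sum>i\<in>I. norm (B i G))\<^sup>2" by (simp add: power_mono)
      \<comment> \<open>Cauchy-Schwarz; this is the origin of the factor \<open>card I\<close> in
        the exponent.\<close>
      also have "\<dots> \<le> real (card I) * (\<Sum>i\<in>I. (norm (B i G))\<^sup>2)"
        using sum_squared_le_sum_of_squares[of "\<lambda>i. norm (B i G)" I] by (simp add: mult.commute)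
      finally have na: "(norm a)\<^sup>2 \<le> real (card I) * (\<Sum>i\<in>I. (norm (B i G))\<^sup>2)" .
      have k0s: "k0 \<in> space \<kappa>" by (auto simp: \<kappa>_def space_PiM k0_def)
      have sing: "{k0} = PiE I (\<lambda>i. {k0 i})"
        unfolding k0_def by (auto simp: PiE_iff extensional_def fun_eq_iff)
      have k0m: "{k0} \<in> sets \<kappa>" unfolding sing \<kappa>_def using fin by (intro sets_PiM_I_finite) auto
      have em: "emeasure \<kappa> {k0} = ennreal (exp (\<Sum>i\<in>I. - \<bar>of_int (k0 i)\<bar> / \<tau>))"
        unfolding sing \<kappa>_def using fin by (subst ps.emeasure_PiM) (auto simp: emeasure_geom_int_singleton prod_ennreal exp_sum)
      have "\<bar>of_int \<lfloor>v i G\<rfloor>\<bar> / \<tau> \<le> 2 + (v i G)\<^sup>2 / \<rho>" for i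
      proof -
        have "\<bar>of_int \<lfloor>v i G\<rfloor>\<bar> \<le> \<bar>v i G\<bar> + 1" by linarith
        then have "\<bar>of_int \<lfloor>v i G\<rfloor>\<bar> / \<tau> \<le> (\<bar>v i G\<bar> + 1) / \<tau>" using \<tau> by (intro divide_right_mono) auto
        also have "\<dots> = \<bar>v i G\<bar> / \<tau> + 1 / \<tau>" by (simp add: add_divide_distrib)
        also have "1 / \<tau> \<le> 1" using \<tau> by simp
        also have "\<bar>v i G\<bar> / \<tau> \<le> 1 + (\<bar>v i G\<bar> / \<tau>)\<^sup>2"
          by (rule le_one_plus_square)
        finally show ?thesis by (simp add: power_divide \<tau>)
      qed
      then have sk: "(\<Sum>i\<in>I. \<bar>of_int (k0 i)\<bar> / \<tau>) \<le> (\<Sum>i\<in>I. 2 + (v i G)\<^sup>2 / \<rho>)"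
        by (intro sum_mono) (simp add: k0_def)
      have fm: "(\<lambda>w. f (G, y0 + w)) \<in> borel_measurable borel"
      proof -
        have "(\<lambda>w. f (G, y0 + w)) \<in> borel_measurable \<nu>" by measurable
        then show ?thesis by (simp cong: measurable_cong_sets)
      qed
      note [measurable] = fm
      have "(\<integral>\<^sup>+w. f (G, (\<Sum>i\<in>I. v i G *\<^sub>R B i G) + w) * ennreal (exp (- ((norm w)\<^sup>2 + 2 * real (card I) * (\<Sum>i\<in>I. (norm (B i G))\<^sup>2) + (\<Sum>i\<in>I. 2 + (v i G)\<^sup>2 / \<rho>)))) \<partial>\<nu>)
        = (\<integral>\<^sup>+w. (f (G, y0 + (w + a)) * ennreal (exp (- (norm w)\<^sup>2))) * ennreal (exp (- ?g G)) \<partial>\<nu>)"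
      proof (intro nn_integral_cong)
        fix w :: 'e
        have *: "- ((norm w)\<^sup>2 + 2 * real (card I) * (\<Sum>i\<in>I. (norm (B i G))\<^sup>2) + (\<Sum>i\<in>I. 2 + (v i G)\<^sup>2 / \<rho>)) = - (norm w)\<^sup>2 + - ?g G"
          by simp
        show "f (G, (\<Sum>i\<in>I. v i G *\<^sub>R B i G) + w) * ennreal (exp (- ((norm w)\<^sup>2 + 2 * real (card I) * (\<Sum>i\<in>I. (norm (B i G))\<^sup>2) + (\<Sum>i\<in>I. 2 + (v i G)\<^sup>2 / \<rho>)))) =
          (f (G, y0 + (w + a)) * ennreal (exp (- (norm w)\<^sup>2))) * ennreal (exp (- ?g G))"
          unfolding * exp_add[of "- (norm w)\<^sup>2"] by (simp add: ennreal_mult a_def algebra_simps)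
      qed
      also have "\<dots> = (\<integral>\<^sup>+w. f (G, y0 + (w + a)) * ennreal (exp (- (norm w)\<^sup>2)) \<partial>\<nu>) * ennreal (exp (- ?g G))"
        by (rule nn_integral_multc) measurable
      also have "\<dots> \<le> (ennreal (exp (2 * (norm a)\<^sup>2)) * (\<integral>\<^sup>+w. f (G, y0 + w) \<partial>\<nu>)) * ennreal (exp (- ?g G))"
        by (intro mult_right_mono tame_noiseD[OF \<nu> fm]) simp
      also have "\<dots> = F k0 * ennreal (exp (2 * (norm a)\<^sup>2 - ?g G))"
        unfolding diff_conv_add_uminus exp_add[of "2 * (norm a)\<^sup>2"] by (simp add: F_def y0_def ennreal_mult ac_simps del: minus_add_distrib)
      \<comment> \<open>The \<open>B\<close> part of the exponent pays for the shift, its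
        \<open>v\<close> part for the small weight of the atom \<open>k0\<close>.\<close>
      also have "\<dots> \<le> F k0 * emeasure \<kappa> {k0}"
        unfolding em by (intro mult_left_mono ennreal_leI) (use na sk in \<open>auto simp: sum_negf\<close>)
      also have "\<dots> = (\<integral>\<^sup>+k. F k0 * indicator {k0} k \<partial>\<kappa>)" using k0m by (simp add: nn_integral_cmult_indicator)
      also have "\<dots> \<le> (\<integral>\<^sup>+k. F k \<partial>\<kappa>)" by (intro nn_integral_mono) (auto split: split_indicator)
      finally show "(\<integral>\<^sup>+w. f (G, (\<Sum>i\<in>I. v i G *\<^sub>R B i G) + w) * ennreal (exp (- ((norm w)\<^sup>2 + 2 * real (card I) * (\<Sum>i\<in>I. (norm (B i G))\<^sup>2) + (\<Sum>i\<in>I. 2 + (v i G)\<^sup>2 / \<rho>)))) \<partial>\<nu>)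
         \<le> (\<integral>\<^sup>+k. \<integral>\<^sup>+w. f (G, (\<Sum>i\<in>I. of_int (k i) *\<^sub>R B i G) + w) \<partial>\<nu> \<partial>\<kappa>)"
        by (simp add: F_def)
    qed
    also have "\<dots> = (\<integral>\<^sup>+z. f z \<partial>\<mu>)" by (rule int\<mu>[symmetric]) measurable
    finally show "(\<integral>\<^sup>+(G, w). f (G, (\<Sum>i\<in>I. v i G *\<^sub>R B i G) + w) *
         ennreal (exp (- ((norm w)\<^sup>2 + 2 * real (card I) * (\<Sum>i\<in>I. (norm (B i G))\<^sup>2) + (\<Sum>i\<in>I. 2 + (v i G)\<^sup>2 / \<rho>)))) \<partial>(PQ \<Otimes>\<^sub>M \<nu>))
      \<le> (\<integral>\<^sup>+z. f z \<partial>\<mu>)" .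
  qed
qed

text \<open>Markov's inequality bounds the sum over the letters of the exponent in \<open>one_letter_domination\<close> by \<open>J * K\<close> outside an event of
  probability at most \<open>1 / 4\<close>.\<close>
lemma converse_core:
  fixes PQ :: "'g measure" and \<nu> :: "'e::euclidean_space measure" and I :: "'i set"
    and Y :: "'x::real_normed_vector \<Rightarrow> 'g \<Rightarrow> 'e" and v :: "'x \<Rightarrow> 'i \<Rightarrow> 'g \<Rightarrow> real"
  assumes PQ: "prob_space PQ" and \<nu>: "tame_noise \<nu>" and fin: "finite I"
    and B: "\<And>i. B i \<in> PQ \<rightarrow>\<^sub>M borel" and v: "\<And>x i. v x i \<in> borel_measurable PQ"
    and Y: "\<And>x G. Y x G = (\<Sum>i\<in>I. v x i G *\<^sub>R B i G)"
    and B2: "\<And>i. i \<in> I \<Longrightarrow> (\<integral>\<^sup>+G. ennreal ((norm (B i G))\<^sup>2) \<partial>PQ) < \<infinity>"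
    and v2: "\<And>x i. i \<in> I \<Longrightarrow> (\<integral>\<^sup>+G. ennreal ((v x i G)\<^sup>2) \<partial>PQ) \<le> ennreal (c * (norm x)\<^sup>2)" and c: "c \<ge> 0"
  shows "\<exists>C. \<forall>\<rho>\<ge>1. \<forall>J>0. \<forall>Ms (enc :: 'm \<Rightarrow> nat \<Rightarrow> 'x) D. finite Ms \<longrightarrow>
    (\<forall>m\<in>Ms. (\<Sum>j<J. (norm (enc m j))\<^sup>2) \<le> real J * \<rho>) \<longrightarrow>
    disjoint_family_on D Ms \<longrightarrow> (\<forall>m\<in>Ms. D m \<in> sets (PiM {..<J} (\<lambda>_. PQ \<Otimes>\<^sub>M \<nu>))) \<longrightarrow>
    3 / 4 * card Ms \<le> (\<Sum>m\<in>Ms. measure (PiM {..<J} (\<lambda>_. PQ \<Otimes>\<^sub>M \<nu>))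
       {\<omega> \<in> space (PiM {..<J} (\<lambda>_. PQ \<Otimes>\<^sub>M \<nu>)).
         (\<lambda>j\<in>{..<J}. (fst (\<omega> j), Y (enc m j) (fst (\<omega> j)) + snd (\<omega> j))) \<in> D m}) \<longrightarrow>
    real (card Ms) \<le> 2 * exp (real J * (C + card I / 2 * ln \<rho>))"
proof -
  interpret PQ: prob_space PQ by (rule PQ)
  interpret N: prob_space \<nu> using \<nu> by (simp add: tame_noise_def)
  have setsN [measurable_cong, simp]: "sets \<nu> = sets borel" using \<nu> by (simp add: tame_noise_def)
  interpret P: pair_prob_space PQ \<nu> ..
  let ?P = "PQ \<Otimes>\<^sub>M \<nu>"
  note [measurable] = B v
  define W where "W = enn2real (\<integral>\<^sup>+w. ennreal ((norm w)\<^sup>2) \<partial>\<nu>)"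
  have W: "(\<integral>\<^sup>+w. ennreal ((norm w)\<^sup>2) \<partial>\<nu>) = ennreal W" "W \<ge> 0"
    using \<nu> unfolding W_def tame_noise_def by (auto simp: ennreal_enn2real_if less_top)
  define b where "b i = enn2real (\<integral>\<^sup>+G. ennreal ((norm (B i G))\<^sup>2) \<partial>PQ)" for i
  have b: "(\<integral>\<^sup>+G. ennreal ((norm (B i G))\<^sup>2) \<partial>PQ) = ennreal (b i)" "b i \<ge> 0" if "i \<in> I" for i
    using B2[OF that] unfolding b_def by (auto simp: ennreal_enn2real_if less_top)
  define n where "n = real (card I)"
  \<comment> \<open>For the input \<open>x\<close> the mean exponent is at most
    \<open>a + n * c * ((norm x)\<^sup>2 / \<rho>)\<close>. Under the power constraint the average
    of this over a block is at most \<open>a + n * c\<close>, and \<open>K\<close> below is at least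
    four times that, which is what Markov needs for \<open>1 / 4\<close>.\<close>
  define a where "a = W + 2 * n * (\<Sum>i\<in>I. b i) + 2 * n"
  have a0: "a \<ge> 0" "n \<ge> 0" using W b by (auto simp: a_def n_def intro!: add_nonneg_nonneg mult_nonneg_nonneg sum_nonneg)
  define K where "K = 4 * (a + n * c) + 4"
  have K: "K > 0" "a + n * c \<le> K / 4" using a0 c by (auto simp: K_def intro!: add_nonneg_pos)
  define g where "g \<rho> x = (\<lambda>(G, w::'e). (norm w)\<^sup>2 + 2 * real (card I) * (\<Sum>i\<in>I. (norm (B i G))\<^sup>2) + (\<Sum>i\<in>I. 2 + (v x i G)\<^sup>2 / \<rho>))" for \<rho> x
  have gm [measurable]: "g \<rho> x \<in> borel_measurable ?P" for \<rho> x unfolding g_def by measurable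
  have g0: "g \<rho> x z \<ge> 0" if "\<rho> \<ge> 1" for \<rho> x z
    using that by (auto simp: g_def split: prod.split intro!: add_nonneg_nonneg mult_nonneg_nonneg sum_nonneg)
  have Eg: "(\<integral>\<^sup>+z. ennreal (g \<rho> x z) \<partial>?P) \<le> ennreal (a + n * c * ((norm x)\<^sup>2 / \<rho>))" if \<rho>: "\<rho> \<ge> 1" for \<rho> x
  proof -
    let ?u = "\<lambda>G. ennreal (2 * n) * (\<Sum>i\<in>I. ennreal ((norm (B i G))\<^sup>2)) + (\<Sum>i\<in>I. 2 + ennreal (1 / \<rho>) * ennreal ((v x i G)\<^sup>2))"
    have "ennreal (g \<rho> x (G, w)) = ennreal ((norm w)\<^sup>2) + ?u G" for G w
    proof -
      have 1: "(\<Sum>i\<in>I. 2 + ennreal (1 / \<rho>) * ennreal ((v x i G)\<^sup>2)) = ennreal (\<Sum>i\<in>I. 2 + (v x i G)\<^sup>2 / \<rho>)"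
        using \<rho> by (subst sum_ennreal[symmetric]) (auto intro!: sum.cong simp: ennreal_plus ennreal_mult[symmetric])
      have 2: "ennreal (2 * n) * (\<Sum>i\<in>I. ennreal ((norm (B i G))\<^sup>2)) = ennreal (2 * n * (\<Sum>i\<in>I. (norm (B i G))\<^sup>2))"
        using a0 by (simp add: ennreal_mult sum_nonneg)
      show ?thesis unfolding 1 2 g_def using \<rho> a0
        by (simp add: n_def ennreal_plus sum_nonneg add.assoc)
    qed
    then have "(\<integral>\<^sup>+z. ennreal (g \<rho> x z) \<partial>?P) = (\<integral>\<^sup>+G. \<integral>\<^sup>+w. ennreal ((norm w)\<^sup>2) + ?u G \<partial>\<nu> \<partial>PQ)"
      by (subst N.nn_integral_fst[symmetric]) auto
    also have "\<dots> = ennreal W + (\<integral>\<^sup>+G. ?u G \<partial>PQ)"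
      by (simp add: nn_integral_add N.emeasure_space_1 PQ.emeasure_space_1 W)
    also have "(\<integral>\<^sup>+G. ?u G \<partial>PQ) = ennreal (2 * n) * (\<Sum>i\<in>I. \<integral>\<^sup>+G. ennreal ((norm (B i G))\<^sup>2) \<partial>PQ) +
        (\<Sum>i\<in>I. 2 + ennreal (1 / \<rho>) * (\<integral>\<^sup>+G. ennreal ((v x i G)\<^sup>2) \<partial>PQ))"
      by (simp add: nn_integral_add nn_integral_cmult nn_integral_sum PQ.emeasure_space_1 del: sum_ennreal)
    also have "\<dots> \<le> ennreal (2 * n) * (\<Sum>i\<in>I. ennreal (b i)) + (\<Sum>i\<in>I. 2 + ennreal (1 / \<rho>) * ennreal (c * (norm x)\<^sup>2))"
      by (intro add_mono mult_left_mono sum_mono v2) (auto simp: b)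
    also have "\<dots> = ennreal (2 * n * (\<Sum>i\<in>I. b i)) + ennreal (\<Sum>i\<in>I. 2 + 1 / \<rho> * (c * (norm x)\<^sup>2))"
    proof -
      have "(\<Sum>i\<in>I. 2 + ennreal (1 / \<rho>) * ennreal (c * (norm x)\<^sup>2)) = ennreal (\<Sum>i\<in>I. 2 + 1 / \<rho> * (c * (norm x)\<^sup>2))"
        using \<rho> c by (subst sum_ennreal[symmetric]) (auto intro!: sum.cong simp: ennreal_plus ennreal_mult[symmetric])
      moreover have "(\<Sum>i\<in>I. ennreal (b i)) = ennreal (\<Sum>i\<in>I. b i)" using b by (intro sum_ennreal) auto
      ultimately show ?thesis using a0 b by (simp add: ennreal_mult sum_nonneg)
    qed
    also have "ennreal W + \<dots> = ennreal (a + n * c * ((norm x)\<^sup>2 / \<rho>))"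
      using W a0 b \<rho> c by (simp add: ennreal_plus[symmetric] sum_nonneg a_def n_def algebra_simps del: ennreal_plus)
    finally show ?thesis by (simp add: add_left_mono)
  qed
  have main: "real (card Ms) \<le> 2 * exp (real J * ((K + n * ln 4) + card I / 2 * ln \<rho>))"
    if \<rho>: "\<rho> \<ge> 1" and J: "J > 0" and fM: "finite Ms"
      and pow: "\<And>m. m \<in> Ms \<Longrightarrow> (\<Sum>j<J. (norm (enc m j))\<^sup>2) \<le> real J * \<rho>"
      and dis: "disjoint_family_on D Ms" and D: "\<And>m. m \<in> Ms \<Longrightarrow> D m \<in> sets (PiM {..<J} (\<lambda>_. ?P))"
      and corr: "3 / 4 * card Ms \<le> (\<Sum>m\<in>Ms. measure (PiM {..<J} (\<lambda>_. ?P))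
         {\<omega> \<in> space (PiM {..<J} (\<lambda>_. ?P)). (\<lambda>j\<in>{..<J}. (fst (\<omega> j), Y (enc m j) (fst (\<omega> j)) + snd (\<omega> j))) \<in> D m})"
    for \<rho> J and Ms :: "'m set" and enc :: "'m \<Rightarrow> nat \<Rightarrow> 'x" and D
  proof -
    let ?\<Omega> = "PiM {..<J} (\<lambda>_. ?P)"
    obtain \<mu> where \<mu>: "sets \<mu> = sets ?P" "emeasure \<mu> (space \<mu>) \<le> ennreal ((4 * sqrt \<rho>) ^ card I)"
      and dom: "\<And>x f. f \<in> borel_measurable ?P \<Longrightarrow>
        (\<integral>\<^sup>+(G, w). f (G, (\<Sum>i\<in>I. v x i G *\<^sub>R B i G) + w) *
         ennreal (exp (- ((norm w)\<^sup>2 + 2 * real (card I) * (\<Sum>i\<in>I. (norm (B i G))\<^sup>2) + (\<Sum>i\<in>I. 2 + (v x i G)\<^sup>2 / \<rho>)))) \<partial>?P)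
        \<le> (\<integral>\<^sup>+z. f z \<partial>\<mu>)"
    proof (rule one_letter_domination[where B=B, OF PQ \<nu> fin B \<rho>])
      fix \<mu> assume "sets \<mu> = sets ?P" "emeasure \<mu> (space \<mu>) \<le> ennreal ((4 * sqrt \<rho>) ^ card I)"
        and d: "\<And>u f. (\<And>i. u i \<in> borel_measurable PQ) \<Longrightarrow> f \<in> borel_measurable ?P \<Longrightarrow>
          (\<integral>\<^sup>+(G, w). f (G, (\<Sum>i\<in>I. u i G *\<^sub>R B i G) + w) *
           ennreal (exp (- ((norm w)\<^sup>2 + 2 * real (card I) * (\<Sum>i\<in>I. (norm (B i G))\<^sup>2) + (\<Sum>i\<in>I. 2 + (u i G)\<^sup>2 / \<rho>)))) \<partial>?P)
          \<le> (\<integral>\<^sup>+z. f z \<partial>\<mu>)"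
      then show thesis using d[OF v] by (intro that) auto
    qed
    interpret \<mu>: finite_measure \<mu> using \<mu>(2) by (intro finite_measureI) (auto simp: top_unique)
    interpret P\<mu>: product_sigma_finite "\<lambda>_::nat. \<mu>" ..
    interpret PP: product_prob_space "\<lambda>_::nat. ?P" "{..<J}" ..
    have [measurable_cong]: "sets \<mu> = sets ?P" by (rule \<mu>(1))
    let ?M = "PiM {..<J} (\<lambda>_. \<mu>)"
    have setsM: "sets ?M = sets ?\<Omega>" by (rule sets_PiM_cong) (auto simp: \<mu>)
    have massM: "emeasure ?M (space ?M) \<le> ennreal (((4 * sqrt \<rho>) ^ card I) ^ J)"
    proof -
      have "emeasure ?M (space ?M) = (\<Prod>i<J. emeasure \<mu> (space \<mu>))"
        unfolding space_PiM by (subst P\<mu>.emeasure_PiM) auto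
      also have "\<dots> \<le> (\<Prod>i<J. ennreal ((4 * sqrt \<rho>) ^ card I))" by (rule prod_mono_ennreal) (rule \<mu>(2))
      also have "\<dots> = ennreal (((4 * sqrt \<rho>) ^ card I) ^ J)" using \<rho> by (simp add: ennreal_power)
      finally show ?thesis .
    qed
    interpret M: finite_measure ?M using massM by (intro finite_measureI) (auto simp: top_unique)
    define T where "T m j = (\<lambda>z. (fst z, Y (enc m j) (fst z) + snd z))" for m j
    have Tm: "T m j \<in> ?P \<rightarrow>\<^sub>M ?P" for m j unfolding T_def Y by measurable
    define S where "S m = {\<omega> \<in> space ?\<Omega>. (\<lambda>j\<in>{..<J}. T m j (\<omega> j)) \<in> D m}" for m
    have TTm [measurable]: "(\<lambda>\<omega>. \<lambda>j\<in>{..<J}. T m j (\<omega> j)) \<in> ?\<Omega> \<rightarrow>\<^sub>M ?\<Omega>" for m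
      using Tm by measurable
    have Sm [measurable]: "S m \<in> sets ?\<Omega>" if "m \<in> Ms" for m
      using measurable_sets[OF TTm D[OF that], of m] by (simp add: S_def vimage_def Int_def conj_commute)
    have bound: "measure ?\<Omega> (S m) \<le> 1 / 4 + exp (real J * K) * measure ?M (D m)" if m: "m \<in> Ms" for m
    proof -
      have [measurable]: "D m \<in> sets ?\<Omega>" using D m by blast
      have [measurable]: "S m \<in> sets ?\<Omega>" using Sm m by blast
      let ?sg = "\<lambda>\<omega>. \<Sum>j<J. g \<rho> (enc m j) (\<omega> j)"
      \<comment> \<open>Either the exponents sum to at least \<open>J * K\<close>, and the first
        term is at least 1, or they do not, and inserting the weights into the second term costs at
        most \<open>exp (J * K)\<close>.\<close>
      have pt: "indicator (S m) \<omega> \<le> (\<Sum>j<J. ennreal (1 / (real J * K)) * ennreal (g \<rho> (enc m j) (\<omega> j))) +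
           ennreal (exp (real J * K)) * (indicator (D m) (\<lambda>j\<in>{..<J}. T m j (\<omega> j)) * (\<Prod>j<J. ennreal (exp (- g \<rho> (enc m j) (\<omega> j)))))"
        if "\<omega> \<in> space ?\<Omega>" for \<omega>
      proof (cases "\<omega> \<in> S m")
        case True
        then have TD: "(\<lambda>j\<in>{..<J}. T m j (\<omega> j)) \<in> D m" by (simp add: S_def)
        show ?thesis
        proof (cases "?sg \<omega> \<ge> real J * K")
          case True
          have "(\<Sum>j<J. ennreal (1 / (real J * K)) * ennreal (g \<rho> (enc m j) (\<omega> j))) = ennreal (1 / (real J * K) * ?sg \<omega>)"
          proof -
            have "(\<Sum>j<J. ennreal (1 / (real J * K)) * ennreal (g \<rho> (enc m j) (\<omega> j))) = ennreal (1 / (real J * K)) * ennreal (?sg \<omega>)"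
              using g0[OF \<rho>] by (simp add: sum_distrib_left[symmetric])
            also have "\<dots> = ennreal (1 / (real J * K) * ?sg \<omega>)"
              using g0[OF \<rho>] J K by (intro ennreal_mult[symmetric] sum_nonneg) auto
            finally show ?thesis .
          qed
          moreover have "1 / (real J * K) * ?sg \<omega> \<ge> 1" using True J K by (simp add: field_simps)
          ultimately have "1 \<le> (\<Sum>j<J. ennreal (1 / (real J * K)) * ennreal (g \<rho> (enc m j) (\<omega> j)))"
            by (metis ennreal_leI ennreal_1)
          then show ?thesis using \<open>\<omega> \<in> S m\<close> by (simp add: add_increasing2)
        next
          case False
          have "ennreal (exp (real J * K)) * (\<Prod>j<J. ennreal (exp (- g \<rho> (enc m j) (\<omega> j)))) = ennreal (exp (real J * K + (\<Sum>j<J. - g \<rho> (enc m j) (\<omega> j))))"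
            by (simp add: prod_ennreal exp_add exp_sum ennreal_mult prod_nonneg)
          moreover have "exp (real J * K + (\<Sum>j<J. - g \<rho> (enc m j) (\<omega> j))) \<ge> 1" using False by (simp add: sum_negf)
          ultimately have "1 \<le> ennreal (exp (real J * K)) * (\<Prod>j<J. ennreal (exp (- g \<rho> (enc m j) (\<omega> j))))"
            by (metis ennreal_leI ennreal_1)
          then show ?thesis using TD \<open>\<omega> \<in> S m\<close> by (simp add: add_increasing)
        qed
      qed simp
      have comp: "(\<integral>\<^sup>+\<omega>. ennreal (g \<rho> (enc m j) (\<omega> j)) \<partial>?\<Omega>) = (\<integral>\<^sup>+z. ennreal (g \<rho> (enc m j) z) \<partial>?P)" if "j < J" for j
      proof -
        have "(\<integral>\<^sup>+z. ennreal (g \<rho> (enc m j) z) \<partial>distr ?\<Omega> ?P (\<lambda>\<omega>. \<omega> j)) = (\<integral>\<^sup>+\<omega>. ennreal (g \<rho> (enc m j) (\<omega> j)) \<partial>?\<Omega>)"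
          using that by (intro nn_integral_distr) auto
        then show ?thesis using that by (simp add: PP.PiM_component)
      qed
      have "emeasure ?\<Omega> (S m) = (\<integral>\<^sup>+\<omega>. indicator (S m) \<omega> \<partial>?\<Omega>)" by simp
      also have "\<dots> \<le> (\<integral>\<^sup>+\<omega>. (\<Sum>j<J. ennreal (1 / (real J * K)) * ennreal (g \<rho> (enc m j) (\<omega> j))) +
           ennreal (exp (real J * K)) * (indicator (D m) (\<lambda>j\<in>{..<J}. T m j (\<omega> j)) * (\<Prod>j<J. ennreal (exp (- g \<rho> (enc m j) (\<omega> j))))) \<partial>?\<Omega>)"
        by (rule nn_integral_mono) (rule pt)
      also have "\<dots> = (\<Sum>j<J. ennreal (1 / (real J * K)) * (\<integral>\<^sup>+\<omega>. ennreal (g \<rho> (enc m j) (\<omega> j)) \<partial>?\<Omega>)) +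
           ennreal (exp (real J * K)) * (\<integral>\<^sup>+\<omega>. indicator (D m) (\<lambda>j\<in>{..<J}. T m j (\<omega> j)) * (\<Prod>j<J. ennreal (exp (- g \<rho> (enc m j) (\<omega> j)))) \<partial>?\<Omega>)"
      proof -
        have [measurable]: "(\<lambda>\<omega>. indicator (D m) (\<lambda>j\<in>{..<J}. T m j (\<omega> j)) :: ennreal) \<in> borel_measurable ?\<Omega>"
          by (rule measurable_compose[OF TTm]) measurable
        show ?thesis by (simp add: nn_integral_add nn_integral_sum nn_integral_cmult)
      qed
      also have "\<dots> \<le> (\<Sum>j<J. ennreal (1 / (real J * K)) * ennreal (a + n * c * ((norm (enc m j))\<^sup>2 / \<rho>))) +
           ennreal (exp (real J * K)) * (\<integral>\<^sup>+y. indicator (D m) y \<partial>?M)"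
      proof (intro add_mono sum_mono mult_left_mono)
        fix j assume "j \<in> {..<J}"
        then show "(\<integral>\<^sup>+\<omega>. ennreal (g \<rho> (enc m j) (\<omega> j)) \<partial>?\<Omega>) \<le> ennreal (a + n * c * ((norm (enc m j))\<^sup>2 / \<rho>))"
          using comp Eg[OF \<rho>] by simp
      next
        \<comment> \<open>The one-letter domination is multiplied over the block; the encoder may
          differ from letter to letter, but \<open>\<mu>\<close> is always the same.\<close>
        show "(\<integral>\<^sup>+\<omega>. indicator (D m) (\<lambda>j\<in>{..<J}. T m j (\<omega> j)) * (\<Prod>j<J. ennreal (exp (- g \<rho> (enc m j) (\<omega> j)))) \<partial>?\<Omega>) \<le> (\<integral>\<^sup>+y. indicator (D m) y \<partial>?M)"
        proof (rule nn_integral_PiM_le[where k="\<lambda>j z. ennreal (exp (- g \<rho> (enc m j) z))"])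
          fix j and f :: "'g \<times> 'e \<Rightarrow> ennreal" assume "f \<in> borel_measurable \<mu>"
          then have "f \<in> borel_measurable ?P" by (simp cong: measurable_cong_sets add: \<mu>)
          from dom[OF this, of "enc m j"] show "(\<integral>\<^sup>+x. f (T m j x) * ennreal (exp (- g \<rho> (enc m j) x)) \<partial>?P) \<le> integral\<^sup>N \<mu> f"
            by (simp add: T_def Y g_def case_prod_beta')
        next
          show "T m i \<in> ?P \<rightarrow>\<^sub>M \<mu>" for i using Tm by (simp cong: measurable_cong_sets add: \<mu>)
          show "indicator (D m) \<in> borel_measurable ?M" using D[OF m] by (simp add: borel_measurable_indicator_iff setsM)
        qed (auto intro: P.sigma_finite_measure_axioms \<mu>.sigma_finite_measure_axioms)
      qed auto
      also have "(\<Sum>j<J. ennreal (1 / (real J * K)) * ennreal (a + n * c * ((norm (enc m j))\<^sup>2 / \<rho>))) =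
          ennreal (\<Sum>j<J. 1 / (real J * K) * (a + n * c * ((norm (enc m j))\<^sup>2 / \<rho>)))"
      proof -
        have "ennreal (1 / (real J * K)) * ennreal (a + n * c * ((norm (enc m j))\<^sup>2 / \<rho>)) =
            ennreal (1 / (real J * K) * (a + n * c * ((norm (enc m j))\<^sup>2 / \<rho>)))" for j
          using a0 c \<rho> J K by (intro ennreal_mult[symmetric]) auto
        then show ?thesis using a0 c \<rho> J K by (simp only:) (intro sum_ennreal, auto)
      qed
      also have "\<dots> \<le> ennreal (1 / 4)"
      proof (rule ennreal_leI)
        have "(\<Sum>j<J. 1 / (real J * K) * (a + n * c * ((norm (enc m j))\<^sup>2 / \<rho>))) =
          1 / (real J * K) * (real J * a + n * c * ((\<Sum>j<J. (norm (enc m j))\<^sup>2) / \<rho>))"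
          by (simp add: sum_distrib_left sum.distrib sum_divide_distrib distrib_left)
        also have "\<dots> \<le> 1 / (real J * K) * (real J * a + n * c * ((real J * \<rho>) / \<rho>))"
          using J K a0 c \<rho> pow[OF m] by (intro mult_left_mono add_left_mono divide_right_mono) auto
        also have "\<dots> = (a + n * c) / K" using J K \<rho> by (simp add: field_simps)
        also have "\<dots> \<le> 1 / 4" using K by (simp add: field_simps)
        finally show "(\<Sum>j<J. 1 / (real J * K) * (a + n * c * ((norm (enc m j))\<^sup>2 / \<rho>))) \<le> 1 / 4" .
      qed
      also have "(\<integral>\<^sup>+y. indicator (D m) y \<partial>?M) = ennreal (measure ?M (D m))"
        using D[OF m] setsM by (simp add: M.emeasure_eq_measure)
      finally have "ennreal (measure ?\<Omega> (S m)) \<le> ennreal (1 / 4 + exp (real J * K) * measure ?M (D m))"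
        by (simp add: PP.emeasure_eq_measure ennreal_mult[symmetric] ennreal_plus[symmetric] add_right_mono del: ennreal_plus)
      then show ?thesis by (subst (asm) ennreal_le_iff) auto
    qed
    \<comment> \<open>Success \<open>3 / 4\<close> minus the Markov loss \<open>1 / 4\<close> leaves
      at least half of the codewords to be paid for by the mass of disjoint sets; hence the factor 2
      in the conclusion.\<close>
    have "3 / 4 * card Ms \<le> (\<Sum>m\<in>Ms. measure ?\<Omega> (S m))" using corr by (simp add: S_def T_def)
    also have "\<dots> \<le> (\<Sum>m\<in>Ms. 1 / 4 + exp (real J * K) * measure ?M (D m))" by (intro sum_mono bound)
    also have "\<dots> = card Ms / 4 + exp (real J * K) * (\<Sum>m\<in>Ms. measure ?M (D m))"
      by (simp add: sum.distrib sum_distrib_left)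
    also have "(\<Sum>m\<in>Ms. measure ?M (D m)) = measure ?M (\<Union>m\<in>Ms. D m)"
      using D setsM fM dis by (intro M.finite_measure_finite_Union[symmetric]) auto
    also have "\<dots> \<le> measure ?M (space ?M)" by (rule M.bounded_measure)
    also have "\<dots> \<le> ((4 * sqrt \<rho>) ^ card I) ^ J"
      using massM \<rho> by (simp add: M.emeasure_eq_measure)
    finally have "real (card Ms) \<le> 2 * (exp (real J * K) * ((4 * sqrt \<rho>) ^ card I) ^ J)" by (simp add: mult_left_mono)
    also have "((4 * sqrt \<rho>) ^ card I) ^ J = exp (real J * (n * ln (4 * sqrt \<rho>)))"
      using \<rho> by (simp add: n_def exp_of_nat_mult)
    \<comment> \<open>Each real coefficient contributes half of \<open>ln \<rho>\<close>.\<close>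
    also have "ln (4 * sqrt \<rho>) = ln 4 + ln \<rho> / 2" using \<rho> by (simp add: ln_mult ln_sqrt)
    also have "exp (real J * K) * exp (real J * (n * (ln 4 + ln \<rho> / 2))) = exp (real J * ((K + n * ln 4) + card I / 2 * ln \<rho>))"
      by (simp add: exp_add[symmetric] n_def algebra_simps)
    finally show ?thesis .
  qed
  show ?thesis by (rule exI[of _ "K + n * ln 4"]) (use main in blast)
qed

section \<open>Bases adapted to the two correlation ranges\<close>

text \<open>Conjugate-linear in the first argument, so that the entries of
  \<open>cadj U *v x\<close> are the values at the columns of \<open>U\<close>, and vanishing on a
  set passes to its complex span.\<close>

definition hip :: "complex^'m::finite \<Rightarrow> complex^'m \<Rightarrow> complex" where
  "hip e x = (\<Sum>j\<in>UNIV. cnj (e $ j) * x $ j)"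

lemma hip_add_left: "hip (d + e) x = hip d x + hip e x"
  by (simp add: hip_def distrib_right sum.distrib)

lemma hip_smult_left: "hip (c *s e) x = cnj c * hip e x"
  by (simp add: hip_def sum_distrib_left ac_simps)

lemma hip_zero_left [simp]: "hip 0 x = 0"
  by (simp add: hip_def)

lemma hip_diff_right: "hip e (x - y) = hip e x - hip e y"
  by (simp add: hip_def right_diff_distrib sum_subtractf)

lemma hip_sum_smult_right: "hip e (\<Sum>i\<in>I. c i *s b i) = (\<Sum>i\<in>I. c i * hip e (b i))"
  unfolding hip_def by (simp add: sum_distrib_left sum.swap[of _ _ I] ac_simps)

lemma norm_hip_le: "norm (hip e x) \<le> (\<Sum>j\<in>UNIV. norm (e $ j)) * norm x"
proof -
  have "norm (hip e x) \<le> (\<Sum>j\<in>UNIV. norm (e $ j) * norm (x $ j))"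
    unfolding hip_def by (intro order_trans[OF norm_sum] sum_mono) (simp add: norm_mult)
  also have "\<dots> \<le> (\<Sum>j\<in>UNIV. norm (e $ j) * norm x)"
    by (intro sum_mono mult_left_mono Finite_Cartesian_Product.norm_nth_le) auto
  finally show ?thesis by (simp add: sum_distrib_right)
qed

lemma hip_span_eq_0:
  assumes "e \<in> vec.span S" "\<And>s. s \<in> S \<Longrightarrow> hip s x = 0"
  shows "hip e x = 0"
  using assms(1)
  by (induction rule: vec.span_induct_alt) (auto simp: hip_add_left hip_smult_left assms(2))

lemma cadj_mult_vec_nth: "(cadj U *v x) $ i = hip (column i U) x"
  by (simp add: cadj_def matrix_vector_mult_def hip_def column_def)

text \<open>What a user cannot see depends on \<open>U\<close> only through its column span. The
  columns may therefore be exchanged for any basis of that span, in particular for one adapted to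
  both users.\<close>

lemma cadj_mult_vec_eq_0_iff: "cadj U *v x = 0 \<longleftrightarrow> (\<forall>e\<in>vec.span (columns U). hip e x = 0)"
proof
  assume "cadj U *v x = 0"
  then have "hip (column i U) x = 0" for i by (metis cadj_mult_vec_nth zero_index)
  then have "hip s x = 0" if "s \<in> columns U" for s
    using that by (auto simp: columns_def)
  then show "\<forall>e\<in>vec.span (columns U). hip e x = 0" using hip_span_eq_0 by blast
next
  assume "\<forall>e\<in>vec.span (columns U). hip e x = 0"
  then show "cadj U *v x = 0"
    by (auto simp: vec_eq_iff cadj_mult_vec_nth columns_def intro!: vec.span_base)
qed

text \<open>The coordinate functional of \<open>e\<close> extends from the independent set to the
  whole space, and conjugating its coefficients represents it by a vector.\<close>

lemma dual_family:
  fixes E :: "(complex^'m::finite) set"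
  assumes "vec.independent E"
  obtains b where "\<And>e e'. e \<in> E \<Longrightarrow> e' \<in> E \<Longrightarrow> hip e' (b e) = (if e' = e then 1 else 0)"
proof -
  have "\<exists>b. \<forall>e'\<in>E. hip e' b = (if e' = e then 1 else 0)" for e
  proof -
    obtain g :: "complex^'m \<Rightarrow> complex^'m" where g: "Vector_Spaces.linear (*s) (*s) g"
      "\<forall>x\<in>E. g x = (if x = e then vec 1 else 0)"
      using vec.linear_independent_extend[OF assms, of "\<lambda>x. if x = e then vec 1 else 0"] by blast
    \<comment> \<open>The extension sends \<open>e\<close> to \<open>vec 1\<close>, which is 1 in
      every coordinate, so any row of the matrix represents the functional.\<close>
    define i where "i = (SOME i::'m. True)"
    have "hip e' (\<chi> j. cnj (matrix g $ i $ j)) = cnj ((matrix g *v e') $ i)" for e'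
      by (simp add: hip_def matrix_vector_mult_def ac_simps)
    also have "\<dots> e' = cnj (g e' $ i)" for e' using matrix_works[OF g(1)] by simp
    finally show ?thesis using g(2) by (intro exI[of _ "\<chi> j. cnj (matrix g $ i $ j)"]) auto
  qed
  then show ?thesis using that by metis
qed

lemma dim_span_columns:
  fixes U :: "complex^'r::finite^'m::finite"
  assumes "cadj U ** U = mat 1"
  shows "vec.dim (vec.span (columns U)) = CARD('r)"
proof -
  have inj: "inj ((*v) U)"
    by (rule injI) (metis assms matrix_vector_mul_assoc matrix_vector_mul_lid)
  have cols: "columns U = (*v) U ` cart_basis"
    by (force simp: columns_def cart_basis_def column_def matrix_vector_mult_def axis_def if_distrib cong: if_cong)
  have "vec.independent ((*v) U ` cart_basis)"
    by (rule vec.independent_injective_image[OF independent_cart_basis]) (rule inj_on_subset[OF inj subset_UNIV])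
  then have "vec.dim (columns U) = card ((*v) U ` cart_basis)"
    unfolding cols by (rule vec.dim_eq_card_independent)
  also have "\<dots> = CARD('r)"
    using inj by (subst card_image) (auto simp: card_cart_basis intro: inj_on_subset)
  finally show ?thesis by simp
qed

text \<open>A basis of the intersection is extended inside each subspace. Independence of the union
  is a count: by the dimension formula its cardinality is the dimension of the sum, which it
  spans.\<close>

lemma adapted_basis:
  fixes S1 S2 :: "(complex^'m::finite) set"
  assumes S: "vec.subspace S1" "vec.subspace S2"
  obtains C A1 A2 where "C \<inter> A1 = {}" "C \<inter> A2 = {}" "A1 \<inter> A2 = {}"
    "vec.independent (C \<union> A1 \<union> A2)" "vec.span (C \<union> A1) = S1" "vec.span (C \<union> A2) = S2"
    "card C = vec.dim (S1 \<inter> S2)" "card (C \<union> A1) = vec.dim S1" "card (C \<union> A2) = vec.dim S2"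
proof -
  obtain C where C: "C \<subseteq> S1 \<inter> S2" "vec.independent C" "S1 \<inter> S2 \<subseteq> vec.span C" "card C = vec.dim (S1 \<inter> S2)"
    using vec.basis_exists by metis
  obtain B1 where B1: "C \<subseteq> B1" "B1 \<subseteq> S1" "vec.independent B1" "S1 \<subseteq> vec.span B1"
    using vec.maximal_independent_subset_extend[of C S1] C by auto
  obtain B2 where B2: "C \<subseteq> B2" "B2 \<subseteq> S2" "vec.independent B2" "S2 \<subseteq> vec.span B2"
    using vec.maximal_independent_subset_extend[of C S2] C by auto
  have sp: "vec.span B1 = S1" "vec.span B2 = S2"
    using B1 B2 S vec.span_minimal by blast+
  have cd: "card B1 = vec.dim S1" "card B2 = vec.dim S2"
    using B1 B2 vec.basis_card_eq_dim by blast+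
  have fin: "finite B1" "finite B2" "finite C" using B1 B2 C vec.finiteI_independent by blast+
  have int: "B1 \<inter> B2 = C"
  proof
    show "B1 \<inter> B2 \<subseteq> C"
    proof
      fix e assume e: "e \<in> B1 \<inter> B2"
      show "e \<in> C"
      proof (rule ccontr)
        assume "e \<notin> C"
        \<comment> \<open>A common element outside \<open>C\<close> lies in the intersection, hence
          in the span of \<open>C\<close>, which is contained in \<open>B1 - {e}\<close>; this
          contradicts independence of \<open>B1\<close>.\<close>
        then have "e \<in> vec.span (B1 - {e})"
          using e C(3) B1 B2 vec.span_mono[of C "B1 - {e}"] by blast
        then show False using e B1(3) by (auto simp: vec.dependent_def)
      qed
    qed
  qed (use B1 B2 in auto)
  let ?V = "{x + y |x y. x \<in> S1 \<and> y \<in> S2}"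
  have "vec.dim ?V + card C = card B1 + card B2" using vec.dim_sums_Int[OF S] C cd by simp
  moreover have "card (B1 \<union> B2) + card C = card B1 + card B2"
    using card_Un_Int[OF fin(1,2)] int by simp
  ultimately have dimV: "vec.dim ?V = card (B1 \<union> B2)" by simp
  have "vec.independent (B1 \<union> B2)"
  proof (rule vec.card_le_dim_spanning)
    show "B1 \<union> B2 \<subseteq> ?V"
    proof
      fix e assume "e \<in> B1 \<union> B2"
      then have "(e \<in> S1 \<and> 0 \<in> S2) \<or> (0 \<in> S1 \<and> e \<in> S2)"
        using B1 B2 vec.subspace_0[OF S(1)] vec.subspace_0[OF S(2)] by blast
      then show "e \<in> ?V" by (metis (mono_tags, lifting) add.left_neutral add.right_neutral mem_Collect_eq)
    qed
    show "?V \<subseteq> vec.span (B1 \<union> B2)"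
      using vec.span_mono[of B1 "B1 \<union> B2"] vec.span_mono[of B2 "B1 \<union> B2"] sp by (auto intro!: vec.span_add)
  qed (use fin dimV in auto)
  moreover have "C \<union> (B1 - C) \<union> (B2 - C) = B1 \<union> B2" "C \<union> (B1 - C) = B1" "C \<union> (B2 - C) = B2" using B1 B2 by auto
  ultimately show ?thesis
    using that[of "B1 - C" C "B2 - C"] that[of C "B1 - C" "B2 - C"] int sp cd C(4) by auto
qed

text \<open>A dual vector is orthogonal to every other basis element, hence to the whole span of
  \<open>F\<close>. This provides streams invisible to a user without any knowledge of the
  fading.\<close>

lemma cadj_dual_eq_0:
  assumes dual: "\<And>e e'. e \<in> E \<Longrightarrow> e' \<in> E \<Longrightarrow> hip e' (b e) = (if e' = e then 1 else 0)"
    and F: "F \<subseteq> E" "vec.span F = vec.span (columns U)" and e: "e \<in> E - F"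
  shows "cadj U *v b e = 0"
  unfolding cadj_mult_vec_eq_0_iff F(2)[symmetric]
proof
  fix d assume "d \<in> vec.span F"
  then show "hip d (b e) = 0" by (rule hip_span_eq_0) (use F e in \<open>auto simp: dual\<close>)
qed

text \<open>\<open>E\<close> need not span the whole space, so the expansion may miss part of
  \<open>x\<close>; the difference is orthogonal to \<open>F\<close>, and the user does not see
  it.\<close>

lemma cadj_expansion:
  assumes dual: "\<And>e e'. e \<in> E \<Longrightarrow> e' \<in> E \<Longrightarrow> hip e' (b e) = (if e' = e then 1 else 0)"
    and F: "F \<subseteq> E" "vec.span F = vec.span (columns U)" and fin: "finite E"
  shows "cadj U *v x = cadj U *v (\<Sum>e\<in>E. hip e x *s b e)"
proof -
  have "cadj U *v (x - (\<Sum>e\<in>E. hip e x *s b e)) = 0"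
    unfolding cadj_mult_vec_eq_0_iff F(2)[symmetric]
  proof
    fix d assume "d \<in> vec.span F"
    then show "hip d (x - (\<Sum>e\<in>E. hip e x *s b e)) = 0"
    proof (rule hip_span_eq_0)
      fix s assume s: "s \<in> F"
      have "(\<Sum>e\<in>E. hip e x * hip s (b e)) = (\<Sum>e\<in>E. if s = e then hip e x else 0)"
        using s F by (intro sum.cong) (auto simp: dual)
      then show "hip s (x - (\<Sum>e\<in>E. hip e x *s b e)) = 0"
        using s F fin by (auto simp: hip_diff_right hip_sum_smult_right)
    qed
  qed
  then show ?thesis by (simp add: matrix_vector_mult_diff_distrib)
qed

section \<open>The part of an input that a user sees\<close>

text \<open>The deterministic part of the channel: by \<open>chan_mult_vec\<close> the random factor
  \<open>G\<close> acts on this vector and on nothing else.\<close>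

definition vis :: "('r::finite \<Rightarrow> real) \<Rightarrow> complex^'r^'m::finite \<Rightarrow> complex^'m \<Rightarrow> complex^'r" where
  "vis \<sigma> U x = diagm (\<lambda>i. complex_of_real (sqrt (\<sigma> i))) *v (cadj U *v x)"

lemma chan_mult_vec: "chan G \<sigma> U *v x = G *v vis \<sigma> U x"
  by (simp add: chan_def vis_def matrix_vector_mul_assoc matrix_mul_assoc)

lemma vis_nth: "vis \<sigma> U x $ i = complex_of_real (sqrt (\<sigma> i)) * (cadj U *v x) $ i"
  by (simp add: vis_def diagm_def matrix_vector_mult_def if_distrib if_distribR cong: if_cong)

lemma vis_cong: "cadj U *v x = cadj U *v y \<Longrightarrow> vis \<sigma> U x = vis \<sigma> U y"
  by (simp add: vis_def)

lemma norm_matrix_vector_mult_le: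
  fixes A :: "complex^'r::finite^'n::finite"
  shows "norm (A *v x) \<le> norm A * norm x"
proof -
  have row: "norm ((A *v x) $ i) \<le> norm (A $ i) * norm x" for i
  proof -
    have "norm ((A *v x) $ i) \<le> (\<Sum>j\<in>UNIV. norm (A $ i $ j) * norm (x $ j))"
      unfolding matrix_vector_mult_def by (simp, intro order_trans[OF norm_sum] sum_mono) (simp add: norm_mult)
    also have "\<dots> \<le> L2_set (\<lambda>j. norm (A $ i $ j)) UNIV * L2_set (\<lambda>j. norm (x $ j)) UNIV"
      using L2_set_mult_ineq[of "\<lambda>j. norm (A $ i $ j)" "\<lambda>j. norm (x $ j)" UNIV] by simp
    finally show ?thesis by (simp add: norm_vec_def)
  qed
  have "norm (A *v x) \<le> L2_set (\<lambda>i. norm (A $ i) * norm x) UNIV"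
    unfolding norm_vec_def[of "A *v x"] by (intro L2_set_mono row) auto
  also have "\<dots> = norm A * norm x"
    by (simp add: norm_vec_def[of A] L2_set_right_distrib mult.commute[of _ "norm x"])
  finally show ?thesis .
qed

lemma norm_vis_le: obtains c where "c \<ge> 0" "\<And>x. norm (vis \<sigma> U x) \<le> c * norm x"
proof -
  have "norm (vis \<sigma> U x) \<le> norm (diagm (\<lambda>i. complex_of_real (sqrt (\<sigma> i)))) * (norm (cadj U) * norm x)" for x
    unfolding vis_def by (intro order_trans[OF norm_matrix_vector_mult_le] mult_left_mono norm_matrix_vector_mult_le) auto
  then show ?thesis
    by (intro that[of "norm (diagm (\<lambda>i. complex_of_real (sqrt (\<sigma> i)))) * norm (cadj U)"]) (auto simp: ac_simps)
qed

text \<open>The trace of \<open>cadj G ** G\<close> is the squared norm of \<open>G\<close>, and the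
  trace of an integrable matrix is integrable.\<close>

lemma nn_integral_norm_square_stats:
  fixes PG :: "(complex^'r::finite^'n::finite) measure"
  assumes "valid_stats \<sigma> U PG"
  shows "(\<integral>\<^sup>+G. ennreal ((norm G)\<^sup>2) \<partial>PG) < \<infinity>"
proof -
  have i: "integrable PG (\<lambda>G. cadj G ** G)" using assms by (auto simp: valid_stats_def intro: integrable.intros)
  have "bounded_linear (\<lambda>M::complex^'r^'r. \<Sum>j\<in>UNIV. Re (M $ j $ j))"
    by (intro bounded_linear_sum bounded_linear_compose[OF bounded_linear_Re] bounded_linear_compose[OF bounded_linear_vec_nth] bounded_linear_vec_nth)
  then have "integrable PG (\<lambda>G. \<Sum>j\<in>UNIV. Re ((cadj G ** G) $ j $ j))" by (rule integrable_bounded_linear[OF _ i])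
  moreover have "(\<Sum>j\<in>UNIV. Re ((cadj G ** G) $ j $ j)) = (norm G)\<^sup>2" for G :: "complex^'r^'n"
  proof -
    have "Re ((cadj G ** G) $ j $ j) = (\<Sum>i\<in>UNIV. (norm (G $ i $ j))\<^sup>2)" for j
      by (simp add: matrix_matrix_mult_def cadj_def cmod_power2) (simp add: power2_eq_square)
    moreover have "(norm G)\<^sup>2 = (\<Sum>i\<in>UNIV. \<Sum>j\<in>UNIV. (norm (G $ i $ j))\<^sup>2)"
      by (simp add: norm_vec_def L2_set_def sum_nonneg)
    ultimately show ?thesis by simp (rule sum.swap)
  qed
  ultimately have "integrable PG (\<lambda>G. (norm G)\<^sup>2)" by simp
  then show ?thesis by (simp add: integrable_iff_bounded)
qed

section \<open>Converse\<close>

text \<open>The conclusion of \<open>converse_core\<close> with \<open>\<beta>\<close> in place of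
  \<open>card I / 2\<close>; thus \<open>\<beta>\<close> counts complex coefficients. Messages are
  pairs so that the same notion serves one user and both users together.\<close>

definition packing_bound :: "'g measure \<Rightarrow> 'e::euclidean_space measure \<Rightarrow> ('x::real_normed_vector \<Rightarrow> 'g \<Rightarrow> 'e) \<Rightarrow> real \<Rightarrow> bool" where
  "packing_bound PQ \<nu> Y \<beta> \<longleftrightarrow> (\<exists>C. \<forall>\<rho>\<ge>1. \<forall>J>0. \<forall>Ms (enc :: nat \<times> nat \<Rightarrow> nat \<Rightarrow> 'x) D. finite Ms \<longrightarrow>
    (\<forall>m\<in>Ms. (\<Sum>j<J. (norm (enc m j))\<^sup>2) \<le> real J * \<rho>) \<longrightarrow>
    disjoint_family_on D Ms \<longrightarrow> (\<forall>m\<in>Ms. D m \<in> sets (PiM {..<J} (\<lambda>_. PQ \<Otimes>\<^sub>M \<nu>))) \<longrightarrow>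
    3 / 4 * card Ms \<le> (\<Sum>m\<in>Ms. measure (PiM {..<J} (\<lambda>_. PQ \<Otimes>\<^sub>M \<nu>))
       {\<omega> \<in> space (PiM {..<J} (\<lambda>_. PQ \<Otimes>\<^sub>M \<nu>)).
         (\<lambda>j\<in>{..<J}. (fst (\<omega> j), Y (enc m j) (fst (\<omega> j)) + snd (\<omega> j))) \<in> D m}) \<longrightarrow>
    real (card Ms) \<le> 2 * exp (real J * (C + \<beta> * ln \<rho>)))"

text \<open>The flags select the receivers that are counted. An uncounted receiver gets noise alone,
  so all bounds live on one output space.\<close>

definition joint_out :: "bool \<Rightarrow> bool \<Rightarrow> ('r1::finite \<Rightarrow> real) \<Rightarrow> complex^'r1^'m::finite \<Rightarrow> ('r2::finite \<Rightarrow> real) \<Rightarrow> complex^'r2^'m \<Rightarrow>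
    complex^'m \<Rightarrow> (complex^'r1^'n1::finite) \<times> (complex^'r2^'n2::finite) \<Rightarrow> (complex^'n1) \<times> (complex^'n2)" where
  "joint_out p1 p2 \<sigma>1 U1 \<sigma>2 U2 x G =
     (if p1 then chan (fst G) \<sigma>1 U1 *v x else 0, if p2 then chan (snd G) \<sigma>2 U2 *v x else 0)"

lemma matrix_vector_mult_measurable [measurable]:
  "(\<lambda>G :: complex^'r::finite^'n::finite. G *v x) \<in> borel_measurable borel"
  unfolding matrix_vector_mult_def
  by (intro borel_measurable_continuous_onI continuous_intros)

lemma vec_nth_measurable [measurable]: "(\<lambda>y :: complex^'n::finite. y $ i) \<in> borel_measurable borel"
  by (intro borel_measurable_continuous_onI continuous_intros)

lemma chan_measurable [measurable]:
  "(\<lambda>G :: complex^'r::finite^'n::finite. chan G \<sigma> (U :: complex^'r^'m::finite)) \<in> borel_measurable borel"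
  unfolding chan_def matrix_matrix_mult_def
  by (intro borel_measurable_continuous_onI continuous_intros)

lemma nn_integral_marginal_square:
  assumes st: "valid_stats \<sigma> U PG" and q [measurable]: "q \<in> PJ \<rightarrow>\<^sub>M borel" and m: "distr PJ borel q = PG"
  obtains c where "c \<ge> 0" "\<And>x. (\<integral>\<^sup>+G. ennreal ((norm (chan (q G) \<sigma> U *v x))\<^sup>2) \<partial>PJ) \<le> ennreal (c * (norm x)\<^sup>2)"
proof -
  obtain c0 where c0: "c0 \<ge> 0" "\<And>x. norm (vis \<sigma> U x) \<le> c0 * norm x" using norm_vis_le[of \<sigma> U] by blast
  define K where "K = enn2real (\<integral>\<^sup>+G. ennreal ((norm G)\<^sup>2) \<partial>PG)"
  have "(\<integral>\<^sup>+G. ennreal ((norm G)\<^sup>2) \<partial>PG) = ennreal K" "K \<ge> 0"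
    using nn_integral_norm_square_stats[OF st] unfolding K_def by (auto simp: ennreal_enn2real_if less_top)
  then have K: "(\<integral>\<^sup>+G. ennreal ((norm (q G))\<^sup>2) \<partial>PJ) = ennreal K" "K \<ge> 0"
    unfolding m[symmetric] by (auto simp: nn_integral_distr)
  show ?thesis
  proof (rule that)
    show "K * c0\<^sup>2 \<ge> 0" using K by simp
    fix x
    have "(\<integral>\<^sup>+G. ennreal ((norm (chan (q G) \<sigma> U *v x))\<^sup>2) \<partial>PJ) \<le> (\<integral>\<^sup>+G. ennreal ((c0 * norm x)\<^sup>2) * ennreal ((norm (q G))\<^sup>2) \<partial>PJ)"
    proof (rule nn_integral_mono)
      fix G
      have "norm (chan (q G) \<sigma> U *v x) \<le> norm (q G) * (c0 * norm x)"
        unfolding chan_mult_vec by (intro order_trans[OF norm_matrix_vector_mult_le] mult_left_mono c0) auto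
      then have "(norm (chan (q G) \<sigma> U *v x))\<^sup>2 \<le> (norm (q G) * (c0 * norm x))\<^sup>2" by (rule power_mono) simp
      then show "ennreal ((norm (chan (q G) \<sigma> U *v x))\<^sup>2) \<le> ennreal ((c0 * norm x)\<^sup>2) * ennreal ((norm (q G))\<^sup>2)"
        by (simp add: ennreal_mult[symmetric] power_mult_distrib ennreal_leI mult.commute)
    qed
    also have "\<dots> = ennreal ((c0 * norm x)\<^sup>2) * ennreal K" by (simp add: nn_integral_cmult K)
    also have "\<dots> = ennreal (K * c0\<^sup>2 * (norm x)\<^sup>2)" using K by (simp add: ennreal_mult[symmetric] power_mult_distrib ac_simps)
    finally show "(\<integral>\<^sup>+G. ennreal ((norm (chan (q G) \<sigma> U *v x))\<^sup>2) \<partial>PJ) \<le> ennreal (K * c0\<^sup>2 * (norm x)\<^sup>2)" .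
  qed
qed

lemma scaleR_vec_complex: "r *\<^sub>R (x :: complex^'m) = complex_of_real r *s x"
proof -
  have "(r *\<^sub>R x) $ i = (complex_of_real r *s x) $ i" for i
    by (simp only: vector_scaleR_component vector_smult_component) (rule scaleR_conv_of_real)
  then show ?thesis by (simp add: vec_eq_iff)
qed

lemma matrix_vector_mult_sum_smult: "A *v (\<Sum>e\<in>E. c e *s b e) = (\<Sum>e\<in>E. c e *s (A *v b e))"
  for A :: "complex^'m::finite^'n::finite"
  by (simp add: vec.sum vec.scale)

text \<open>\<open>converse_core\<close> rounds real coefficients, so each complex one is split in
  two and the index set doubles.\<close>

lemma matrix_vector_mult_sum_Re_Im:
  fixes A :: "complex^'m::finite^'n::finite"
  assumes "finite E"
  shows "A *v (\<Sum>e\<in>E. c e *s b e) = (\<Sum>(e, t)\<in>E \<times> UNIV. (if t then Re (c e) else Im (c e)) *\<^sub>R (A *v (if t then b e else \<i> *s b e)))"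
proof -
  have "c e *s (A *v b e) = Re (c e) *\<^sub>R (A *v b e) + Im (c e) *\<^sub>R (A *v (\<i> *s b e))" for e
    by (simp add: vec.scale scaleR_vec_complex vec.scale_left_distrib[symmetric] complex_eq[symmetric] mult.commute)
  then show ?thesis using assms
    by (simp add: matrix_vector_mult_sum_smult sum.cartesian_product[symmetric] UNIV_bool add.commute)
qed

lemma vec_expansion_Re_Im:
  fixes y :: "complex^'n::finite"
  shows "y = (\<Sum>i\<in>UNIV. (if snd i then Re (y $ fst i) else Im (y $ fst i)) *\<^sub>R axis (fst i) (if snd i then 1 else \<i>))"
proof -
  have "\<i> *s axis i 1 = axis i \<i>" for i :: 'n by (simp add: vec_eq_iff axis_def)
  then have "(if t then axis i 1 else \<i> *s axis i 1) = axis i (if t then 1 else \<i>)" for i :: 'n and t by simp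
  then show ?thesis
    using matrix_vector_mult_sum_Re_Im[of "UNIV :: 'n set" "mat 1 :: complex^'n^'n" "\<lambda>i. y $ i" "\<lambda>i. axis i 1"]
    by (simp add: basis_expansion case_prod_beta')
qed

locale two_user_bc =
  fixes \<sigma>1 :: "'r1::finite \<Rightarrow> real" and U1 :: "complex^'r1^'m::finite"
    and \<sigma>2 :: "'r2::finite \<Rightarrow> real" and U2 :: "complex^'r2^'m"
    and PG1 :: "(complex^'r1^'n1::finite) measure" and PG2 :: "(complex^'r2^'n2::finite) measure"
    and PJ :: "((complex^'r1^'n1) \<times> (complex^'r2^'n2)) measure"
  assumes stats1: "valid_stats \<sigma>1 U1 PG1"
    and stats2: "valid_stats \<sigma>2 U2 PG2"
    and joint: "prob_space PJ" "sets PJ = sets borel"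
    and marg1: "distr PJ borel fst = PG1"
    and marg2: "distr PJ borel snd = PG2"
begin

lemma tame_pair: "tame_noise ((cnoise :: (complex^'n1) measure) \<Otimes>\<^sub>M (cnoise :: (complex^'n2) measure))"
  by (intro tame_noise_Pair tame_noise_cnoise)

lemma fst_snd_PJ: "fst \<in> PJ \<rightarrow>\<^sub>M borel" "snd \<in> PJ \<rightarrow>\<^sub>M borel"
  unfolding measurable_cong_sets[OF joint(2) refl]
  by (intro borel_measurable_continuous_onI continuous_intros)+

lemma joint_out_measurable: "joint_out p1 p2 \<sigma>1 U1 \<sigma>2 U2 x \<in> borel_measurable PJ"
proof -
  note [measurable] = fst_snd_PJ
  show ?thesis unfolding joint_out_def chan_mult_vec
    by (cases p1; cases p2) (simp_all, measurable)
qed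

lemma joint_out_square_finite:
  "(\<integral>\<^sup>+G. ennreal ((norm (joint_out p1 p2 \<sigma>1 U1 \<sigma>2 U2 x G))\<^sup>2) \<partial>PJ) < \<infinity>"
proof -
  note [measurable] = fst_snd_PJ
  obtain c1 where c1: "\<And>x. (\<integral>\<^sup>+G. ennreal ((norm (chan (fst G) \<sigma>1 U1 *v x))\<^sup>2) \<partial>PJ) \<le> ennreal (c1 * (norm x)\<^sup>2)"
    using nn_integral_marginal_square[OF stats1 fst_snd_PJ(1) marg1] by blast
  obtain c2 where c2: "\<And>x. (\<integral>\<^sup>+G. ennreal ((norm (chan (snd G) \<sigma>2 U2 *v x))\<^sup>2) \<partial>PJ) \<le> ennreal (c2 * (norm x)\<^sup>2)"
    using nn_integral_marginal_square[OF stats2 fst_snd_PJ(2) marg2] by blast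
  have "(\<integral>\<^sup>+G. ennreal ((norm (joint_out p1 p2 \<sigma>1 U1 \<sigma>2 U2 x G))\<^sup>2) \<partial>PJ) \<le>
     (\<integral>\<^sup>+G. ennreal ((norm (chan (fst G) \<sigma>1 U1 *v x))\<^sup>2) + ennreal ((norm (chan (snd G) \<sigma>2 U2 *v x))\<^sup>2) \<partial>PJ)"
    by (intro nn_integral_mono) (simp add: joint_out_def norm_Pair flip: ennreal_plus)
  also have "\<dots> = (\<integral>\<^sup>+G. ennreal ((norm (chan (fst G) \<sigma>1 U1 *v x))\<^sup>2) \<partial>PJ) + (\<integral>\<^sup>+G. ennreal ((norm (chan (snd G) \<sigma>2 U2 *v x))\<^sup>2) \<partial>PJ)"
    unfolding chan_mult_vec by (rule nn_integral_add) measurable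
  also have "\<dots> \<le> ennreal (c1 * (norm x)\<^sup>2) + ennreal (c2 * (norm x)\<^sup>2)" by (intro add_mono c1 c2)
  also have "\<dots> < \<infinity>" by simp
  finally show ?thesis .
qed

text \<open>The coefficients \<open>hip e x\<close> are deterministic and the vectors they multiply,
  the outputs for the inputs \<open>b e\<close> and their multiples by \<open>\<i>\<close>, are
  random. One common expansion in \<open>E\<close> is valid for every counted user because
  \<open>E\<close> contains a basis of its span.\<close>

lemma packing_bound_streams:
  assumes ind: "vec.independent E"
    and F1: "p1 \<Longrightarrow> F1 \<subseteq> E \<and> vec.span F1 = vec.span (columns U1)"
    and F2: "p2 \<Longrightarrow> F2 \<subseteq> E \<and> vec.span F2 = vec.span (columns U2)"
  shows "packing_bound PJ (cnoise \<Otimes>\<^sub>M cnoise) (joint_out p1 p2 \<sigma>1 U1 \<sigma>2 U2) (real (card E))"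
proof -
  interpret prob_space PJ by (rule joint(1))
  have fin: "finite E" using ind vec.finiteI_independent by blast
  obtain b where b: "\<And>e e'. e \<in> E \<Longrightarrow> e' \<in> E \<Longrightarrow> hip e' (b e) = (if e' = e then 1 else 0)"
    using dual_family[OF ind] by blast
  define v where "v x i G = (if snd i then Re (hip (fst i) x) else Im (hip (fst i) x))"
    for x and i :: "(complex^'m) \<times> bool" and G :: "(complex^'r1^'n1) \<times> (complex^'r2^'n2)"
  define B where "B i G = joint_out p1 p2 \<sigma>1 U1 \<sigma>2 U2 (if snd i then b (fst i) else \<i> *s b (fst i)) G"
    for i and G :: "(complex^'r1^'n1) \<times> (complex^'r2^'n2)"
  define c where "c = (\<Sum>e\<in>E. (\<Sum>j\<in>UNIV. norm (e $ j))\<^sup>2)"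
  have Y: "joint_out p1 p2 \<sigma>1 U1 \<sigma>2 U2 x G = (\<Sum>i\<in>E \<times> UNIV. v x i G *\<^sub>R B i G)" for x G
  proof -
    have 1: "chan (fst G) \<sigma>1 U1 *v x = (\<Sum>i\<in>E \<times> UNIV. v x i G *\<^sub>R (chan (fst G) \<sigma>1 U1 *v (if snd i then b (fst i) else \<i> *s b (fst i))))" if p1
    proof -
      have "chan (fst G) \<sigma>1 U1 *v x = chan (fst G) \<sigma>1 U1 *v (\<Sum>e\<in>E. hip e x *s b e)"
        unfolding chan_mult_vec by (intro arg_cong2[where f="(*v)"] refl vis_cong cadj_expansion[where F=F1, OF b]) (use F1[OF that] fin in auto)
      then show ?thesis unfolding matrix_vector_mult_sum_Re_Im[OF fin] v_def by (simp add: case_prod_beta')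
    qed
    have 2: "chan (snd G) \<sigma>2 U2 *v x = (\<Sum>i\<in>E \<times> UNIV. v x i G *\<^sub>R (chan (snd G) \<sigma>2 U2 *v (if snd i then b (fst i) else \<i> *s b (fst i))))" if p2
    proof -
      have "chan (snd G) \<sigma>2 U2 *v x = chan (snd G) \<sigma>2 U2 *v (\<Sum>e\<in>E. hip e x *s b e)"
        unfolding chan_mult_vec by (intro arg_cong2[where f="(*v)"] refl vis_cong cadj_expansion[where F=F2, OF b]) (use F2[OF that] fin in auto)
      then show ?thesis unfolding matrix_vector_mult_sum_Re_Im[OF fin] v_def by (simp add: case_prod_beta')
    qed
    show ?thesis
      by (rule prod_eqI) (auto simp: joint_out_def B_def fst_sum snd_sum 1 2)
  qed
  have v2: "(\<integral>\<^sup>+G. ennreal ((v x i G)\<^sup>2) \<partial>PJ) \<le> ennreal (c * (norm x)\<^sup>2)" if "i \<in> E \<times> UNIV" for x i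
  proof -
    have "(v x i G)\<^sup>2 \<le> c * (norm x)\<^sup>2" for G
    proof -
      have "\<bar>v x i G\<bar> \<le> norm (hip (fst i) x)" by (simp add: v_def abs_Re_le_cmod abs_Im_le_cmod)
      also have "\<dots> \<le> (\<Sum>j\<in>UNIV. norm (fst i $ j)) * norm x" by (rule norm_hip_le)
      finally have "\<bar>v x i G\<bar>\<^sup>2 \<le> ((\<Sum>j\<in>UNIV. norm (fst i $ j)) * norm x)\<^sup>2" by (rule power_mono) simp
      also have "\<dots> \<le> c * (norm x)\<^sup>2"
        unfolding power_mult_distrib c_def using that fin
        by (intro mult_right_mono member_le_sum[of "fst i" E "\<lambda>e. (\<Sum>j\<in>UNIV. norm (e $ j))\<^sup>2"]) auto
      finally show ?thesis by simp
    qed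
    then have "(\<integral>\<^sup>+G. ennreal ((v x i G)\<^sup>2) \<partial>PJ) \<le> (\<integral>\<^sup>+G. ennreal (c * (norm x)\<^sup>2) \<partial>PJ)"
      by (intro nn_integral_mono ennreal_leI)
    then show ?thesis by (simp add: emeasure_space_1)
  qed
  have c0: "c \<ge> 0" unfolding c_def by (intro sum_nonneg) auto
  have "card (E \<times> (UNIV :: bool set)) / 2 = real (card E)" by (simp add: card_cartesian_product)
  then show ?thesis
    unfolding packing_bound_def
    using converse_core[where 'm="nat \<times> nat", OF joint(1) tame_pair _ _ _ Y _ v2 c0]
    using fin joint_out_measurable joint_out_square_finite by (auto simp: B_def v_def)
qed

text \<open>Here the roles are exchanged: the vectors are the fixed unit vectors of the antennas and
  the coefficients, the entries of the noiseless output, depend on the fading. Their mean square is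
  of order \<open>(norm x)\<^sup>2\<close>, as \<open>converse_core\<close> requires.\<close>

lemma packing_bound_antennas1:
  "packing_bound PJ (cnoise \<Otimes>\<^sub>M cnoise) (joint_out True False \<sigma>1 U1 \<sigma>2 U2) (real CARD('n1))"
proof -
  interpret prob_space PJ by (rule joint(1))
  note [measurable] = fst_snd_PJ
  obtain c where c: "c \<ge> 0" "\<And>x. (\<integral>\<^sup>+G. ennreal ((norm (chan (fst G) \<sigma>1 U1 *v x))\<^sup>2) \<partial>PJ) \<le> ennreal (c * (norm x)\<^sup>2)"
    using nn_integral_marginal_square[OF stats1 fst_snd_PJ(1) marg1] by blast
  define v where "v x i G = (if snd i then Re ((chan (fst G) \<sigma>1 U1 *v x) $ fst i) else Im ((chan (fst G) \<sigma>1 U1 *v x) $ fst i))"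
    for x and i :: "'n1 \<times> bool" and G :: "(complex^'r1^'n1) \<times> (complex^'r2^'n2)"
  define B where "B i G = (axis (fst i) (if snd i then 1 else \<i>), 0 :: complex^'n2)" for i :: "'n1 \<times> bool" and G :: "(complex^'r1^'n1) \<times> (complex^'r2^'n2)"
  have Y: "joint_out True False \<sigma>1 U1 \<sigma>2 U2 x G = (\<Sum>i\<in>UNIV. v x i G *\<^sub>R B i G)" for x G
    unfolding joint_out_def v_def B_def using vec_expansion_Re_Im[of "chan (fst G) \<sigma>1 U1 *v x"]
    by (intro prod_eqI) (auto simp: fst_sum snd_sum)
  have v2: "(\<integral>\<^sup>+G. ennreal ((v x i G)\<^sup>2) \<partial>PJ) \<le> ennreal (c * (norm x)\<^sup>2)" for x i
  proof (rule order_trans[OF nn_integral_mono c(2)], rule ennreal_leI)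
    fix G
    have "\<bar>v x i G\<bar> \<le> norm ((chan (fst G) \<sigma>1 U1 *v x) $ fst i)" by (simp add: v_def abs_Re_le_cmod abs_Im_le_cmod)
    also have "\<dots> \<le> norm (chan (fst G) \<sigma>1 U1 *v x)" by (rule Finite_Cartesian_Product.norm_nth_le)
    finally show "(v x i G)\<^sup>2 \<le> (norm (chan (fst G) \<sigma>1 U1 *v x))\<^sup>2" by (simp add: abs_le_square_iff[symmetric])
  qed
  have vm: "v x i \<in> borel_measurable PJ" for x i
    unfolding v_def chan_mult_vec by (cases "snd i") (simp_all, measurable)
  have Bm: "B i \<in> PJ \<rightarrow>\<^sub>M borel" for i unfolding B_def by simp
  have B2: "(\<integral>\<^sup>+G. ennreal ((norm (B i G))\<^sup>2) \<partial>PJ) < \<infinity>" for i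
    unfolding B_def by (simp add: emeasure_space_1)
  have "card (UNIV :: ('n1 \<times> bool) set) / 2 = real CARD('n1)" by simp
  then show ?thesis
    unfolding packing_bound_def
    using converse_core[where 'm="nat \<times> nat", OF joint(1) tame_pair finite_class.finite_UNIV Bm vm Y B2 v2 c(1)] by simp
qed

lemma packing_bound_antennas2:
  "packing_bound PJ (cnoise \<Otimes>\<^sub>M cnoise) (joint_out False True \<sigma>1 U1 \<sigma>2 U2) (real CARD('n2))"
proof -
  interpret prob_space PJ by (rule joint(1))
  note [measurable] = fst_snd_PJ
  obtain c where c: "c \<ge> 0" "\<And>x. (\<integral>\<^sup>+G. ennreal ((norm (chan (snd G) \<sigma>2 U2 *v x))\<^sup>2) \<partial>PJ) \<le> ennreal (c * (norm x)\<^sup>2)"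
    using nn_integral_marginal_square[OF stats2 fst_snd_PJ(2) marg2] by blast
  define v where "v x i G = (if snd i then Re ((chan (snd G) \<sigma>2 U2 *v x) $ fst i) else Im ((chan (snd G) \<sigma>2 U2 *v x) $ fst i))"
    for x and i :: "'n2 \<times> bool" and G :: "(complex^'r1^'n1) \<times> (complex^'r2^'n2)"
  define B where "B i G = (0 :: complex^'n1, axis (fst i) (if snd i then 1 else \<i>))" for i :: "'n2 \<times> bool" and G :: "(complex^'r1^'n1) \<times> (complex^'r2^'n2)"
  have Y: "joint_out False True \<sigma>1 U1 \<sigma>2 U2 x G = (\<Sum>i\<in>UNIV. v x i G *\<^sub>R B i G)" for x G
    unfolding joint_out_def v_def B_def using vec_expansion_Re_Im[of "chan (snd G) \<sigma>2 U2 *v x"]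
    by (intro prod_eqI) (auto simp: fst_sum snd_sum)
  have v2: "(\<integral>\<^sup>+G. ennreal ((v x i G)\<^sup>2) \<partial>PJ) \<le> ennreal (c * (norm x)\<^sup>2)" for x i
  proof (rule order_trans[OF nn_integral_mono c(2)], rule ennreal_leI)
    fix G
    have "\<bar>v x i G\<bar> \<le> norm ((chan (snd G) \<sigma>2 U2 *v x) $ fst i)" by (simp add: v_def abs_Re_le_cmod abs_Im_le_cmod)
    also have "\<dots> \<le> norm (chan (snd G) \<sigma>2 U2 *v x)" by (rule Finite_Cartesian_Product.norm_nth_le)
    finally show "(v x i G)\<^sup>2 \<le> (norm (chan (snd G) \<sigma>2 U2 *v x))\<^sup>2" by (simp add: abs_le_square_iff[symmetric])
  qed
  have vm: "v x i \<in> borel_measurable PJ" for x i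
    unfolding v_def chan_mult_vec by (cases "snd i") (simp_all, measurable)
  have Bm: "B i \<in> PJ \<rightarrow>\<^sub>M borel" for i unfolding B_def by simp
  have B2: "(\<integral>\<^sup>+G. ennreal ((norm (B i G))\<^sup>2) \<partial>PJ) < \<infinity>" for i
    unfolding B_def by (simp add: emeasure_space_1)
  have "card (UNIV :: ('n2 \<times> bool) set) / 2 = real CARD('n2)" by simp
  then show ?thesis
    unfolding packing_bound_def
    using converse_core[where 'm="nat \<times> nat", OF joint(1) tame_pair finite_class.finite_UNIV Bm vm Y B2 v2 c(1)] by simp
qed

end

section \<open>From codes to bounds on the degrees of freedom\<close>

text \<open>Averaging: when only one user is counted, the message of the other can be frozen at a
  value for which the mean error does not increase.\<close>

lemma exists_column_le_average:
  fixes f :: "nat \<Rightarrow> nat \<Rightarrow> real"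
  assumes "(\<Sum>a<K. \<Sum>b<L. f a b) \<le> c * (real K * real L)" "L > 0"
  shows "\<exists>b<L. (\<Sum>a<K. f a b) \<le> c * real K"
proof (rule ccontr)
  assume "\<not> ?thesis"
  then have "(\<Sum>b<L. c * real K) < (\<Sum>b<L. \<Sum>a<K. f a b)"
    using assms(2) by (intro sum_strict_mono) auto
  also have "\<dots> = (\<Sum>a<K. \<Sum>b<L. f a b)" by (rule sum.swap)
  finally show False using assms(1) by (simp add: ac_simps)
qed

lemma sets_cnoise [simp]: "sets cnoise = sets borel"
  by (simp add: cnoise_def)

definition err_event where
  "err_event \<sigma>1 U1 \<sigma>2 U2 PJ J enc dec1 dec2 m1 m2 = {\<omega> \<in> space (block_space PJ J).
      dec1 (\<lambda>j\<in>{..<J}. (chan (fst (fst (\<omega> j))) \<sigma>1 U1,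
              chan (fst (fst (\<omega> j))) \<sigma>1 U1 *v enc m1 m2 j + fst (snd (\<omega> j)))) \<noteq> m1 \<or>
      dec2 (\<lambda>j\<in>{..<J}. (chan (snd (fst (\<omega> j))) \<sigma>2 U2,
              chan (snd (fst (\<omega> j))) \<sigma>2 U2 *v enc m1 m2 j + snd (snd (\<omega> j)))) \<noteq> m2}"

lemma code_exists_iff:
  "code_exists \<sigma>1 U1 \<sigma>2 U2 PJ \<rho> J L1 L2 \<epsilon> \<longleftrightarrow>
     (\<exists>enc dec1 dec2. (\<forall>m1<L1. \<forall>m2<L2. (\<Sum>j<J. (norm (enc m1 m2 j))\<^sup>2) / real J \<le> \<rho>) \<and>
       dec1 \<in> PiM {..<J} (\<lambda>_. borel) \<rightarrow>\<^sub>M count_space UNIV \<and>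
       dec2 \<in> PiM {..<J} (\<lambda>_. borel) \<rightarrow>\<^sub>M count_space UNIV \<and>
       (\<forall>m1<L1. \<forall>m2<L2. err_event \<sigma>1 U1 \<sigma>2 U2 PJ J enc dec1 dec2 m1 m2 \<in> sets (block_space PJ J)) \<and>
       (\<Sum>m1<L1. \<Sum>m2<L2. measure (block_space PJ J) (err_event \<sigma>1 U1 \<sigma>2 U2 PJ J enc dec1 dec2 m1 m2)) / (real L1 * real L2) \<le> \<epsilon>)"
  unfolding code_exists_def err_event_def Let_def by (rule refl)

context two_user_bc
begin

lemma PiM_chan_measurable1:
  "(\<lambda>\<omega>. \<lambda>j\<in>{..<J}. (chan (fst (fst (\<omega> j))) \<sigma>1 U1, fst (snd (\<omega> j)))) \<in>
     PiM {..<J} (\<lambda>_. PJ \<Otimes>\<^sub>M (cnoise \<Otimes>\<^sub>M cnoise)) \<rightarrow>\<^sub>M PiM {..<J} (\<lambda>_. borel :: ((complex^'m^'n1) \<times> (complex^'n1)) measure)"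
proof -
  have "(\<lambda>z. chan (fst (fst z)) \<sigma>1 U1) \<in> borel_measurable (PJ \<Otimes>\<^sub>M (cnoise \<Otimes>\<^sub>M cnoise))"
    by (rule measurable_compose[OF measurable_compose[OF measurable_fst fst_snd_PJ(1)] chan_measurable])
  moreover have "(\<lambda>z. fst (snd z)) \<in> borel_measurable (PJ \<Otimes>\<^sub>M (cnoise \<Otimes>\<^sub>M cnoise))"
    using measurable_compose[OF measurable_snd measurable_fst, of PJ cnoise cnoise]
    unfolding measurable_cong_sets[OF refl sets_cnoise] .
  ultimately have "(\<lambda>z. (chan (fst (fst z)) \<sigma>1 U1, fst (snd z))) \<in> PJ \<Otimes>\<^sub>M (cnoise \<Otimes>\<^sub>M cnoise) \<rightarrow>\<^sub>M borel"
    by (rule borel_measurable_Pair)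
  then show ?thesis by measurable
qed

lemma PiM_chan_measurable2:
  "(\<lambda>\<omega>. \<lambda>j\<in>{..<J}. (chan (snd (fst (\<omega> j))) \<sigma>2 U2, snd (snd (\<omega> j)))) \<in>
     PiM {..<J} (\<lambda>_. PJ \<Otimes>\<^sub>M (cnoise \<Otimes>\<^sub>M cnoise)) \<rightarrow>\<^sub>M PiM {..<J} (\<lambda>_. borel :: ((complex^'m^'n2) \<times> (complex^'n2)) measure)"
proof -
  have "(\<lambda>z. chan (snd (fst z)) \<sigma>2 U2) \<in> borel_measurable (PJ \<Otimes>\<^sub>M (cnoise \<Otimes>\<^sub>M cnoise))"
    by (rule measurable_compose[OF measurable_compose[OF measurable_fst fst_snd_PJ(2)] chan_measurable])
  moreover have "(\<lambda>z. snd (snd z)) \<in> borel_measurable (PJ \<Otimes>\<^sub>M (cnoise \<Otimes>\<^sub>M cnoise))"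
    using measurable_compose[OF measurable_snd measurable_snd, of PJ cnoise cnoise]
    unfolding measurable_cong_sets[OF refl sets_cnoise] .
  ultimately have "(\<lambda>z. (chan (snd (fst z)) \<sigma>2 U2, snd (snd z))) \<in> PJ \<Otimes>\<^sub>M (cnoise \<Otimes>\<^sub>M cnoise) \<rightarrow>\<^sub>M borel"
    by (rule borel_measurable_Pair)
  then show ?thesis by measurable
qed

lemma prob_space_block: "prob_space (block_space PJ J)"
proof -
  interpret PJ: prob_space PJ by (rule joint(1))
  interpret N: prob_space "(cnoise :: (complex^'n1) measure) \<Otimes>\<^sub>M (cnoise :: (complex^'n2) measure)"
    using tame_pair by (simp add: tame_noise_def)
  interpret P: pair_prob_space PJ "(cnoise :: (complex^'n1) measure) \<Otimes>\<^sub>M (cnoise :: (complex^'n2) measure)" ..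
  show ?thesis unfolding block_space_def by (intro prob_space_PiM P.prob_space_axioms)
qed

text \<open>The success sets of the counted decoders form a packing in the joint space of fadings
  and outputs. Genie-aided observation only helps: the set for a counted user is measurable with
  respect to what that user alone receives.\<close>

lemma rate_bound:
  assumes pb: "packing_bound PJ (cnoise \<Otimes>\<^sub>M cnoise) (joint_out p1 p2 \<sigma>1 U1 \<sigma>2 U2) \<beta>" and p: "p1 \<or> p2"
  shows "\<exists>C. \<forall>\<rho>\<ge>1. \<forall>R. achievable_rate \<sigma>1 U1 \<sigma>2 U2 PJ \<rho> R \<longrightarrow>
    (if p1 then fst R else 0) + (if p2 then snd R else 0) \<le> C + \<beta> * ln \<rho>"
proof -
  obtain C where C0: "\<forall>\<rho>\<ge>1. \<forall>J>0. \<forall>Ms (enc :: nat \<times> nat \<Rightarrow> nat \<Rightarrow> complex^'m) D. finite Ms \<longrightarrow>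
    (\<forall>m\<in>Ms. (\<Sum>j<J. (norm (enc m j))\<^sup>2) \<le> real J * \<rho>) \<longrightarrow>
    disjoint_family_on D Ms \<longrightarrow> (\<forall>m\<in>Ms. D m \<in> sets (block_space PJ J)) \<longrightarrow>
    3 / 4 * card Ms \<le> (\<Sum>m\<in>Ms. measure (block_space PJ J)
       {\<omega> \<in> space (block_space PJ J).
         (\<lambda>j\<in>{..<J}. (fst (\<omega> j), joint_out p1 p2 \<sigma>1 U1 \<sigma>2 U2 (enc m j) (fst (\<omega> j)) + snd (\<omega> j))) \<in> D m}) \<longrightarrow>
    real (card Ms) \<le> 2 * exp (real J * (C + \<beta> * ln \<rho>))"
    using pb unfolding packing_bound_def block_space_def[symmetric] by (elim exE) (rule that)
  note C = C0[rule_format]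
  show ?thesis
  proof (intro exI[of _ "C + ln 2"] allI impI)
    fix \<rho> :: real and R assume \<rho>: "\<rho> \<ge> 1" and R: "achievable_rate \<sigma>1 U1 \<sigma>2 U2 PJ \<rho> R"
    define rate where "rate = (if p1 then fst R else 0) + (if p2 then snd R else 0)"
    have R0: "fst R \<ge> 0" "snd R \<ge> 0" using R by (auto simp: achievable_rate_def)
    \<comment> \<open>Error \<open>1 / 4\<close> leaves exactly the success \<open>3 / 4\<close>
      asked for by \<open>packing_bound\<close>; a single block length is enough.\<close>
    obtain J0 where J0: "\<forall>J\<ge>J0. J > 0 \<longrightarrow> (\<exists>L1 L2. real L1 \<ge> exp (real J * fst R) \<and> real L2 \<ge> exp (real J * snd R) \<and>
                 code_exists \<sigma>1 U1 \<sigma>2 U2 PJ \<rho> J L1 L2 (1/4))"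
      using R unfolding achievable_rate_def by (metis zero_less_divide_1_iff zero_less_numeral)
    define J where "J = Suc J0"
    have J: "J > 0" by (simp add: J_def)
    obtain L1 L2 where L: "real L1 \<ge> exp (real J * fst R)" "real L2 \<ge> exp (real J * snd R)"
      and ce: "code_exists \<sigma>1 U1 \<sigma>2 U2 PJ \<rho> J L1 L2 (1/4)"
      using J0[rule_format, of J] by (auto simp: J_def)
    have Lpos: "L1 > 0" "L2 > 0" using L by (smt (verit) exp_gt_zero of_nat_0_less_iff)+
    let ?\<Omega> = "block_space PJ J"
    interpret \<Omega>: prob_space ?\<Omega> by (rule prob_space_block)
    \<comment> \<open>\<open>T1\<close> and \<open>T2\<close> extract from the joint observation
      what each decoder is given.\<close>
    define T1 where "T1 = (\<lambda>\<omega> :: nat \<Rightarrow> ((complex^'r1^'n1) \<times> (complex^'r2^'n2)) \<times> (complex^'n1) \<times> (complex^'n2). \<lambda>j\<in>{..<J}. (chan (fst (fst (\<omega> j))) \<sigma>1 U1, fst (snd (\<omega> j))))"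
    define T2 where "T2 = (\<lambda>\<omega> :: nat \<Rightarrow> ((complex^'r1^'n1) \<times> (complex^'r2^'n2)) \<times> (complex^'n1) \<times> (complex^'n2). \<lambda>j\<in>{..<J}. (chan (snd (fst (\<omega> j))) \<sigma>2 U2, snd (snd (\<omega> j))))"
    obtain enc dec1 dec2 where pow: "\<And>m1 m2. m1 < L1 \<Longrightarrow> m2 < L2 \<Longrightarrow> (\<Sum>j<J. (norm (enc m1 m2 j))\<^sup>2) / real J \<le> \<rho>"
      and dec: "dec1 \<in> PiM {..<J} (\<lambda>_. borel) \<rightarrow>\<^sub>M count_space UNIV" "dec2 \<in> PiM {..<J} (\<lambda>_. borel) \<rightarrow>\<^sub>M count_space UNIV"
      and Em: "\<And>m1 m2. m1 < L1 \<Longrightarrow> m2 < L2 \<Longrightarrow> err_event \<sigma>1 U1 \<sigma>2 U2 PJ J enc dec1 dec2 m1 m2 \<in> sets ?\<Omega>"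
      and err: "(\<Sum>m1<L1. \<Sum>m2<L2. measure ?\<Omega> (err_event \<sigma>1 U1 \<sigma>2 U2 PJ J enc dec1 dec2 m1 m2)) / (real L1 * real L2) \<le> 1 / 4"
      using ce unfolding code_exists_iff by blast
    define E where "E = err_event \<sigma>1 U1 \<sigma>2 U2 PJ J enc dec1 dec2"
    note Em = Em[folded E_def] and err = err[folded E_def]
    have err': "(\<Sum>m1<L1. \<Sum>m2<L2. measure ?\<Omega> (E m1 m2)) \<le> 1 / 4 * (real L1 * real L2)"
      using err Lpos by (simp add: field_simps)
    have "\<exists>Ms. Ms \<subseteq> {..<L1} \<times> {..<L2} \<and> (\<Sum>(m1, m2)\<in>Ms. measure ?\<Omega> (E m1 m2)) \<le> 1 / 4 * real (card Ms) \<and>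
        real (card Ms) \<ge> exp (real J * rate) \<and> (p1 \<or> (\<exists>a. \<forall>m\<in>Ms. fst m = a)) \<and> (p2 \<or> (\<exists>b. \<forall>m\<in>Ms. snd m = b))"
    proof (cases "p1 \<and> p2")
      case True
      have "exp (real J * rate) = exp (real J * fst R) * exp (real J * snd R)"
        using True by (simp add: rate_def distrib_left exp_add)
      also have "\<dots> \<le> real L1 * real L2" using L by (intro mult_mono) auto
      finally show ?thesis
        using err' True by (intro exI[of _ "{..<L1} \<times> {..<L2}"]) (auto simp: sum.cartesian_product)
    next
      case False
      show ?thesis
      proof (cases p1)
        case True
        then have "\<not> p2" using False by simp
        obtain b where b: "b < L2" "(\<Sum>a<L1. measure ?\<Omega> (E a b)) \<le> 1 / 4 * real L1"
          using exists_column_le_average[OF err' Lpos(2)] by blast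
        then show ?thesis
          using True \<open>\<not> p2\<close> L by (intro exI[of _ "{..<L1} \<times> {b}"]) (auto simp: sum.cartesian_product[symmetric] rate_def card_cartesian_product)
      next
        case False
        then have "p2" using p by simp
        have "(\<Sum>m2<L2. \<Sum>m1<L1. measure ?\<Omega> (E m1 m2)) \<le> 1 / 4 * (real L2 * real L1)"
          using err' by (subst sum.swap) (simp add: ac_simps)
        then obtain a where a: "a < L1" "(\<Sum>b<L2. measure ?\<Omega> (E a b)) \<le> 1 / 4 * real L2"
          using exists_column_le_average[OF _ Lpos(1), of "\<lambda>x y. measure ?\<Omega> (E y x)" L2 "1/4"] by blast
        then show ?thesis
          using False \<open>p2\<close> L by (intro exI[of _ "{a} \<times> {..<L2}"]) (auto simp: sum.cartesian_product[symmetric] rate_def card_cartesian_product)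
      qed
    qed
    then obtain Ms where Ms: "Ms \<subseteq> {..<L1} \<times> {..<L2}" "(\<Sum>(m1, m2)\<in>Ms. measure ?\<Omega> (E m1 m2)) \<le> 1 / 4 * real (card Ms)"
        "real (card Ms) \<ge> exp (real J * rate)" "p1 \<or> (\<exists>a. \<forall>m\<in>Ms. fst m = a)" "p2 \<or> (\<exists>b. \<forall>m\<in>Ms. snd m = b)"
      by blast
    have fM: "finite Ms" using Ms(1) finite_subset by blast
    \<comment> \<open>An uncounted user imposes no condition. Its message is constant on
      \<open>Ms\<close>, so distinct elements of \<open>Ms\<close> still differ in a counted message
      and the sets stay disjoint.\<close>
    define D where "D m = {\<omega> \<in> space ?\<Omega>. (p1 \<longrightarrow> dec1 (T1 \<omega>) = fst m) \<and> (p2 \<longrightarrow> dec2 (T2 \<omega>) = snd m)}" for m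
    have [measurable]: "(\<lambda>\<omega>. dec1 (T1 \<omega>)) \<in> ?\<Omega> \<rightarrow>\<^sub>M count_space UNIV" "(\<lambda>\<omega>. dec2 (T2 \<omega>)) \<in> ?\<Omega> \<rightarrow>\<^sub>M count_space UNIV"
      unfolding T1_def T2_def block_space_def
      using measurable_compose[OF PiM_chan_measurable1 dec(1)] measurable_compose[OF PiM_chan_measurable2 dec(2)] by auto
    have "real (card Ms) \<le> 2 * exp (real J * (C + \<beta> * ln \<rho>))"
    proof (rule C[OF \<rho> J fM, where enc="\<lambda>(m1, m2). enc m1 m2" and D=D])
      fix m assume "m \<in> Ms"
      then have "(\<Sum>j<J. (norm (enc (fst m) (snd m) j))\<^sup>2) / real J \<le> \<rho>" using Ms(1) by (intro pow) auto
      then show "(\<Sum>j<J. (norm ((case m of (m1, m2) \<Rightarrow> enc m1 m2) j))\<^sup>2) \<le> real J * \<rho>"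
        using J by (simp add: field_simps case_prod_beta)
    next
      show "disjoint_family_on D Ms"
        unfolding disjoint_family_on_def D_def
      proof (intro ballI impI)
        fix m n assume "m \<in> Ms" "n \<in> Ms" "m \<noteq> n"
        then have "(p1 \<and> fst m \<noteq> fst n) \<or> (p2 \<and> snd m \<noteq> snd n)" using Ms(4,5) by (metis prod_eqI)
        then show "{\<omega> \<in> space ?\<Omega>. (p1 \<longrightarrow> dec1 (T1 \<omega>) = fst m) \<and> (p2 \<longrightarrow> dec2 (T2 \<omega>) = snd m)} \<inter>
          {\<omega> \<in> space ?\<Omega>. (p1 \<longrightarrow> dec1 (T1 \<omega>) = fst n) \<and> (p2 \<longrightarrow> dec2 (T2 \<omega>) = snd n)} = {}" by auto
      qed
      show Dm: "D m \<in> sets ?\<Omega>" for m unfolding D_def by measurable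
      let ?S = "\<lambda>m. {\<omega> \<in> space ?\<Omega>.
         (\<lambda>j\<in>{..<J}. (fst (\<omega> j), joint_out p1 p2 \<sigma>1 U1 \<sigma>2 U2 ((case m of (m1, m2) \<Rightarrow> enc m1 m2) j) (fst (\<omega> j)) + snd (\<omega> j))) \<in> D m}"
      have "1 - measure ?\<Omega> (E m1 m2) \<le> measure ?\<Omega> (?S (m1, m2))" if m: "(m1, m2) \<in> Ms" for m1 m2
      proof -
        have "1 - measure ?\<Omega> (E m1 m2) = measure ?\<Omega> (space ?\<Omega> - E m1 m2)"
          using m Ms(1) by (intro \<Omega>.prob_compl[symmetric] Em) auto
        also have "\<dots> \<le> measure ?\<Omega> (?S (m1, m2))"
        proof (rule \<Omega>.finite_measure_mono)
          have tm: "(\<lambda>\<omega>. \<lambda>j\<in>{..<J}. (fst (\<omega> j), joint_out p1 p2 \<sigma>1 U1 \<sigma>2 U2 (enc m1 m2 j) (fst (\<omega> j)) + snd (\<omega> j))) \<in> ?\<Omega> \<rightarrow>\<^sub>M ?\<Omega>"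
          proof -
            have [measurable_cong]: "sets ((cnoise :: (complex^'n1) measure) \<Otimes>\<^sub>M (cnoise :: (complex^'n2) measure)) = sets borel"
              using tame_pair by (simp add: tame_noise_def)
            note [measurable] = joint_out_measurable
            show ?thesis unfolding block_space_def by measurable
          qed
          show "?S (m1, m2) \<in> sets ?\<Omega>"
            using measurable_sets[OF tm Dm, of "(m1, m2)"] by (simp add: vimage_def Int_def conj_commute)
          show "space ?\<Omega> - E m1 m2 \<subseteq> ?S (m1, m2)"
          proof
            fix \<omega> assume w: "\<omega> \<in> space ?\<Omega> - E m1 m2"
            let ?o = "\<lambda>j\<in>{..<J}. (fst (\<omega> j), joint_out p1 p2 \<sigma>1 U1 \<sigma>2 U2 (enc m1 m2 j) (fst (\<omega> j)) + snd (\<omega> j))"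
            have "?o \<in> space ?\<Omega>" using measurable_space[OF tm] w by blast
            moreover have "dec1 (T1 ?o) = m1" if p1
            proof -
              have "T1 ?o = (\<lambda>j\<in>{..<J}. (chan (fst (fst (\<omega> j))) \<sigma>1 U1, chan (fst (fst (\<omega> j))) \<sigma>1 U1 *v enc m1 m2 j + fst (snd (\<omega> j))))"
                using that by (auto simp: T1_def joint_out_def fun_eq_iff)
              then show ?thesis using w by (simp add: E_def err_event_def)
            qed
            moreover have "dec2 (T2 ?o) = m2" if p2
            proof -
              have "T2 ?o = (\<lambda>j\<in>{..<J}. (chan (snd (fst (\<omega> j))) \<sigma>2 U2, chan (snd (fst (\<omega> j))) \<sigma>2 U2 *v enc m1 m2 j + snd (snd (\<omega> j))))"
                using that by (auto simp: T2_def joint_out_def fun_eq_iff)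
              then show ?thesis using w by (simp add: E_def err_event_def)
            qed
            ultimately show "\<omega> \<in> ?S (m1, m2)" using w by (simp add: D_def)
          qed
        qed
        finally show ?thesis .
      qed
      then have "(\<Sum>m\<in>Ms. measure ?\<Omega> (?S m)) \<ge> (\<Sum>(m1, m2)\<in>Ms. 1 - measure ?\<Omega> (E m1 m2))"
        by (intro sum_mono) (auto simp: case_prod_beta)
      moreover have "(\<Sum>(m1, m2)\<in>Ms. 1 - measure ?\<Omega> (E m1 m2)) = real (card Ms) - (\<Sum>(m1, m2)\<in>Ms. measure ?\<Omega> (E m1 m2))"
        by (simp add: case_prod_beta sum_subtractf)
      ultimately show "3 / 4 * card Ms \<le> (\<Sum>m\<in>Ms. measure ?\<Omega> (?S m))" using Ms(2) by linarith
    qed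
    then have "exp (real J * rate) \<le> exp (ln 2 + real J * (C + \<beta> * ln \<rho>))" using Ms(3) by (simp add: exp_add)
    then have "real J * rate \<le> ln 2 + real J * (C + \<beta> * ln \<rho>)" by simp
    \<comment> \<open>The factor 2 of the packing bound becomes a constant per letter because
      \<open>J\<close> is at least 1.\<close>
    also have "\<dots> \<le> real J * ln 2 + real J * (C + \<beta> * ln \<rho>)" using J by simp
    also have "\<dots> = real J * (C + ln 2 + \<beta> * ln \<rho>)" by (simp add: algebra_simps)
    finally have "rate \<le> C + ln 2 + \<beta> * ln \<rho>" using J by simp
    then show "(if p1 then fst R else 0) + (if p2 then snd R else 0) \<le> C + ln 2 + \<beta> * ln \<rho>" by (simp add: rate_def)
  qed
qed

text \<open>The rate bound describes a closed set, so it passes to the closure that defines the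
  capacity region; dividing by \<open>ln \<rho>\<close> removes the constant.\<close>

lemma dof_bound:
  assumes pb: "packing_bound PJ (cnoise \<Otimes>\<^sub>M cnoise) (joint_out p1 p2 \<sigma>1 U1 \<sigma>2 U2) \<beta>" and p: "p1 \<or> p2"
    and d: "(d1, d2) \<in> dof_region \<sigma>1 U1 \<sigma>2 U2 PJ"
  shows "(if p1 then d1 else 0) + (if p2 then d2 else 0) \<le> \<beta>"
proof -
  let ?s = "\<lambda>R :: real \<times> real. (if p1 then fst R else 0) + (if p2 then snd R else 0)"
  obtain C where C: "\<And>\<rho> R. \<rho> \<ge> 1 \<Longrightarrow> achievable_rate \<sigma>1 U1 \<sigma>2 U2 PJ \<rho> R \<Longrightarrow> ?s R \<le> C + \<beta> * ln \<rho>"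
    using rate_bound[OF pb p] by blast
  obtain R where R: "\<And>\<rho>. \<rho> > 0 \<Longrightarrow> R \<rho> \<in> capacity_region \<sigma>1 U1 \<sigma>2 U2 PJ \<rho>"
    and lim: "((\<lambda>\<rho>. fst (R \<rho>) / ln \<rho>) \<longlongrightarrow> d1) at_top" "((\<lambda>\<rho>. snd (R \<rho>) / ln \<rho>) \<longlongrightarrow> d2) at_top"
    using d unfolding dof_region_def by blast
  have bound: "?s (R \<rho>) \<le> C + \<beta> * ln \<rho>" if "\<rho> \<ge> 1" for \<rho>
  proof -
    have "closed {R. ?s R \<le> C + \<beta> * ln \<rho>}"
      by (intro closed_Collect_le) (cases p1; cases p2; auto intro!: continuous_intros)+
    moreover have "{R. achievable_rate \<sigma>1 U1 \<sigma>2 U2 PJ \<rho> R} \<subseteq> {R. ?s R \<le> C + \<beta> * ln \<rho>}" using C[OF that] by blast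
    ultimately have "capacity_region \<sigma>1 U1 \<sigma>2 U2 PJ \<rho> \<subseteq> {R. ?s R \<le> C + \<beta> * ln \<rho>}"
      unfolding capacity_region_def by (rule closure_minimal[rotated])
    then show ?thesis using R[of \<rho>] that by auto
  qed
  have l1: "((\<lambda>\<rho>. ?s (R \<rho>) / ln \<rho>) \<longlongrightarrow> (if p1 then d1 else 0) + (if p2 then d2 else 0)) at_top"
  proof -
    have "((\<lambda>\<rho>. (if p1 then fst (R \<rho>) / ln \<rho> else 0) + (if p2 then snd (R \<rho>) / ln \<rho> else 0)) \<longlongrightarrow> (if p1 then d1 else 0) + (if p2 then d2 else 0)) at_top"
      by (intro tendsto_add) (auto simp: lim)
    then show ?thesis by (rule Lim_transform_eventually) (auto simp: add_divide_distrib)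
  qed
  have "((\<lambda>\<rho>. C / ln \<rho>) \<longlongrightarrow> 0) at_top"
    by (rule real_tendsto_divide_at_top[OF tendsto_const ln_at_top])
  from tendsto_add[OF this tendsto_const[of \<beta>]] have l2: "((\<lambda>\<rho>. C / ln \<rho> + \<beta>) \<longlongrightarrow> \<beta>) at_top" by simp
  have "\<forall>\<^sub>F \<rho> in at_top. ?s (R \<rho>) / ln \<rho> \<le> C / ln \<rho> + \<beta>"
    using eventually_gt_at_top[of "1::real"]
  proof eventually_elim
    case (elim \<rho>)
    then have "ln \<rho> > 0" by simp
    then have "?s (R \<rho>) / ln \<rho> \<le> (C + \<beta> * ln \<rho>) / ln \<rho>" using bound[of \<rho>] elim by (intro divide_right_mono) auto
    then show ?case using \<open>ln \<rho> > 0\<close> by (simp add: add_divide_distrib)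
  qed
  then show ?thesis by (rule tendsto_le[OF trivial_limit_at_top_linorder l2 l1])
qed

lemma dof_nonneg:
  assumes d: "(d1, d2) \<in> dof_region \<sigma>1 U1 \<sigma>2 U2 PJ"
  shows "d1 \<ge> 0" "d2 \<ge> 0"
proof -
  obtain R where R: "\<And>\<rho>. \<rho> > 0 \<Longrightarrow> R \<rho> \<in> capacity_region \<sigma>1 U1 \<sigma>2 U2 PJ \<rho>"
    and lim: "((\<lambda>\<rho>. fst (R \<rho>) / ln \<rho>) \<longlongrightarrow> d1) at_top" "((\<lambda>\<rho>. snd (R \<rho>) / ln \<rho>) \<longlongrightarrow> d2) at_top"
    using d unfolding dof_region_def by blast
  have pos: "fst (R \<rho>) \<ge> 0 \<and> snd (R \<rho>) \<ge> 0" if "\<rho> > 0" for \<rho>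
  proof -
    have "closed {R :: real \<times> real. fst R \<ge> 0 \<and> snd R \<ge> 0}"
      by (intro closed_Collect_conj closed_Collect_le continuous_intros)
    moreover have "{R. achievable_rate \<sigma>1 U1 \<sigma>2 U2 PJ \<rho> R} \<subseteq> {R. fst R \<ge> 0 \<and> snd R \<ge> 0}" by (auto simp: achievable_rate_def)
    ultimately have "capacity_region \<sigma>1 U1 \<sigma>2 U2 PJ \<rho> \<subseteq> {R. fst R \<ge> 0 \<and> snd R \<ge> 0}"
      unfolding capacity_region_def by (rule closure_minimal[rotated])
    then show ?thesis using R[of \<rho>] that by auto
  qed
  have ev: "\<forall>\<^sub>F \<rho> in at_top. fst (R \<rho>) / ln \<rho> \<ge> 0 \<and> snd (R \<rho>) / ln \<rho> \<ge> 0"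
    using eventually_gt_at_top[of "1::real"] by eventually_elim (auto intro!: divide_nonneg_nonneg simp: pos)
  show "d1 \<ge> 0" by (rule tendsto_lowerbound[OF lim(1)]) (use ev in \<open>auto elim: eventually_mono\<close>)
  show "d2 \<ge> 0" by (rule tendsto_lowerbound[OF lim(2)]) (use ev in \<open>auto elim: eventually_mono\<close>)
qed

text \<open>The adapted basis gives \<open>r1 + r2 - r0\<close> when both users are counted, and its
  two halves give \<open>r1\<close> and \<open>r2\<close>; the antenna bounds give \<open>N1\<close>
  and \<open>N2\<close>, and their sum is the bound \<open>N1 + N2\<close>.\<close>

lemma dof_converse:
  assumes d: "(d1, d2) \<in> dof_region \<sigma>1 U1 \<sigma>2 U2 PJ"
  defines "r0 \<equiv> vec.dim (vec.span (columns U1) \<inter> vec.span (columns U2))"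
  shows "d1 \<le> real (min CARD('n1) CARD('r1))" "d2 \<le> real (min CARD('n2) CARD('r2))"
    "d1 + d2 \<le> min (real CARD('r1) + real CARD('r2) - real r0) (real CARD('n1) + real CARD('n2))"
proof -
  have UU: "cadj U1 ** U1 = mat 1" "cadj U2 ** U2 = mat 1" using stats1 stats2 by (auto simp: valid_stats_def)
  obtain B A1 A2 where A: "B \<inter> A1 = {}" "B \<inter> A2 = {}" "A1 \<inter> A2 = {}"
    "vec.independent (B \<union> A1 \<union> A2)" "vec.span (B \<union> A1) = vec.span (columns U1)" "vec.span (B \<union> A2) = vec.span (columns U2)"
    "card B = r0" "card (B \<union> A1) = CARD('r1)" "card (B \<union> A2) = CARD('r2)"
    using adapted_basis[of "vec.span (columns U1)" "vec.span (columns U2)"]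
    unfolding dim_span_columns[OF UU(1)] dim_span_columns[OF UU(2)] r0_def by (metis vec.subspace_span)
  have fin: "finite (B \<union> A1 \<union> A2)" using A(4) vec.finiteI_independent by blast
  have "card (B \<union> A1 \<union> A2) + card B = card (B \<union> A1) + card (B \<union> A2)"
    using fin A(1-3) by (simp add: card_Un_disjoint Int_Un_distrib2)
  then have card: "real (card (B \<union> A1 \<union> A2)) = real CARD('r1) + real CARD('r2) - real r0" using A by simp
  have s: "d1 + d2 \<le> real CARD('r1) + real CARD('r2) - real r0"
    using dof_bound[OF packing_bound_streams[of _ True "B \<union> A1" True "B \<union> A2"], of "B \<union> A1 \<union> A2" d1 d2] A d card by auto
  have i1: "vec.independent (B \<union> A1)" "vec.independent (B \<union> A2)" by (rule vec.independent_mono[OF A(4)], blast)+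
  have 1: "d1 \<le> real CARD('r1)"
    using dof_bound[OF packing_bound_streams[of _ True "B \<union> A1" False "{}"], of "B \<union> A1" d1 d2] A d i1 by auto
  have 2: "d2 \<le> real CARD('r2)"
    using dof_bound[OF packing_bound_streams[of _ False "{}" True "B \<union> A2"], of "B \<union> A2" d1 d2] A d i1 by auto
  have 3: "d1 \<le> real CARD('n1)" using dof_bound[OF packing_bound_antennas1 _ d] by simp
  have 4: "d2 \<le> real CARD('n2)" using dof_bound[OF packing_bound_antennas2 _ d] by simp
  show "d1 \<le> real (min CARD('n1) CARD('r1))" "d2 \<le> real (min CARD('n2) CARD('r2))"
    "d1 + d2 \<le> min (real CARD('r1) + real CARD('r2) - real r0) (real CARD('n1) + real CARD('n2))"
    using s 1 2 3 4 by auto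
qed

end

section \<open>Codes and near-singular channels\<close>

text \<open>A word near \<open>w\<close> is determined by the set of positions where it differs and
  by its values there: at most \<open>2 ^ J\<close> sets, each with fewer than
  \<open>2 * J / n\<close> free symbols.\<close>

lemma card_hamming_ball_le:
  fixes q J n :: nat and w :: "nat \<Rightarrow> nat"
  assumes q: "q > 0" and n: "n > 0"
  shows "real (card {u \<in> PiE {..<J} (\<lambda>_. {..<q}). n * card {j\<in>{..<J}. u j \<noteq> w j} < 2 * J}) \<le> 2 ^ J * q powr (2 * real J / real n)"
proof -
  let ?Sets = "{S \<in> Pow {..<J}. n * card S < 2 * J}"
  let ?B = "{u \<in> PiE {..<J} (\<lambda>_. {..<q}). n * card {j\<in>{..<J}. u j \<noteq> w j} < 2 * J}"
  let ?X = "SIGMA S:?Sets. PiE S (\<lambda>_. {..<q})"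
  let ?f = "\<lambda>u. ({j\<in>{..<J}. u j \<noteq> w j}, restrict u {j\<in>{..<J}. u j \<noteq> w j})"
  have inj: "inj_on ?f ?B"
  proof (rule inj_onI)
    fix u v assume u: "u \<in> ?B" and v: "v \<in> ?B" and eq: "?f u = ?f v"
    have S: "{j\<in>{..<J}. u j \<noteq> w j} = {j\<in>{..<J}. v j \<noteq> w j}"
      using eq unfolding prod.inject by (rule conjunct1)
    have R: "restrict u {j\<in>{..<J}. u j \<noteq> w j} = restrict v {j\<in>{..<J}. v j \<noteq> w j}"
      using eq unfolding prod.inject by (rule conjunct2)
    show "u = v"
    proof (rule PiE_ext)
      show "u \<in> PiE {..<J} (\<lambda>_. {..<q})" "v \<in> PiE {..<J} (\<lambda>_. {..<q})" using u v by auto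
      fix j assume j: "j \<in> {..<J}"
      show "u j = v j"
      proof (cases "u j = w j")
        case True
        then have "j \<notin> {j\<in>{..<J}. v j \<noteq> w j}" using S by blast
        then show ?thesis using True j by auto
      next
        case False
        then have "j \<in> {j\<in>{..<J}. u j \<noteq> w j}" "j \<in> {j\<in>{..<J}. v j \<noteq> w j}" using j S by blast+
        then show ?thesis using fun_cong[OF R, of j] by (simp add: restrict_apply)
      qed
    qed
  qed
  have fin: "finite ?X" by (intro finite_SigmaI finite_PiE) (auto intro: finite_subset)
  have "?f ` ?B \<subseteq> ?X" by (auto simp: PiE_iff split: if_splits)
  then have "card ?B \<le> card ?X" using fin by (rule card_inj_on_le[OF inj])
  also have "card ?X = (\<Sum>S\<in>?Sets. q ^ card S)"
  proof (subst card_SigmaI)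
    have fS: "finite S" if "S \<in> ?Sets" for S using that finite_subset[of S "{..<J}"] by simp
    show "\<forall>S\<in>?Sets. finite (PiE S (\<lambda>_. {..<q}))" using fS by (auto intro!: finite_PiE)
    show "(\<Sum>S\<in>?Sets. card (PiE S (\<lambda>_. {..<q}))) = (\<Sum>S\<in>?Sets. q ^ card S)"
      using fS by (intro sum.cong) (simp_all add: card_PiE)
  qed simp
  finally have "real (card ?B) \<le> (\<Sum>S\<in>?Sets. real q ^ card S)" by (simp add: of_nat_le_iff[symmetric, where 'a=real] del: of_nat_le_iff)
  also have "\<dots> \<le> (\<Sum>S\<in>?Sets. q powr (2 * real J / real n))"
  proof (rule sum_mono)
    fix S assume "S \<in> ?Sets"
    then have "real (n * card S) \<le> real (2 * J)" unfolding of_nat_le_iff by simp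
    then have "real (card S) \<le> 2 * real J / real n" using n by (simp add: field_simps)
    then show "real q ^ card S \<le> q powr (2 * real J / real n)"
      using q by (subst powr_realpow[symmetric]) (auto intro!: powr_mono)
  qed
  also have "\<dots> = card ?Sets * q powr (2 * real J / real n)" by simp
  also have "\<dots> \<le> 2 ^ J * q powr (2 * real J / real n)"
  proof (rule mult_right_mono)
    have "card ?Sets \<le> card (Pow {..<J})" by (rule card_mono) auto
    then have "real (card ?Sets) \<le> real (card (Pow {..<J}))" by (rule of_nat_mono)
    then show "real (card ?Sets) \<le> 2 ^ J" by (simp only: card_Pow finite_lessThan card_lessThan of_nat_power of_nat_numeral)
  qed simp
  finally show ?thesis .
qed

text \<open>Greedy choice: as long as the balls around the chosen words do not exhaust all words, a
  further word far from all of them exists.\<close>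

lemma gilbert_varshamov:
  fixes q J n B :: nat
  assumes q: "q > 0" and n: "n > 0" and B: "real B * (2 ^ J * q powr (2 * real J / real n)) \<le> real q ^ J"
  shows "\<exists>c :: nat \<Rightarrow> nat \<Rightarrow> nat. (\<forall>i<B. \<forall>j<J. c i j < q) \<and>
    (\<forall>i<B. \<forall>i'<B. i \<noteq> i' \<longrightarrow> 2 * J \<le> n * card {j\<in>{..<J}. c i j \<noteq> c i' j})"
proof -
  let ?W = "PiE {..<J} (\<lambda>_. {..<q})"
  let ?V = "2 ^ J * q powr (2 * real J / real n)"
  let ?ball = "\<lambda>w. {u \<in> ?W. n * card {j\<in>{..<J}. u j \<noteq> w j} < 2 * J}"
  have finW: "finite ?W" by (intro finite_PiE) auto
  have "b \<le> B \<Longrightarrow> \<exists>c. (\<forall>i<b. c i \<in> ?W) \<and> (\<forall>i<b. \<forall>i'<b. i \<noteq> i' \<longrightarrow> 2 * J \<le> n * card {j\<in>{..<J}. c i j \<noteq> c i' j})" for b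
  proof (induction b)
    case 0
    show ?case by simp
  next
    case (Suc b)
    then obtain c where c: "\<And>i. i < b \<Longrightarrow> c i \<in> ?W"
      "\<And>i i'. i < b \<Longrightarrow> i' < b \<Longrightarrow> i \<noteq> i' \<Longrightarrow> 2 * J \<le> n * card {j\<in>{..<J}. c i j \<noteq> c i' j}"
      by (meson Suc_leD)
    have "real (card (\<Union>i<b. ?ball (c i))) \<le> (\<Sum>i<b. real (card (?ball (c i))))"
      using card_UN_le[of "{..<b}" "\<lambda>i. ?ball (c i)"] by (simp add: of_nat_le_iff[symmetric, where 'a=real] del: of_nat_le_iff)
    also have "\<dots> \<le> (\<Sum>i<b. ?V)" by (intro sum_mono card_hamming_ball_le q n)
    \<comment> \<open>Fewer than \<open>B\<close> words have been chosen so far, so the inequality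
      is strict and some word is left uncovered.\<close>
    also have "\<dots> < real B * ?V" using Suc.prems q by (auto intro!: mult_strict_right_mono)
    also have "\<dots> \<le> real (card ?W)" using B by (simp add: card_PiE)
    finally have "card (\<Union>i<b. ?ball (c i)) < card ?W" by simp
    moreover have "finite (\<Union>i<b. ?ball (c i))" by (rule finite_subset[OF _ finW]) blast
    ultimately have "\<not> ?W \<subseteq> (\<Union>i<b. ?ball (c i))" using card_mono by (meson leD)
    then obtain w where w: "w \<in> ?W" "\<And>i. i < b \<Longrightarrow> w \<notin> ?ball (c i)" by blast
    have sym: "{j\<in>{..<J}. c i j \<noteq> w j} = {j\<in>{..<J}. w j \<noteq> c i j}" for i by auto
    have far: "2 * J \<le> n * card {j\<in>{..<J}. w j \<noteq> c i j}" if "i < b" for i using w(1) w(2)[OF that] by (simp add: not_less)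
    show ?case
    proof (intro exI[of _ "c(b := w)"] conjI allI impI)
      show "(c(b := w)) i \<in> ?W" if "i < Suc b" for i
        using that c(1) w(1) by (cases "i = b") auto
      fix i i' assume "i < Suc b" "i' < Suc b" "i \<noteq> i'"
      then consider "i = b" "i' < b" | "i' = b" "i < b" | "i < b" "i' < b" by linarith
      then show "2 * J \<le> n * card {j\<in>{..<J}. (c(b := w)) i j \<noteq> (c(b := w)) i' j}"
      proof cases
        case 1 then show ?thesis using far[of i'] by simp
      next
        case 2 then show ?thesis using far[of i] unfolding sym[symmetric] by simp
      next
        case 3 then show ?thesis using c(2)[of i i'] \<open>i \<noteq> i'\<close> by simp
      qed
    qed
  qed
  from this[of B] obtain c where c: "\<forall>i<B. c i \<in> ?W" "\<forall>i<B. \<forall>i'<B. i \<noteq> i' \<longrightarrow> 2 * J \<le> n * card {j\<in>{..<J}. c i j \<noteq> c i' j}" by auto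
  then show ?thesis by (intro exI[of _ c]) (auto simp: PiE_iff)
qed

text \<open>A Chernoff bound: on the event the product of the factors \<open>?h\<close> is at least
  \<open>4 ^ J\<close>, while each factor has mean at most 2, so the probability is at most
  \<open>2 ^ J / 4 ^ J\<close>.\<close>

lemma many_bad_letters_unlikely:
  fixes P :: "'a measure"
  assumes P: "prob_space P" and bad [measurable]: "bad \<in> sets P" and le: "measure P bad \<le> 1 / 4 ^ n"
  shows "{\<omega> \<in> space (PiM {..<J} (\<lambda>_. P)). J \<le> n * card {j\<in>{..<J}. \<omega> j \<in> bad}} \<in> sets (PiM {..<J} (\<lambda>_. P))" (is "?S \<in> _")
    and "measure (PiM {..<J} (\<lambda>_. P)) {\<omega> \<in> space (PiM {..<J} (\<lambda>_. P)). J \<le> n * card {j\<in>{..<J}. \<omega> j \<in> bad}} \<le> (1 / 2) ^ J"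
proof -
  interpret P: prob_space P by (rule P)
  interpret PP: product_prob_space "\<lambda>_::nat. P" "{..<J}" ..
  let ?\<Omega> = "PiM {..<J} (\<lambda>_. P)"
  have S_eq: "?S = {\<omega> \<in> space ?\<Omega>. real J \<le> real n * (\<Sum>j<J. indicator bad (\<omega> j))}"
  proof -
    have "real (card {j\<in>{..<J}. \<omega> j \<in> bad}) = (\<Sum>j<J. indicator bad (\<omega> j))" for \<omega>
      by (simp add: indicator_def sum.inter_filter[symmetric] Int_def)
    then show ?thesis by (simp add: of_nat_mult[symmetric] of_nat_le_iff[symmetric, where 'a=real] del: of_nat_le_iff)
  qed
  show Sm [measurable]: "?S \<in> sets ?\<Omega>" unfolding S_eq by measurable
  \<comment> \<open>The height \<open>4 ^ n\<close> is the inverse of the assumed bound on the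
    probability of \<open>bad\<close>; \<open>J / n\<close> bad letters then already produce
    \<open>4 ^ J\<close>.\<close>
  let ?h = "\<lambda>z. 1 + ennreal (4 ^ n) * indicator bad z"
  have pt: "indicator ?S \<omega> \<le> ennreal ((1 / 4) ^ J) * (\<Prod>j<J. ?h (\<omega> j))" for \<omega>
  proof (cases "\<omega> \<in> ?S")
    case True
    let ?A = "{j\<in>{..<J}. \<omega> j \<in> bad}"
    have "ennreal (4 ^ J) \<le> ennreal ((4 ^ n) ^ card ?A)"
      using True by (intro ennreal_leI) (auto simp: power_mult[symmetric] intro!: power_increasing)
    also have "\<dots> = (\<Prod>j\<in>?A. ennreal (4 ^ n))" by (simp add: ennreal_power)
    also have "\<dots> \<le> (\<Prod>j\<in>?A. ?h (\<omega> j))" by (intro prod_mono_ennreal) auto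
    also have "\<dots> \<le> (\<Prod>j<J. ?h (\<omega> j))"
    proof -
      have "(\<Prod>j<J. ?h (\<omega> j)) = (\<Prod>j\<in>?A. ?h (\<omega> j))"
        by (rule prod.mono_neutral_right) auto
      then show ?thesis by simp
    qed
    finally have "ennreal ((1 / 4) ^ J) * ennreal (4 ^ J) \<le> ennreal ((1 / 4) ^ J) * (\<Prod>j<J. ?h (\<omega> j))" by (rule mult_left_mono) simp
    moreover have "ennreal ((1 / 4) ^ J) * ennreal (4 ^ J) = 1"
      by (simp add: ennreal_mult[symmetric] power_mult_distrib[symmetric])
    ultimately show ?thesis using True by simp
  qed simp
  have "ennreal (measure ?\<Omega> ?S) = (\<integral>\<^sup>+\<omega>. indicator ?S \<omega> \<partial>?\<Omega>)" by (simp add: PP.emeasure_eq_measure)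
  also have "\<dots> \<le> (\<integral>\<^sup>+\<omega>. ennreal ((1 / 4) ^ J) * (\<Prod>j<J. ?h (\<omega> j)) \<partial>?\<Omega>)" by (intro nn_integral_mono pt)
  also have "\<dots> = ennreal ((1 / 4) ^ J) * (\<integral>\<^sup>+\<omega>. (\<Prod>j<J. ?h (\<omega> j)) \<partial>?\<Omega>)" by (rule nn_integral_cmult) measurable
  also have "(\<integral>\<^sup>+\<omega>. (\<Prod>j<J. ?h (\<omega> j)) \<partial>?\<Omega>) = (\<Prod>j<J. \<integral>\<^sup>+z. ?h z \<partial>P)"
    by (rule PP.product_nn_integral_prod) auto
  also have "(\<integral>\<^sup>+z. ?h z \<partial>P) \<le> 2"
  proof -
    have "(\<integral>\<^sup>+z. ?h z \<partial>P) = 1 + ennreal (4 ^ n) * ennreal (measure P bad)"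
      by (simp add: nn_integral_add nn_integral_cmult P.emeasure_eq_measure P.prob_space)
    also have "\<dots> \<le> 1 + ennreal (4 ^ n * (1 / 4 ^ n))"
      using le by (subst ennreal_mult[symmetric]) (auto intro!: add_left_mono ennreal_leI mult_left_mono simp del: times_divide_eq_right)
    finally show ?thesis by simp
  qed
  then have "(\<Prod>j<J. \<integral>\<^sup>+z. ?h z \<partial>P) \<le> (\<Prod>j<J. 2)" by (intro prod_mono_ennreal)
  then have "ennreal ((1 / 4) ^ J) * (\<Prod>j<J. \<integral>\<^sup>+z. ?h z \<partial>P) \<le> ennreal ((1 / 4) ^ J) * (\<Prod>j<J. 2)" by (rule mult_left_mono) simp
  also have "\<dots> = ennreal ((1 / 4) ^ J * 2 ^ J)"
    by (simp add: ennreal_mult ennreal_power[symmetric])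
  also have "(1 / 4) ^ J * 2 ^ J = (1 / 2 :: real) ^ J" by (simp add: power_mult_distrib[symmetric])
  finally show "measure ?\<Omega> ?S \<le> (1 / 2) ^ J" by (simp add: ennreal_le_iff)
qed

section \<open>Fading that is nearly singular on a subspace\<close>

text \<open>Applying \<open>A\<close> to the relation and subtracting its multiple by
  \<open>k\<close> cancels the term of \<open>k\<close> and multiplies the others by
  \<open>l - k\<close>, which is nonzero.\<close>

lemma eigenvectors_independent:
  fixes A :: "complex^'r::finite^'r"
  assumes "finite F" "\<And>l. l \<in> F \<Longrightarrow> A *v x l = l *s x l \<and> x l \<noteq> 0" "(\<Sum>l\<in>F. c l *s x l) = 0" "l \<in> F"
  shows "c l = 0"
  using assms
proof (induction F arbitrary: c l rule: finite_induct)
  case (insert k F)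
  have "(\<Sum>l\<in>insert k F. c l *s x l) = c k *s x k + (\<Sum>l\<in>F. c l *s x l)" using insert.hyps by simp
  then have z: "(\<Sum>l\<in>F. c l *s x l) = - (c k *s x k)" using insert.prems(2) by (simp add: eq_neg_iff_add_eq_0 add.commute)
  have "A *v (\<Sum>l\<in>F. c l *s x l) = (\<Sum>l\<in>F. (l * c l) *s x l)"
    unfolding matrix_vector_mult_sum_smult using insert.prems(1) by (intro sum.cong) (auto simp: mult.commute)
  moreover have "A *v (- (c k *s x k)) = k *s (- (c k *s x k))"
    using insert.prems(1)[of k] by (simp add: vec.scale vec.neg mult.commute vec.scale_minus_right)
  ultimately have "(\<Sum>l\<in>F. (l * c l) *s x l) = k *s (\<Sum>l\<in>F. c l *s x l)" using z by simp
  then have "(\<Sum>l\<in>F. ((l - k) * c l) *s x l) = 0"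
    by (simp add: left_diff_distrib vec.scale_left_diff_distrib sum_subtractf vec.scale_sum_right)
  then have "(l - k) * c l = 0" if "l \<in> F" for l using insert.IH[of "\<lambda>l. (l - k) * c l"] insert.prems(1) that by blast
  then have cF: "c l = 0" if "l \<in> F" for l using that insert.hyps by (metis eq_iff_diff_eq_0 mult_eq_0_iff)
  then have "c k *s x k = 0" using z by simp
  then have "c k = 0" using insert.prems(1)[of k] by simp
  then show ?case using cF insert.prems(3) by auto
qed simp

lemma finite_eigenvalues:
  fixes A :: "complex^'r::finite^'r"
  shows "finite {l. \<exists>u. u \<noteq> 0 \<and> A *v u = l *s u}"
proof (rule ccontr)
  assume "infinite {l. \<exists>u. u \<noteq> 0 \<and> A *v u = l *s u}"
  from infinite_arbitrarily_large[OF this, of "Suc CARD('r)"]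
  obtain F where F: "F \<subseteq> {l. \<exists>u. u \<noteq> 0 \<and> A *v u = l *s u}" "finite F" "card F = Suc CARD('r)" by blast
  have "\<forall>l\<in>F. \<exists>u. A *v u = l *s u \<and> u \<noteq> 0" using F(1) by blast
  then obtain x where x: "\<And>l. l \<in> F \<Longrightarrow> A *v x l = l *s x l \<and> x l \<noteq> 0" unfolding bchoice_iff by blast
  have inj: "inj_on x F"
  proof (rule inj_onI)
    fix k l assume "k \<in> F" "l \<in> F" "x k = x l"
    then have "k *s x k = l *s x k" using x by metis
    then show "k = l" using x \<open>k \<in> F\<close> by simp
  qed
  have "vec.independent (x ` F)"
  proof -
    have "\<forall>v\<in>x ` F. c v = 0" if "(\<Sum>v\<in>x ` F. c v *s v) = 0" for c
    proof -
      have "(\<Sum>l\<in>F. c (x l) *s x l) = 0" using that inj by (simp add: sum.reindex)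
      then show ?thesis using eigenvectors_independent[OF F(2) x, of "\<lambda>l. c (x l)"] by blast
    qed
    then show ?thesis using F(2) by (simp add: vec.independent_explicit)
  qed
  then have "card (x ` F) \<le> vec.dim (UNIV :: (complex^'r) set)"
    by (intro vec.independent_card_le_dim) auto
  then show False using F inj by (simp add: card_image vec_dim_card card_cart_basis)
qed

text \<open>A basis of \<open>V\<close> is mapped injectively into the standard basis of the output
  space, which is where the bound on the dimension enters. The matrix \<open>G0\<close> is the
  direction of the lines in \<open>singular_null\<close>.\<close>

lemma exists_matrix_left_inverse_on:
  fixes V :: "(complex^'r::finite) set"
  assumes "vec.dim V \<le> CARD('n::finite)" "vec.subspace V"
  obtains G0 :: "complex^'r^'n" and L :: "complex^'n^'r" where "\<And>u. u \<in> V \<Longrightarrow> L *v (G0 *v u) = u"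
proof -
  obtain B where B: "B \<subseteq> V" "vec.independent B" "V \<subseteq> vec.span B" "card B = vec.dim V"
    using vec.basis_exists by metis
  have fB: "finite B" using B vec.finiteI_independent by blast
  have "card B \<le> card (cart_basis :: (complex^'n) set)" using B assms by (simp add: card_cart_basis)
  then obtain \<phi> where \<phi>: "inj_on \<phi> B" "\<phi> ` B \<subseteq> (cart_basis :: (complex^'n) set)"
    using card_le_inj[OF fB finite_cart_basis] by blast
  have ind: "vec.independent (\<phi> ` B)" by (rule vec.independent_mono[OF independent_cart_basis \<phi>(2)])
  obtain g :: "complex^'r \<Rightarrow> complex^'n" where g: "Vector_Spaces.linear (*s) (*s) g" "\<forall>x\<in>B. g x = \<phi> x"
    using vec.linear_independent_extend[OF B(2)] by blast
  obtain h :: "complex^'n \<Rightarrow> complex^'r" where h: "Vector_Spaces.linear (*s) (*s) h" "\<forall>x\<in>\<phi> ` B. h x = the_inv_into B \<phi> x"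
    using vec.linear_independent_extend[OF ind] by blast
  have gh: "matrix h *v (matrix g *v u) = u" if "u \<in> vec.span B" for u
    using that
  proof (induction rule: vec.span_induct_alt)
    case (step c x y)
    have "matrix h *v (matrix g *v x) = x"
      using step g(2) h(2) by (simp add: matrix_works[OF g(1)] matrix_works[OF h(1)] the_inv_into_f_f[OF \<phi>(1)])
    then show ?case using step by (simp add: matrix_vector_right_distrib vec.scale)
  qed simp
  show ?thesis by (rule that[of "matrix h" "matrix g"]) (use gh B in blast)
qed

text \<open>The strict inequality makes this a union of open sets, so it is measurable although it
  quantifies over uncountably many \<open>u\<close>. Outside it \<open>G\<close> shrinks vectors of
  a subspace \<open>V\<close> at most by the factor \<open>\<kappa>\<close>.\<close>

definition near_singular :: "(complex^'r::finite) set \<Rightarrow> real \<Rightarrow> (complex^'r^'n::finite) set" where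
  "near_singular V \<kappa> = {G. \<exists>u\<in>V. norm u = 1 \<and> norm (G *v u) < \<kappa>}"

lemma open_near_singular: "open (near_singular V \<kappa> :: (complex^'r::finite^'n::finite) set)"
proof -
  have "(near_singular V \<kappa> :: (complex^'r^'n) set) = (\<Union>u\<in>{u\<in>V. norm u = 1}. {G. norm (G *v u) < \<kappa>})" by (auto simp: near_singular_def)
  moreover have "open {G :: complex^'r^'n. norm (G *v u) < \<kappa>}" for u
    unfolding matrix_vector_mult_def by (intro open_Collect_less continuous_intros)
  ultimately show ?thesis by auto
qed

lemma Inter_near_singular_measurable:
  "(\<Inter>i. near_singular V (1 / real (Suc i)) :: (complex^'r::finite^'n::finite) set) \<in> sets borel"
  by (intro sets.countable_INT) (auto intro: borel_open open_near_singular)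

lemma closed_vec_subspace:
  fixes V :: "(complex^'r::finite) set"
  assumes "vec.subspace V"
  shows "closed V"
proof (rule closed_subspace)
  show "subspace V"
    using assms unfolding vec.subspace_def subspace_def by (auto simp: scaleR_vec_complex)
qed

lemma not_near_singularD:
  assumes "G \<notin> near_singular V \<kappa>" "vec.subspace V" "u \<in> V"
  shows "\<kappa> * norm u \<le> norm (G *v u)"
proof (cases "u = 0")
  case False
  let ?u = "complex_of_real (1 / norm u) *s u"
  have "?u \<in> V" using assms by (simp add: vec.subspace_scale)
  moreover have "norm ?u = 1" using False unfolding scaleR_vec_complex[symmetric] by simp
  ultimately have "\<kappa> \<le> norm (G *v ?u)" using assms(1) by (auto simp: near_singular_def)
  also have "G *v ?u = (1 / norm u) *\<^sub>R (G *v u)" by (simp add: vec.scale scaleR_vec_complex)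
  finally show ?thesis using False by (simp add: field_simps)
qed simp

text \<open>The unit sphere of \<open>V\<close> is compact, so the least value of
  \<open>norm (G *v u)\<close> on it is attained; being below every \<open>1 / Suc i\<close>, it is
  zero.\<close>

lemma Inter_near_singular:
  assumes "vec.subspace V" "G \<in> (\<Inter>i. near_singular V (1 / real (Suc i)))"
  shows "\<exists>u\<in>V. u \<noteq> 0 \<and> G *v u = 0"
proof -
  let ?K = "{u\<in>V. norm u = 1}"
  have "?K = V \<inter> sphere 0 1" by (auto simp: sphere_def)
  then have "compact ?K" using closed_vec_subspace[OF assms(1)] by (simp add: compact_Int_closed closed_Int_compact)
  moreover have "?K \<noteq> {}" using assms(2) by (auto simp: near_singular_def)
  moreover have "continuous_on ?K (\<lambda>u. norm (G *v u))" unfolding matrix_vector_mult_def by (intro continuous_intros)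
  ultimately obtain u where u: "u \<in> ?K" "\<And>y. y \<in> ?K \<Longrightarrow> norm (G *v u) \<le> norm (G *v y)"
    using continuous_attains_inf[of ?K "\<lambda>u. norm (G *v u)"] by blast
  have "norm (G *v u) \<le> 0"
  proof (rule ccontr)
    assume "\<not> ?thesis"
    then obtain i where "inverse (real (Suc i)) < norm (G *v u)" using reals_Archimedean[of "norm (G *v u)"] by auto
    moreover have "G \<in> near_singular V (1 / real (Suc i))" using assms(2) by blast
    ultimately show False using u(2) by (force simp: near_singular_def inverse_eq_divide)
  qed
  then show ?thesis using u(1) by (intro bexI[of _ u]) auto
qed

text \<open>Along every line in a direction \<open>G0\<close> that is left-invertible on \<open>V\<close>, singular matrices correspond to
  eigenvalues of \<open>L ** G\<close>, so there are only finitely many; Fubini then gives a null set.\<close>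
lemma singular_null:
  fixes V :: "(complex^'r::finite) set"
  assumes V: "vec.subspace V" "vec.dim V \<le> CARD('n::finite)"
  shows "emeasure lborel (\<Inter>i. near_singular V (1 / real (Suc i)) :: (complex^'r^'n) set) = 0"
proof -
  define Z where "Z = (\<Inter>i. near_singular V (1 / real (Suc i)) :: (complex^'r^'n) set)"
  have Zm [measurable]: "Z \<in> sets borel" unfolding Z_def by (rule Inter_near_singular_measurable)
  obtain G0 :: "complex^'r^'n" and L :: "complex^'n^'r" where L: "\<And>u. u \<in> V \<Longrightarrow> L *v (G0 *v u) = u"
    using exists_matrix_left_inverse_on[OF V(2,1)] by blast
  have fin: "finite {t::real. G + t *\<^sub>R G0 \<in> Z}" for G
  proof -
    have "{t::real. G + t *\<^sub>R G0 \<in> Z} \<subseteq> (\<lambda>t. complex_of_real (- t)) -` {l. \<exists>u. u \<noteq> 0 \<and> (L ** G) *v u = l *s u}"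
    proof
      fix t :: real assume "t \<in> {t. G + t *\<^sub>R G0 \<in> Z}"
      then obtain u where u: "u \<in> V" "u \<noteq> 0" "(G + t *\<^sub>R G0) *v u = 0"
        using Inter_near_singular[OF V(1)] unfolding Z_def by blast
      have "(t *\<^sub>R G0) *v u = t *\<^sub>R (G0 *v u)"
        by (simp add: vec_eq_iff matrix_vector_mult_def scaleR_sum_right)
      then have "G *v u = complex_of_real (- t) *s (G0 *v u)"
        using u(3) by (simp add: matrix_vector_mult_add_rdistrib scaleR_vec_complex eq_neg_iff_add_eq_0)
      then have "L *v (G *v u) = complex_of_real (- t) *s u"
        using L[OF u(1)] by (simp only: vec.scale)
      then show "t \<in> (\<lambda>t. complex_of_real (- t)) -` {l. \<exists>u. u \<noteq> 0 \<and> (L ** G) *v u = l *s u}"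
        using u(2) by (auto simp: matrix_vector_mul_assoc)
    qed
    moreover have "finite ((\<lambda>t. complex_of_real (- t)) -` {l. \<exists>u. u \<noteq> 0 \<and> (L ** G) *v u = l *s u})"
      by (intro finite_vimageI finite_eigenvalues) (auto simp: inj_def)
    ultimately show ?thesis by (rule finite_subset)
  qed
  have shift: "(\<lambda>p :: real \<times> (complex^'r^'n). snd p + fst p *\<^sub>R G0) \<in> borel_measurable (borel \<Otimes>\<^sub>M borel)" by measurable
  have m: "(\<lambda>p :: real \<times> (complex^'r^'n). indicator {0..1} (fst p) * indicator Z (snd p + fst p *\<^sub>R G0) :: ennreal) \<in> borel_measurable (lborel \<Otimes>\<^sub>M lborel)"
    using shift by measurable
  have tr: "(\<integral>\<^sup>+G. indicator Z (G + t *\<^sub>R G0) \<partial>lborel) = emeasure lborel Z" for t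
  proof -
    have "(\<integral>\<^sup>+G. indicator Z (G + t *\<^sub>R G0) \<partial>lborel) = (\<integral>\<^sup>+G. indicator Z G \<partial>distr lborel borel ((+) (t *\<^sub>R G0)))"
      by (subst nn_integral_distr) (auto simp: add.commute)
    also have "\<dots> = emeasure lborel Z" unfolding lborel_distr_plus by simp
    finally show ?thesis .
  qed
  \<comment> \<open>By translation invariance \<open>Z\<close> has the same measure as each of its
    shifts along \<open>G0\<close>, and so as their average over the unit interval; exchanging the
    integrals leaves finite sets of \<open>t\<close>.\<close>
  have "emeasure lborel Z = (\<integral>\<^sup>+t. indicator {0..1::real} t * emeasure lborel Z \<partial>lborel)"
    by (subst nn_integral_multc) auto
  also have "\<dots> = (\<integral>\<^sup>+t. \<integral>\<^sup>+G. indicator {0..1} t * indicator Z (G + t *\<^sub>R G0) \<partial>lborel \<partial>lborel)"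
  proof (rule nn_integral_cong)
    fix t :: real
    have "(\<lambda>G. indicator Z (G + t *\<^sub>R G0) :: ennreal) \<in> borel_measurable lborel" by measurable
    then show "indicator {0..1} t * emeasure lborel Z = (\<integral>\<^sup>+G. indicator {0..1} t * indicator Z (G + t *\<^sub>R G0) \<partial>lborel)"
      by (simp add: nn_integral_cmult tr)
  qed
  also have "\<dots> = (\<integral>\<^sup>+G. \<integral>\<^sup>+t. indicator {0..1} t * indicator Z (G + t *\<^sub>R G0) \<partial>lborel \<partial>lborel)"
    using lborel_pair.Fubini[OF m] by simp
  also have "\<dots> = (\<integral>\<^sup>+G. 0 \<partial>(lborel :: (complex^'r^'n) measure))"
  proof (rule nn_integral_cong)
    fix G
    have "(\<integral>\<^sup>+t. indicator {0..1} t * indicator Z (G + t *\<^sub>R G0) \<partial>lborel) \<le> (\<integral>\<^sup>+t. indicator {t. G + t *\<^sub>R G0 \<in> Z} t \<partial>lborel)"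
      by (intro nn_integral_mono) (auto split: split_indicator)
    also have "\<dots> = emeasure lborel {t. G + t *\<^sub>R G0 \<in> Z}"
      using finite_imp_closed[OF fin[of G]] by (intro nn_integral_indicator) auto
    also have "\<dots> = 0" by (rule emeasure_lborel_countable) (rule countable_finite[OF fin])
    finally show "(\<integral>\<^sup>+t. indicator {0..1} t * indicator Z (G + t *\<^sub>R G0) \<partial>lborel) = 0" by simp
  qed
  finally show ?thesis by (simp add: Z_def)
qed

lemma exists_small_measure_decseq:
  fixes A :: "nat \<Rightarrow> 'a set"
  assumes "prob_space M" "\<And>i. A i \<in> sets M" "decseq A" "emeasure M (\<Inter>i. A i) = 0" "\<delta> > 0"
  shows "\<exists>i. measure M (A i) < \<delta>"
proof -
  interpret prob_space M by (rule assms)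
  have "(\<lambda>i. measure M (A i)) \<longlonglongrightarrow> measure M (\<Inter>i. A i)"
    using assms by (intro finite_Lim_measure_decseq) auto
  then have "(\<lambda>i. measure M (A i)) \<longlonglongrightarrow> 0" using assms by (simp add: measure_def)
  then have "\<forall>\<^sub>F i in sequentially. measure M (A i) < \<delta>" using assms(5) by (rule order_tendstoD)
  then show ?thesis by (auto simp: eventually_sequentially)
qed

text \<open>The law of \<open>G\<close> has a density, so the null set of exactly singular matrices
  also has probability zero; continuity from above then gives a positive threshold.\<close>

lemma near_singular_small:
  fixes PG :: "(complex^'r::finite^'n::finite) measure"
  assumes st: "valid_stats \<sigma> U PG" and V: "vec.subspace V" "vec.dim V \<le> CARD('n)" and \<delta>: "\<delta> > 0"
  shows "\<exists>\<kappa>>0. measure PG (near_singular V \<kappa>) < \<delta>"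
proof -
  obtain f where f: "f \<in> borel_measurable lborel" "PG = density lborel (\<lambda>G. ennreal (f G))" and P: "prob_space PG"
    using st unfolding valid_stats_def by blast
  have m: "near_singular V \<kappa> \<in> sets PG" for \<kappa> by (simp add: f(2) borel_open open_near_singular)
  have "\<exists>i. measure PG (near_singular V (1 / real (Suc i))) < \<delta>"
  proof (rule exists_small_measure_decseq[OF P m _ _ \<delta>])
    show "decseq (\<lambda>i. near_singular V (1 / real (Suc i)) :: (complex^'r^'n) set)"
    proof (rule decseq_SucI)
      fix i
      have "1 / real (Suc (Suc i)) \<le> 1 / real (Suc i)" by (simp add: field_simps)
      then show "near_singular V (1 / real (Suc (Suc i))) \<subseteq> (near_singular V (1 / real (Suc i)) :: (complex^'r^'n) set)"
        unfolding near_singular_def by force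
    qed
    let ?Z = "\<Inter>i. near_singular V (1 / real (Suc i)) :: (complex^'r^'n) set"
    have "?Z \<in> null_sets lborel" using singular_null[OF V] Inter_near_singular_measurable[of V]
      by (simp add: null_sets_def)
    then have "?Z \<in> null_sets PG"
      using absolutely_continuousI_density[of "\<lambda>G. ennreal (f G)" lborel] f unfolding absolutely_continuous_def by auto
    then show "emeasure PG ?Z = 0" by (rule null_setsD1)
  qed
  then obtain i where "measure PG (near_singular V (1 / real (Suc i))) < \<delta>" by blast
  then show ?thesis by (intro exI[of _ "1 / real (Suc i)"]) simp
qed

lemma noise_tight:
  assumes \<nu>: "tame_noise (\<nu> :: 'e::euclidean_space measure)" and \<delta>: "\<delta> > 0"
  shows "\<exists>t>0. measure \<nu> {w. norm w \<ge> t} < \<delta>"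
proof -
  have P: "prob_space \<nu>" and s: "sets \<nu> = sets borel" using \<nu> by (auto simp: tame_noise_def)
  have "\<exists>i. measure \<nu> {w. norm w \<ge> real (Suc i)} < \<delta>"
  proof (rule exists_small_measure_decseq[OF P _ _ _ \<delta>])
    show "{w :: 'e. norm w \<ge> real (Suc i)} \<in> sets \<nu>" for i unfolding s
      by (intro borel_closed closed_Collect_le continuous_intros)
    show "decseq (\<lambda>i. {w :: 'e. norm w \<ge> real (Suc i)})" by (intro decseq_SucI) auto
    have "(\<Inter>i. {w :: 'e. norm w \<ge> real (Suc i)}) = {}"
    proof (rule equals0I)
      fix w :: 'e assume w: "w \<in> (\<Inter>i. {w. norm w \<ge> real (Suc i)})"
      obtain n where "norm w < real n" using reals_Archimedean2 by blast
      moreover have "real (Suc n) \<le> norm w" using w by blast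
      ultimately show False by simp
    qed
    then show "emeasure \<nu> (\<Inter>i. {w :: 'e. norm w \<ge> real (Suc i)}) = 0" by simp
  qed
  then obtain i where "measure \<nu> {w. norm w \<ge> real (Suc i)} < \<delta>" by blast
  then show ?thesis by (intro exI[of _ "real (Suc i)"]) simp
qed

section \<open>Achievability\<close>

text \<open>A receiver tests its own message \<open>m\<close> jointly with every message
  \<open>m'\<close> of the other user, because shared streams carry both. A pair is accepted if
  fewer than \<open>J / n\<close> letters have a residual of size at least \<open>t\<close>; no
  fading statistics are used. If no pair is accepted, the value of \<open>LEAST\<close> is
  irrelevant, since the analysis only concerns outcomes where the true pair is accepted.\<close>

definition threshold_decoder ::
  "nat \<Rightarrow> real \<Rightarrow> nat \<Rightarrow> nat \<Rightarrow> nat \<Rightarrow> (nat \<Rightarrow> nat \<Rightarrow> nat \<Rightarrow> complex^'m::finite) \<Rightarrow>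
   (nat \<Rightarrow> (complex^'m^'n::finite) \<times> (complex^'n)) \<Rightarrow> nat" where
  "threshold_decoder n t J L K enc z =
     (LEAST m. m < L \<and> (\<exists>m'<K. n * card {j\<in>{..<J}. t \<le> norm (snd (z j) - fst (z j) *v enc m m' j)} < J))"

lemma threshold_decoder_measurable:
  "(threshold_decoder n t J L K enc :: (nat \<Rightarrow> (complex^'m::finite^'n::finite) \<times> (complex^'n)) \<Rightarrow> nat)
     \<in> PiM {..<J} (\<lambda>_. borel) \<rightarrow>\<^sub>M count_space UNIV"
proof -
  have 1: "(\<lambda>y :: (complex^'m^'n) \<times> (complex^'n). norm (snd y - fst y *v x)) \<in> borel_measurable borel" for x
    unfolding matrix_vector_mult_def by (intro borel_measurable_continuous_onI continuous_intros)
  have ind: "indicator {y. t \<le> norm (snd y - fst y *v x)} \<in> borel_measurable (borel :: ((complex^'m^'n) \<times> (complex^'n)) measure)" for x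
    using 1[of x] by measurable
  have comp: "(\<lambda>z. indicator {y. t \<le> norm (snd y - fst y *v x)} (z j) :: real)
      \<in> borel_measurable (PiM {..<J} (\<lambda>_. borel :: ((complex^'m^'n) \<times> (complex^'n)) measure))" if "j \<in> {..<J}" for j x
    by (rule measurable_compose[OF measurable_component_singleton[OF that] ind])
  have card: "real (card {j\<in>{..<J}. t \<le> norm (snd (z j) - fst (z j) *v enc m m' j)}) =
      (\<Sum>j<J. indicator {y. t \<le> norm (snd y - fst y *v enc m m' j)} (z j))" for z :: "nat \<Rightarrow> (complex^'m^'n) \<times> (complex^'n)" and m m'
    by (simp add: indicator_def sum.inter_filter[symmetric] Int_def)
  have eq: "n * card {j\<in>{..<J}. t \<le> norm (snd (z j) - fst (z j) *v enc m m' j)} < J \<longleftrightarrow>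
      real n * (\<Sum>j<J. indicator {y. t \<le> norm (snd y - fst y *v enc m m' j)} (z j)) < real J"
    for z :: "nat \<Rightarrow> (complex^'m^'n) \<times> (complex^'n)" and m m'
    unfolding card[symmetric] of_nat_mult[symmetric] of_nat_less_iff by (rule refl)
  have sum: "(\<lambda>z. \<Sum>j<J. indicator {y. t \<le> norm (snd y - fst y *v enc m m' j)} (z j) :: real)
      \<in> borel_measurable (PiM {..<J} (\<lambda>_. borel :: ((complex^'m^'n) \<times> (complex^'n)) measure))" for m m'
    by (intro borel_measurable_sum comp)
  note [measurable] = sum
  show ?thesis unfolding threshold_decoder_def eq by measurable
qed

text \<open>On the positions \<open>S\<close> where a competitor is separated, each letter is bad or
  leaves the competitor a residual of at least \<open>2 * t - t\<close>. Fewer than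
  \<open>J / n\<close> letters of either kind cannot fill a set of \<open>2 * J / n\<close>
  positions; this fixes both factors 2, in the code distance and in the separation.\<close>

lemma threshold_decoder_correct:
  fixes H :: "nat \<Rightarrow> complex^'m::finite^'n::finite"
  assumes m: "m < L" "m' < K" and few: "n * card {j\<in>{..<J}. bad j} < J"
    and z: "\<And>j. j < J \<Longrightarrow> z j = (H j, H j *v enc m m' j + w j)"
    and w: "\<And>j. j < J \<Longrightarrow> \<not> bad j \<Longrightarrow> norm (w j) < t"
    and sep: "\<And>l l'. l < L \<Longrightarrow> l' < K \<Longrightarrow> l \<noteq> m \<Longrightarrow> \<exists>S\<subseteq>{..<J}. 2 * J \<le> n * card S \<and>
      (\<forall>j\<in>S. \<not> bad j \<longrightarrow> 2 * t \<le> norm (H j *v (enc m m' j - enc l l' j)))"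
  shows "threshold_decoder n t J L K enc z = m"
  unfolding threshold_decoder_def
proof (rule Least_equality)
  have "card {j\<in>{..<J}. t \<le> norm (snd (z j) - fst (z j) *v enc m m' j)} \<le> card {j\<in>{..<J}. bad j}"
  proof (rule card_mono)
    show "{j\<in>{..<J}. t \<le> norm (snd (z j) - fst (z j) *v enc m m' j)} \<subseteq> {j\<in>{..<J}. bad j}"
      using w by (auto simp: z) (meson not_less)
  qed simp
  then have "n * card {j\<in>{..<J}. t \<le> norm (snd (z j) - fst (z j) *v enc m m' j)} < J"
    using few by (meson le_less_trans mult_le_mono2)
  then show "m < L \<and> (\<exists>m'<K. n * card {j\<in>{..<J}. t \<le> norm (snd (z j) - fst (z j) *v enc m m' j)} < J)"
    using m by blast
next
  fix l assume l: "l < L \<and> (\<exists>l'<K. n * card {j\<in>{..<J}. t \<le> norm (snd (z j) - fst (z j) *v enc l l' j)} < J)"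
  show "m \<le> l"
  proof (rule ccontr)
    assume "\<not> m \<le> l"
    obtain l' where l': "l' < K" "n * card {j\<in>{..<J}. t \<le> norm (snd (z j) - fst (z j) *v enc l l' j)} < J" using l by blast
    obtain S where S: "S \<subseteq> {..<J}" "2 * J \<le> n * card S"
      "\<And>j. j \<in> S \<Longrightarrow> \<not> bad j \<Longrightarrow> 2 * t \<le> norm (H j *v (enc m m' j - enc l l' j))"
      using sep[of l l'] l l'(1) \<open>\<not> m \<le> l\<close> by auto
    have "S \<subseteq> {j\<in>{..<J}. bad j} \<union> {j\<in>{..<J}. t \<le> norm (snd (z j) - fst (z j) *v enc l l' j)}"
    proof
      fix j assume j: "j \<in> S"
      have "t \<le> norm (snd (z j) - fst (z j) *v enc l l' j)" if "\<not> bad j"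
      proof -
        have "snd (z j) - fst (z j) *v enc l l' j = H j *v (enc m m' j - enc l l' j) + w j"
          using j S(1) by (auto simp: z matrix_vector_mult_diff_distrib)
        moreover have "norm (H j *v (enc m m' j - enc l l' j)) \<le> norm (H j *v (enc m m' j - enc l l' j) + w j) + norm (w j)"
          by (metis add_diff_cancel_right' norm_triangle_ineq4)
        ultimately show ?thesis using S(3)[OF j that] w[of j] j S(1) that by auto
      qed
      then show "j \<in> {j\<in>{..<J}. bad j} \<union> {j\<in>{..<J}. t \<le> norm (snd (z j) - fst (z j) *v enc l l' j)}" using j S(1) by auto
    qed
    then have "card S \<le> card ({j\<in>{..<J}. bad j} \<union> {j\<in>{..<J}. t \<le> norm (snd (z j) - fst (z j) *v enc l l' j)})"
      by (intro card_mono) auto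
    also have "\<dots> \<le> card {j\<in>{..<J}. bad j} + card {j\<in>{..<J}. t \<le> norm (snd (z j) - fst (z j) *v enc l l' j)}"
      by (rule card_Un_le)
    finally have "n * card S \<le> n * card {j\<in>{..<J}. bad j} + n * card {j\<in>{..<J}. t \<le> norm (snd (z j) - fst (z j) *v enc l l' j)}"
      unfolding distrib_left[symmetric] by (rule mult_le_mono2)
    then show False using S(2) few l'(2) by linarith
  qed
qed

context two_user_bc
begin

lemma PiM_output_measurable1:
  "(\<lambda>\<omega>. \<lambda>j\<in>{..<J}. (chan (fst (fst (\<omega> j))) \<sigma>1 U1, chan (fst (fst (\<omega> j))) \<sigma>1 U1 *v x j + fst (snd (\<omega> j)))) \<in>
     block_space PJ J \<rightarrow>\<^sub>M PiM {..<J} (\<lambda>_. borel :: ((complex^'m^'n1) \<times> (complex^'n1)) measure)"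
proof -
  have "continuous_on UNIV (\<lambda>z :: (complex^'m^'n1) \<times> (complex^'n1). (fst z, fst z *v y + snd z))" for y
    unfolding matrix_vector_mult_def by (intro continuous_intros)
  then have [measurable]: "(\<lambda>z :: (complex^'m^'n1) \<times> (complex^'n1). (fst z, fst z *v y + snd z)) \<in> borel \<rightarrow>\<^sub>M borel" for y
    by (rule borel_measurable_continuous_onI)
  have "(\<lambda>z. \<lambda>j\<in>{..<J}. (fst (z j), fst (z j) *v x j + snd (z j))) \<in>
     PiM {..<J} (\<lambda>_. borel :: ((complex^'m^'n1) \<times> (complex^'n1)) measure) \<rightarrow>\<^sub>M PiM {..<J} (\<lambda>_. borel)"
    by measurable
  from measurable_compose[OF PiM_chan_measurable1 this]
  show ?thesis unfolding block_space_def by (simp cong: restrict_cong)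
qed

lemma PiM_output_measurable2:
  "(\<lambda>\<omega>. \<lambda>j\<in>{..<J}. (chan (snd (fst (\<omega> j))) \<sigma>2 U2, chan (snd (fst (\<omega> j))) \<sigma>2 U2 *v x j + snd (snd (\<omega> j)))) \<in>
     block_space PJ J \<rightarrow>\<^sub>M PiM {..<J} (\<lambda>_. borel :: ((complex^'m^'n2) \<times> (complex^'n2)) measure)"
proof -
  have "continuous_on UNIV (\<lambda>z :: (complex^'m^'n2) \<times> (complex^'n2). (fst z, fst z *v y + snd z))" for y
    unfolding matrix_vector_mult_def by (intro continuous_intros)
  then have [measurable]: "(\<lambda>z :: (complex^'m^'n2) \<times> (complex^'n2). (fst z, fst z *v y + snd z)) \<in> borel \<rightarrow>\<^sub>M borel" for y
    by (rule borel_measurable_continuous_onI)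
  have "(\<lambda>z. \<lambda>j\<in>{..<J}. (fst (z j), fst (z j) *v x j + snd (z j))) \<in>
     PiM {..<J} (\<lambda>_. borel :: ((complex^'m^'n2) \<times> (complex^'n2)) measure) \<rightarrow>\<^sub>M PiM {..<J} (\<lambda>_. borel)"
    by measurable
  from measurable_compose[OF PiM_chan_measurable2 this]
  show ?thesis unfolding block_space_def by (simp cong: restrict_cong)
qed

text \<open>A union bound over two fading events and one noise event. The fading events are pulled
  back to the marginals, whatever the dependence between the two users.\<close>

lemma bad_letter_prob:
  assumes A: "A1 \<in> sets borel" "A2 \<in> sets borel"
    and p: "measure PG1 A1 < \<delta>" "measure PG2 A2 < \<delta>" "measure ((cnoise :: (complex^'n1) measure) \<Otimes>\<^sub>M (cnoise :: (complex^'n2) measure)) {w. t \<le> norm w} < \<delta>"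
  defines "P \<equiv> PJ \<Otimes>\<^sub>M ((cnoise :: (complex^'n1) measure) \<Otimes>\<^sub>M (cnoise :: (complex^'n2) measure))"
  shows "{z \<in> space P. fst (fst z) \<in> A1 \<or> snd (fst z) \<in> A2 \<or> t \<le> norm (snd z)} \<in> sets P"
    and "measure P {z \<in> space P. fst (fst z) \<in> A1 \<or> snd (fst z) \<in> A2 \<or> t \<le> norm (snd z)} \<le> 3 * \<delta>"
proof -
  let ?N = "(cnoise :: (complex^'n1) measure) \<Otimes>\<^sub>M (cnoise :: (complex^'n2) measure)"
  interpret PJ: prob_space PJ by (rule joint(1))
  interpret N: prob_space ?N using tame_pair by (simp add: tame_noise_def)
  interpret P: pair_prob_space PJ ?N ..
  have sN: "sets ?N = sets borel" using tame_pair by (simp add: tame_noise_def)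
  have spN: "space ?N = UNIV" using sets_eq_imp_space_eq[OF sN] by simp
  have W: "{w. t \<le> norm w} \<in> sets ?N" unfolding sN by (intro borel_closed closed_Collect_le continuous_intros)
  note [measurable] = fst_snd_PJ A
  let ?S1 = "fst -` A1 \<inter> space PJ" and ?S2 = "snd -` A2 \<inter> space PJ"
  have S: "?S1 \<in> sets PJ" "?S2 \<in> sets PJ" by measurable
  have eq: "{z \<in> space P. fst (fst z) \<in> A1 \<or> snd (fst z) \<in> A2 \<or> t \<le> norm (snd z)} =
      (?S1 \<times> space ?N \<union> ?S2 \<times> space ?N) \<union> space PJ \<times> {w. t \<le> norm w}"
    unfolding P_def space_pair_measure[of PJ] spN by auto
  have R: "?S1 \<times> space ?N \<in> sets P" "?S2 \<times> space ?N \<in> sets P" "space PJ \<times> {w. t \<le> norm w} \<in> sets P"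
    unfolding P_def by (intro pair_measureI S W sets.top)+
  show "{z \<in> space P. fst (fst z) \<in> A1 \<or> snd (fst z) \<in> A2 \<or> t \<le> norm (snd z)} \<in> sets P"
    unfolding eq by (intro sets.Un R)
  have T: "measure P (X \<times> Y) = measure PJ X * measure ?N Y" if "X \<in> sets PJ" "Y \<in> sets ?N" for X Y
    unfolding P_def using that by (simp add: measure_def N.emeasure_pair_measure_Times enn2real_mult)
  have m1: "measure PJ ?S1 = measure PG1 A1" unfolding marg1[symmetric] by (rule measure_distr[symmetric]) measurable
  have m2: "measure PJ ?S2 = measure PG2 A2" unfolding marg2[symmetric] by (rule measure_distr[symmetric]) measurable
  have "measure P ((?S1 \<times> space ?N \<union> ?S2 \<times> space ?N) \<union> space PJ \<times> {w. t \<le> norm w})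
      \<le> measure P (?S1 \<times> space ?N \<union> ?S2 \<times> space ?N) + measure P (space PJ \<times> {w. t \<le> norm w})"
    by (intro measure_Un_le sets.Un R)
  also have "measure P (?S1 \<times> space ?N \<union> ?S2 \<times> space ?N) \<le> measure P (?S1 \<times> space ?N) + measure P (?S2 \<times> space ?N)"
    by (intro measure_Un_le sets.Un R)
  finally show "measure P {z \<in> space P. fst (fst z) \<in> A1 \<or> snd (fst z) \<in> A2 \<or> t \<le> norm (snd z)} \<le> 3 * \<delta>"
    unfolding eq using p T[OF S(1) sets.top] T[OF S(2) sets.top] T[OF sets.top W]
    unfolding m1 m2 PJ.prob_space N.prob_space by linarith
qed

text \<open>For every message pair the error lies in the same event of too many bad letters, so the
  bound is uniform over messages. The probabilities \<open>1 / (3 * 4 ^ n)\<close> add up to the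
  \<open>1 / 4 ^ n\<close> wanted by \<open>many_bad_letters_unlikely\<close>.\<close>

lemma code_exists_of_separated:
  fixes enc :: "nat \<Rightarrow> nat \<Rightarrow> nat \<Rightarrow> complex^'m"
  assumes L: "L1 > 0" "L2 > 0"
    and V: "vec.subspace V1" "vec.subspace V2"
    and p: "measure PG1 (near_singular V1 \<kappa>) < 1 / (3 * 4 ^ n)" "measure PG2 (near_singular V2 \<kappa>) < 1 / (3 * 4 ^ n)"
      "measure ((cnoise :: (complex^'n1) measure) \<Otimes>\<^sub>M (cnoise :: (complex^'n2) measure)) {w. t \<le> norm w} < 1 / (3 * 4 ^ n)"
    and pow: "\<And>m1 m2. m1 < L1 \<Longrightarrow> m2 < L2 \<Longrightarrow> (\<Sum>j<J. (norm (enc m1 m2 j))\<^sup>2) / real J \<le> \<rho>"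
    and sep1: "\<And>m1 m2 l1 l2. m1 < L1 \<Longrightarrow> m2 < L2 \<Longrightarrow> l1 < L1 \<Longrightarrow> l2 < L2 \<Longrightarrow> l1 \<noteq> m1 \<Longrightarrow>
      \<exists>S\<subseteq>{..<J}. 2 * J \<le> n * card S \<and> (\<forall>j\<in>S. vis \<sigma>1 U1 (enc m1 m2 j - enc l1 l2 j) \<in> V1 \<and> 2 * t \<le> \<kappa> * norm (vis \<sigma>1 U1 (enc m1 m2 j - enc l1 l2 j)))"
    and sep2: "\<And>m1 m2 l1 l2. m1 < L1 \<Longrightarrow> m2 < L2 \<Longrightarrow> l1 < L1 \<Longrightarrow> l2 < L2 \<Longrightarrow> l2 \<noteq> m2 \<Longrightarrow>
      \<exists>S\<subseteq>{..<J}. 2 * J \<le> n * card S \<and> (\<forall>j\<in>S. vis \<sigma>2 U2 (enc m1 m2 j - enc l1 l2 j) \<in> V2 \<and> 2 * t \<le> \<kappa> * norm (vis \<sigma>2 U2 (enc m1 m2 j - enc l1 l2 j)))"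
  shows "code_exists \<sigma>1 U1 \<sigma>2 U2 PJ \<rho> J L1 L2 ((1 / 2) ^ J)"
proof -
  let ?\<Omega> = "block_space PJ J"
  let ?P = "PJ \<Otimes>\<^sub>M ((cnoise :: (complex^'n1) measure) \<Otimes>\<^sub>M (cnoise :: (complex^'n2) measure))"
  interpret PJ: prob_space PJ by (rule joint(1))
  interpret N: prob_space "(cnoise :: (complex^'n1) measure) \<Otimes>\<^sub>M (cnoise :: (complex^'n2) measure)"
    using tame_pair by (simp add: tame_noise_def)
  interpret P: pair_prob_space PJ "(cnoise :: (complex^'n1) measure) \<Otimes>\<^sub>M (cnoise :: (complex^'n2) measure)" ..
  interpret \<Omega>: prob_space ?\<Omega> by (rule prob_space_block)
  define bad where "bad = {z \<in> space ?P. fst (fst z) \<in> near_singular V1 \<kappa> \<or> snd (fst z) \<in> near_singular V2 \<kappa> \<or> t \<le> norm (snd z)}"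
  have bm: "bad \<in> sets ?P" and bp: "measure ?P bad \<le> 1 / 4 ^ n"
    using bad_letter_prob[OF borel_open[OF open_near_singular] borel_open[OF open_near_singular] p]
    unfolding bad_def by auto
  define Bad where "Bad = {\<omega> \<in> space ?\<Omega>. J \<le> n * card {j\<in>{..<J}. \<omega> j \<in> bad}}"
  have Bad: "Bad \<in> sets ?\<Omega>" "measure ?\<Omega> Bad \<le> (1 / 2) ^ J"
    unfolding Bad_def block_space_def by (rule many_bad_letters_unlikely[OF P.prob_space_axioms bm bp])+
  define dec1 :: "(nat \<Rightarrow> (complex^'m^'n1) \<times> (complex^'n1)) \<Rightarrow> nat" where "dec1 = threshold_decoder n t J L1 L2 enc"
  define dec2 :: "(nat \<Rightarrow> (complex^'m^'n2) \<times> (complex^'n2)) \<Rightarrow> nat" where "dec2 = threshold_decoder n t J L2 L1 (\<lambda>m2 m1. enc m1 m2)"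
  have dm: "dec1 \<in> PiM {..<J} (\<lambda>_. borel) \<rightarrow>\<^sub>M count_space UNIV" "dec2 \<in> PiM {..<J} (\<lambda>_. borel) \<rightarrow>\<^sub>M count_space UNIV"
    unfolding dec1_def dec2_def by (rule threshold_decoder_measurable)+
  let ?E = "err_event \<sigma>1 U1 \<sigma>2 U2 PJ J enc dec1 dec2"
  have Em: "?E m1 m2 \<in> sets ?\<Omega>" for m1 m2
  proof -
    note [measurable] = measurable_compose[OF PiM_output_measurable1[where J=J and x="enc m1 m2"] dm(1)] measurable_compose[OF PiM_output_measurable2[where J=J and x="enc m1 m2"] dm(2)]
    show ?thesis unfolding err_event_def by measurable
  qed
  have sub: "?E m1 m2 \<subseteq> Bad" if m: "m1 < L1" "m2 < L2" for m1 m2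
  proof
    fix \<omega> assume "\<omega> \<in> ?E m1 m2"
    then have sp: "\<omega> \<in> space ?\<Omega>" and wrong:
      "dec1 (\<lambda>j\<in>{..<J}. (chan (fst (fst (\<omega> j))) \<sigma>1 U1, chan (fst (fst (\<omega> j))) \<sigma>1 U1 *v enc m1 m2 j + fst (snd (\<omega> j)))) \<noteq> m1 \<or>
       dec2 (\<lambda>j\<in>{..<J}. (chan (snd (fst (\<omega> j))) \<sigma>2 U2, chan (snd (fst (\<omega> j))) \<sigma>2 U2 *v enc m1 m2 j + snd (snd (\<omega> j)))) \<noteq> m2"
      unfolding err_event_def mem_Collect_eq by blast+
    have spj: "\<omega> j \<in> space ?P" if "j < J" for j using sp that by (auto simp: block_space_def space_PiM)
    show "\<omega> \<in> Bad"
    proof (rule ccontr)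
      assume "\<omega> \<notin> Bad"
      then have few: "n * card {j\<in>{..<J}. \<omega> j \<in> bad} < J" using sp by (auto simp: Bad_def)
      have good: "fst (fst (\<omega> j)) \<notin> near_singular V1 \<kappa>" "snd (fst (\<omega> j)) \<notin> near_singular V2 \<kappa>" "norm (snd (\<omega> j)) < t"
        if "j < J" "\<omega> j \<notin> bad" for j using that spj by (auto simp: bad_def)
      have "dec1 (\<lambda>j\<in>{..<J}. (chan (fst (fst (\<omega> j))) \<sigma>1 U1, chan (fst (fst (\<omega> j))) \<sigma>1 U1 *v enc m1 m2 j + fst (snd (\<omega> j)))) = m1"
        unfolding dec1_def
      proof (rule threshold_decoder_correct[where m'=m2 and bad="\<lambda>j. \<omega> j \<in> bad" and H="\<lambda>j. chan (fst (fst (\<omega> j))) \<sigma>1 U1" and w="\<lambda>j. fst (snd (\<omega> j))", OF m few])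
        show "norm (fst (snd (\<omega> j))) < t" if "j < J" "\<omega> j \<notin> bad" for j
          using good(3)[OF that] norm_fst_le[of "fst (snd (\<omega> j))" "snd (snd (\<omega> j))"] by simp
        fix l l' assume "l < L1" "l' < L2" "l \<noteq> m1"
        then obtain S where S: "S \<subseteq> {..<J}" "2 * J \<le> n * card S"
          "\<And>j. j \<in> S \<Longrightarrow> vis \<sigma>1 U1 (enc m1 m2 j - enc l l' j) \<in> V1 \<and> 2 * t \<le> \<kappa> * norm (vis \<sigma>1 U1 (enc m1 m2 j - enc l l' j))"
          using sep1[OF m, of l l'] by blast
        have "2 * t \<le> norm (chan (fst (fst (\<omega> j))) \<sigma>1 U1 *v (enc m1 m2 j - enc l l' j))" if "j \<in> S" "\<omega> j \<notin> bad" for j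
        proof -
          have "\<kappa> * norm (vis \<sigma>1 U1 (enc m1 m2 j - enc l l' j)) \<le> norm (fst (fst (\<omega> j)) *v vis \<sigma>1 U1 (enc m1 m2 j - enc l l' j))"
            using good(1)[of j] S that by (intro not_near_singularD[OF _ V(1)]) auto
          then show ?thesis unfolding chan_mult_vec using S(3)[OF that(1)] by linarith
        qed
        then show "\<exists>S\<subseteq>{..<J}. 2 * J \<le> n * card S \<and> (\<forall>j\<in>S. \<omega> j \<notin> bad \<longrightarrow> 2 * t \<le> norm (chan (fst (fst (\<omega> j))) \<sigma>1 U1 *v (enc m1 m2 j - enc l l' j)))"
          using S(1,2) by blast
      qed simp
      moreover have "dec2 (\<lambda>j\<in>{..<J}. (chan (snd (fst (\<omega> j))) \<sigma>2 U2, chan (snd (fst (\<omega> j))) \<sigma>2 U2 *v enc m1 m2 j + snd (snd (\<omega> j)))) = m2"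
        unfolding dec2_def
      proof (rule threshold_decoder_correct[where m'=m1 and bad="\<lambda>j. \<omega> j \<in> bad" and H="\<lambda>j. chan (snd (fst (\<omega> j))) \<sigma>2 U2" and w="\<lambda>j. snd (snd (\<omega> j))", OF m(2,1) few])
        show "norm (snd (snd (\<omega> j))) < t" if "j < J" "\<omega> j \<notin> bad" for j
          using good(3)[OF that] norm_snd_le[of "snd (snd (\<omega> j))" "fst (snd (\<omega> j))"] by simp
        fix l l' assume "l < L2" "l' < L1" "l \<noteq> m2"
        then obtain S where S: "S \<subseteq> {..<J}" "2 * J \<le> n * card S"
          "\<And>j. j \<in> S \<Longrightarrow> vis \<sigma>2 U2 (enc m1 m2 j - enc l' l j) \<in> V2 \<and> 2 * t \<le> \<kappa> * norm (vis \<sigma>2 U2 (enc m1 m2 j - enc l' l j))"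
          using sep2[OF m, of l' l] by blast
        have "2 * t \<le> norm (chan (snd (fst (\<omega> j))) \<sigma>2 U2 *v (enc m1 m2 j - enc l' l j))" if "j \<in> S" "\<omega> j \<notin> bad" for j
        proof -
          have "\<kappa> * norm (vis \<sigma>2 U2 (enc m1 m2 j - enc l' l j)) \<le> norm (snd (fst (\<omega> j)) *v vis \<sigma>2 U2 (enc m1 m2 j - enc l' l j))"
            using good(2)[of j] S that by (intro not_near_singularD[OF _ V(2)]) auto
          then show ?thesis unfolding chan_mult_vec using S(3)[OF that(1)] by linarith
        qed
        then show "\<exists>S\<subseteq>{..<J}. 2 * J \<le> n * card S \<and> (\<forall>j\<in>S. \<omega> j \<notin> bad \<longrightarrow> 2 * t \<le> norm (chan (snd (fst (\<omega> j))) \<sigma>2 U2 *v (enc m1 m2 j - enc l' l j)))"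
          using S(1,2) by blast
      qed simp
      ultimately show False using wrong by blast
    qed
  qed
  have "measure ?\<Omega> (?E m1 m2) \<le> (1 / 2) ^ J" if "m1 < L1" "m2 < L2" for m1 m2
    using \<Omega>.finite_measure_mono[OF sub[OF that] Bad(1)] Bad(2) by linarith
  then have "(\<Sum>m1<L1. \<Sum>m2<L2. measure ?\<Omega> (?E m1 m2)) \<le> (\<Sum>m1<L1. \<Sum>m2<L2. (1 / 2) ^ J)"
    by (intro sum_mono) auto
  also have "\<dots> = (1 / 2) ^ J * (real L1 * real L2)" by simp
  finally have "(\<Sum>m1<L1. \<Sum>m2<L2. measure ?\<Omega> (?E m1 m2)) / (real L1 * real L2) \<le> (1 / 2) ^ J"
    using L by (simp add: divide_le_eq)
  then show ?thesis unfolding code_exists_iff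
    by (intro exI[of _ enc] exI[of _ dec1] exI[of _ dec2] conjI allI impI) (simp_all add: pow dm Em)
qed

end

section \<open>Streams, constellations and messages\<close>

lemma norm_vec_smult: "norm (c *s x) = norm c * norm (x :: complex^'m::finite)"
  by (simp add: norm_vec_def L2_set_right_distrib norm_mult)

text \<open>For a column of \<open>U\<close> the coefficient is an entry of \<open>vis\<close>
  divided by \<open>sqrt (\<sigma> i)\<close>, which is positive; linear combinations inherit a
  bound.\<close>

lemma hip_le_vis:
  fixes U :: "complex^'r::finite^'m::finite"
  assumes \<sigma>: "\<And>i. \<sigma> i > 0" and e: "e \<in> vec.span (columns U)"
  shows "\<exists>K. \<forall>x. norm (hip e x) \<le> K * norm (vis \<sigma> U x)"
  using e
proof (induction rule: vec.span_induct_alt)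
  case base
  show ?case by (intro exI[of _ 0]) simp
next
  case (step c d e)
  then obtain K where K: "\<And>x. norm (hip e x) \<le> K * norm (vis \<sigma> U x)" by blast
  obtain i where i: "d = column i U" using step by (auto simp: columns_def)
  have d: "norm (hip d x) \<le> (1 / sqrt (\<sigma> i)) * norm (vis \<sigma> U x)" for x
  proof -
    have "sqrt (\<sigma> i) * norm (hip d x) = norm (vis \<sigma> U x $ i)"
      using \<sigma>[of i] by (simp add: vis_nth cadj_mult_vec_nth i norm_mult)
    also have "\<dots> \<le> norm (vis \<sigma> U x)" by (rule Finite_Cartesian_Product.norm_nth_le)
    finally show ?thesis using \<sigma>[of i] by (simp add: field_simps)
  qed
  show ?case
  proof (intro exI[of _ "norm c * (1 / sqrt (\<sigma> i)) + K"] allI)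
    fix x
    have "norm (hip (c *s d + e) x) \<le> norm c * norm (hip d x) + norm (hip e x)"
      unfolding hip_add_left hip_smult_left by (rule norm_triangle_le) (simp add: norm_mult)
    also have "\<dots> \<le> norm c * ((1 / sqrt (\<sigma> i)) * norm (vis \<sigma> U x)) + K * norm (vis \<sigma> U x)"
      by (intro add_mono mult_left_mono d K) simp
    finally show "norm (hip (c *s d + e) x) \<le> (norm c * (1 / sqrt (\<sigma> i)) + K) * norm (vis \<sigma> U x)"
      by (simp add: algebra_simps)
  qed
qed

text \<open>Testing the superposition against \<open>e\<close> isolates \<open>u e\<close>, so a
  change of one visible symbol cannot be cancelled by changes on other streams.\<close>

lemma stream_gain:
  fixes U :: "complex^'r::finite^'m::finite"
  assumes \<sigma>: "\<And>i. \<sigma> i > 0" and T: "finite T"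
    and dual: "\<And>e e'. e \<in> T \<Longrightarrow> e' \<in> T \<Longrightarrow> hip e' (b e) = (if e' = e then 1 else 0)"
    and F: "F \<subseteq> T" "F \<subseteq> vec.span (columns U)"
  shows "\<exists>K>0. \<forall>u. \<forall>e\<in>F. norm (u e) \<le> K * norm (vis \<sigma> U (\<Sum>e\<in>T. u e *s b e))"
proof -
  have "\<forall>e\<in>F. \<exists>K. \<forall>x. norm (hip e x) \<le> K * norm (vis \<sigma> U x)" using hip_le_vis[of \<sigma> _ U] \<sigma> F by blast
  then obtain K where K: "\<And>e x. e \<in> F \<Longrightarrow> norm (hip e x) \<le> K e * norm (vis \<sigma> U x)" by metis
  have fF: "finite F" using F T finite_subset by blast
  define M where "M = 1 + (\<Sum>e\<in>F. \<bar>K e\<bar>)"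
  have KM: "K e \<le> M" if "e \<in> F" for e
    using member_le_sum[of e F "\<lambda>e. \<bar>K e\<bar>"] that fF unfolding M_def by simp
  have M0: "M > 0" unfolding M_def by (intro add_pos_nonneg sum_nonneg) auto
  have "norm (u e) \<le> M * norm (vis \<sigma> U (\<Sum>e\<in>T. u e *s b e))" if e: "e \<in> F" for u e
  proof -
    have "(\<Sum>d\<in>T. u d * hip e (b d)) = (\<Sum>d\<in>T. if e = d then u d else 0)"
      using e F by (intro sum.cong) (auto simp: dual subset_iff)
    then have "u e = hip e (\<Sum>e\<in>T. u e *s b e)" using e F T by (auto simp: hip_sum_smult_right)
    then have "norm (u e) \<le> K e * norm (vis \<sigma> U (\<Sum>e\<in>T. u e *s b e))" using K[OF e] by metis
    also have "\<dots> \<le> M * norm (vis \<sigma> U (\<Sum>e\<in>T. u e *s b e))" by (intro mult_right_mono KM e) simp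
    finally show ?thesis .
  qed
  then show ?thesis using M0 by blast
qed

text \<open>Differences of codewords stay in a subspace of dimension at most \<open>card F\<close>.
  As long as this does not exceed the number of antennas, \<open>near_singular_small\<close> applies
  to that subspace.\<close>

lemma vis_streams_in_span:
  assumes T: "finite T" and inv: "\<And>e. e \<in> T - F \<Longrightarrow> cadj U *v b e = 0"
  shows "vis \<sigma> U (\<Sum>e\<in>T. u e *s b e) \<in> vec.span ((\<lambda>e. vis \<sigma> U (b e)) ` F)"
proof -
  have "vis \<sigma> U (\<Sum>e\<in>T. u e *s b e) = (\<Sum>e\<in>T. u e *s vis \<sigma> U (b e))"
    unfolding vis_def matrix_vector_mult_sum_smult by (rule refl)
  also have "\<dots> \<in> vec.span ((\<lambda>e. vis \<sigma> U (b e)) ` F)"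
  proof (intro vec.span_sum vec.span_scale)
    fix e assume e: "e \<in> T"
    show "vis \<sigma> U (b e) \<in> vec.span ((\<lambda>e. vis \<sigma> U (b e)) ` F)"
    proof (cases "e \<in> F")
      case False
      then have "vis \<sigma> U (b e) = 0" using e inv by (simp add: vis_def)
      then show ?thesis by (simp add: vec.span_zero)
    qed (auto intro: vec.span_base)
  qed
  finally show ?thesis .
qed

lemma dim_vis_span_le: "finite F \<Longrightarrow> vec.dim (vec.span ((\<lambda>e. vis \<sigma> U (b e)) ` F)) \<le> card F"
  by (metis vec.dim_span vec.dim_le_card' card_image_le finite_imageI order_trans)

definition qam :: "nat \<Rightarrow> nat \<Rightarrow> complex" where
  "qam p a = Complex (real (a div p)) (real (a mod p))"

lemma norm_qam_le:
  assumes "a < p * p"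
  shows "norm (qam p a) \<le> 2 * real p"
proof -
  have "p > 0" using assms by (cases p) auto
  then have "real (a div p) < real p" "real (a mod p) < real p"
    unfolding of_nat_less_iff using assms by (auto simp: less_mult_imp_div_less)
  then have "\<bar>Re (qam p a)\<bar> + \<bar>Im (qam p a)\<bar> \<le> 2 * real p" unfolding qam_def complex.sel by linarith
  then show ?thesis using cmod_le[of "qam p a"] by linarith
qed

lemma qam_separated:
  assumes "a \<noteq> a'"
  shows "1 \<le> norm (qam p a - qam p a')"
proof -
  have *: "1 \<le> \<bar>real x - real y\<bar>" if "x \<noteq> y" for x y :: nat using that by linarith
  have "a div p \<noteq> a' div p \<or> a mod p \<noteq> a' mod p" using assms by (metis div_mult_mod_eq)
  then show ?thesis
  proof
    assume "a div p \<noteq> a' div p"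
    then have "1 \<le> \<bar>Re (qam p a - qam p a')\<bar>" using * by (simp add: qam_def)
    then show ?thesis using abs_Re_le_cmod[of "qam p a - qam p a'"] by linarith
  next
    assume "a mod p \<noteq> a' mod p"
    then have "1 \<le> \<bar>Im (qam p a - qam p a')\<bar>" using * by (simp add: qam_def)
    then show ?thesis using abs_Im_le_cmod[of "qam p a - qam p a'"] by linarith
  qed
qed

text \<open>Splits a message number into one independent part per stream.\<close>

lemma PiE_index:
  assumes "finite T"
  obtains \<phi> :: "nat \<Rightarrow> 'e \<Rightarrow> nat" where "\<And>m e. m < (\<Prod>e\<in>T. k e) \<Longrightarrow> e \<in> T \<Longrightarrow> \<phi> m e < k e"
    "\<And>m l. m < (\<Prod>e\<in>T. k e) \<Longrightarrow> l < (\<Prod>e\<in>T. k e) \<Longrightarrow> m \<noteq> l \<Longrightarrow> \<exists>e\<in>T. \<phi> m e \<noteq> \<phi> l e"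
proof -
  let ?X = "PiE T (\<lambda>e. {..<k e})"
  have "finite ?X" "card ?X = (\<Prod>e\<in>T. k e)" using assms by (auto simp: card_PiE intro: finite_PiE)
  then obtain \<phi> where "bij_betw \<phi> {..<\<Prod>e\<in>T. k e} ?X"
    using ex_bij_betw_nat_finite[of ?X] by (auto simp: atLeast0LessThan)
  then have \<phi>: "inj_on \<phi> {..<\<Prod>e\<in>T. k e}" "\<And>m. m < (\<Prod>e\<in>T. k e) \<Longrightarrow> \<phi> m \<in> ?X"
    by (auto simp: bij_betw_def)
  show ?thesis
  proof (rule that)
    show "\<phi> m e < k e" if "m < (\<Prod>e\<in>T. k e)" "e \<in> T" for m e
      using \<phi>(2)[OF that(1)] that(2) by (auto simp: PiE_iff)
    fix m l assume ml: "m < (\<Prod>e\<in>T. k e)" "l < (\<Prod>e\<in>T. k e)" "m \<noteq> l"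
    show "\<exists>e\<in>T. \<phi> m e \<noteq> \<phi> l e"
    proof (rule ccontr)
      assume "\<not> ?thesis"
      then have "\<phi> m = \<phi> l" using \<phi>(2)[OF ml(1)] \<phi>(2)[OF ml(2)] by (intro PiE_ext[of _ T "\<lambda>e. {..<k e}"]) auto
      then show False using \<phi>(1) ml by (auto dest: inj_onD)
    qed
  qed
qed

context two_user_bc
begin

text \<open>The constant \<open>A\<close> is fixed before \<open>p\<close>, \<open>J\<close> and
  \<open>\<rho>\<close>: thresholds and spacing depend only on \<open>n\<close> and the statistics,
  so they cost a bounded amount against \<open>ln \<rho>\<close>.\<close>

lemma stream_code:
  fixes T F1 F2 :: "(complex^'m) set"
  assumes T: "finite T"
    and dual: "\<And>e e'. e \<in> T \<Longrightarrow> e' \<in> T \<Longrightarrow> hip e' (b e) = (if e' = e then 1 else 0)"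
    and F1: "F1 \<subseteq> T" "F1 \<subseteq> vec.span (columns U1)" "card F1 \<le> CARD('n1)" "\<And>e. e \<in> T - F1 \<Longrightarrow> cadj U1 *v b e = 0"
    and F2: "F2 \<subseteq> T" "F2 \<subseteq> vec.span (columns U2)" "card F2 \<le> CARD('n2)" "\<And>e. e \<in> T - F2 \<Longrightarrow> cadj U2 *v b e = 0"
    and n: "n > 0"
  shows "\<exists>A>0. \<forall>p>0. \<forall>J>0. \<forall>\<rho> B b1 b2. (A * real p)\<^sup>2 \<le> \<rho> \<longrightarrow>
     real B * (2 ^ J * real (p * p) powr (2 * real J / real n)) \<le> real (p * p) ^ J \<longrightarrow>
     (\<forall>e\<in>T. 0 < b1 e \<and> 0 < b2 e \<and> b1 e * b2 e \<le> B) \<longrightarrow> (\<forall>e\<in>T - F1. b1 e = 1) \<longrightarrow> (\<forall>e\<in>T - F2. b2 e = 1) \<longrightarrow>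
     code_exists \<sigma>1 U1 \<sigma>2 U2 PJ \<rho> J (\<Prod>e\<in>T. b1 e) (\<Prod>e\<in>T. b2 e) ((1 / 2) ^ J)"
proof -
  have pos: "\<And>i. \<sigma>1 i > 0" "\<And>i. \<sigma>2 i > 0" using stats1 stats2 by (auto simp: valid_stats_def)
  have fF: "finite F1" "finite F2" using F1 F2 T finite_subset by blast+
  define V1 where "V1 = vec.span ((\<lambda>e. vis \<sigma>1 U1 (b e)) ` F1)"
  define V2 where "V2 = vec.span ((\<lambda>e. vis \<sigma>2 U2 (b e)) ` F2)"
  have V: "vec.subspace V1" "vec.subspace V2" unfolding V1_def V2_def by auto
  have dim: "vec.dim V1 \<le> CARD('n1)" "vec.dim V2 \<le> CARD('n2)"
    unfolding V1_def V2_def using F1(3) F2(3) dim_vis_span_le[OF fF(1)] dim_vis_span_le[OF fF(2)] order_trans by blast+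
  let ?\<delta> = "1 / (3 * 4 ^ n) :: real"
  have \<delta>: "?\<delta> > 0" by simp
  obtain \<kappa>1 where \<kappa>1: "\<kappa>1 > 0" "measure PG1 (near_singular V1 \<kappa>1) < ?\<delta>"
    using near_singular_small[OF stats1 V(1) dim(1) \<delta>] by blast
  obtain \<kappa>2 where \<kappa>2: "\<kappa>2 > 0" "measure PG2 (near_singular V2 \<kappa>2) < ?\<delta>"
    using near_singular_small[OF stats2 V(2) dim(2) \<delta>] by blast
  obtain t where t: "t > 0" "measure ((cnoise :: (complex^'n1) measure) \<Otimes>\<^sub>M (cnoise :: (complex^'n2) measure)) {w. t \<le> norm w} < ?\<delta>"
    using noise_tight[OF tame_pair \<delta>] by blast
  define \<kappa> where "\<kappa> = min \<kappa>1 \<kappa>2"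
  have \<kappa>: "\<kappa> > 0" using \<kappa>1 \<kappa>2 by (simp add: \<kappa>_def)
  have p1: "measure PG1 (near_singular V1 \<kappa>) < ?\<delta>"
  proof (rule le_less_trans[OF _ \<kappa>1(2)])
    interpret prob_space PG1 using stats1 by (simp add: valid_stats_def)
    have "sets PG1 = sets borel" unfolding marg1[symmetric] by simp
    then show "measure PG1 (near_singular V1 \<kappa>) \<le> measure PG1 (near_singular V1 \<kappa>1)"
      by (intro finite_measure_mono) (auto simp: near_singular_def[where 'n='n1] \<kappa>_def borel_open[OF open_near_singular, unfolded near_singular_def])
  qed
  have p2: "measure PG2 (near_singular V2 \<kappa>) < ?\<delta>"
  proof (rule le_less_trans[OF _ \<kappa>2(2)])
    interpret prob_space PG2 using stats2 by (simp add: valid_stats_def)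
    have "sets PG2 = sets borel" unfolding marg2[symmetric] by simp
    then show "measure PG2 (near_singular V2 \<kappa>) \<le> measure PG2 (near_singular V2 \<kappa>2)"
      by (intro finite_measure_mono) (auto simp: near_singular_def[where 'n='n2] \<kappa>_def borel_open[OF open_near_singular, unfolded near_singular_def])
  qed
  obtain K1 where K1: "K1 > 0" "\<And>u e. e \<in> F1 \<Longrightarrow> norm (u e) \<le> K1 * norm (vis \<sigma>1 U1 (\<Sum>e\<in>T. u e *s b e))"
  proof -
    have "\<exists>K>0. \<forall>u. \<forall>e\<in>F1. norm (u e) \<le> K * norm (vis \<sigma>1 U1 (\<Sum>e\<in>T. u e *s b e))"
      by (rule stream_gain) (use pos(1) T dual F1(1,2) in auto)
    then show ?thesis using that by blast
  qed
  obtain K2 where K2: "K2 > 0" "\<And>u e. e \<in> F2 \<Longrightarrow> norm (u e) \<le> K2 * norm (vis \<sigma>2 U2 (\<Sum>e\<in>T. u e *s b e))"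
  proof -
    have "\<exists>K>0. \<forall>u. \<forall>e\<in>F2. norm (u e) \<le> K * norm (vis \<sigma>2 U2 (\<Sum>e\<in>T. u e *s b e))"
      by (rule stream_gain) (use pos(2) T dual F2(1,2) in auto)
    then show ?thesis using that by blast
  qed
  \<comment> \<open>The spacing: a single wrong visible symbol moves \<open>vis\<close> by at least
    \<open>\<Delta> / K1\<close> or \<open>\<Delta> / K2\<close>, which a fading that is not nearly
    singular turns into an output distance of at least \<open>2 * t\<close>.\<close>
  define \<Delta> where "\<Delta> = 2 * t * (K1 + K2) / \<kappa>"
  have \<Delta>: "\<Delta> > 0" using t \<kappa> K1 K2 by (simp add: \<Delta>_def)
  have D1: "2 * t \<le> \<kappa> * v" if "\<Delta> \<le> K1 * v" "v \<ge> 0" for v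
  proof -
    have "\<Delta> \<le> (K1 + K2) * v" using that K2(1) mult_right_mono[of K1 "K1 + K2" v] by linarith
    then have "(K1 + K2) * (2 * t) \<le> (K1 + K2) * (\<kappa> * v)" using \<kappa> by (simp add: \<Delta>_def field_simps)
    then show ?thesis using K1(1) K2(1) by simp
  qed
  have D2: "2 * t \<le> \<kappa> * v" if "\<Delta> \<le> K2 * v" "v \<ge> 0" for v
  proof -
    have "\<Delta> \<le> (K1 + K2) * v" using that K1(1) mult_right_mono[of K2 "K1 + K2" v] by linarith
    then have "(K1 + K2) * (2 * t) \<le> (K1 + K2) * (\<kappa> * v)" using \<kappa> by (simp add: \<Delta>_def field_simps)
    then show ?thesis using K1(1) K2(1) by simp
  qed
  \<comment> \<open>Symbols have norm at most \<open>2 * p\<close>, so codeword letters have norm at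
    most \<open>A * p\<close>; the summand 1 keeps \<open>A\<close> positive when there are no
    streams.\<close>
  define A where "A = 1 + 2 * \<Delta> * (\<Sum>e\<in>T. norm (b e))"
  have A: "A > 0" unfolding A_def using \<Delta> by (intro add_pos_nonneg mult_nonneg_nonneg sum_nonneg) auto
  show ?thesis
  proof (intro exI[of _ A] conjI A allI impI)
    fix p J B :: nat and \<rho> :: real and b1 b2 :: "complex^'m \<Rightarrow> nat"
    assume p: "p > 0" and J: "J > 0" and \<rho>: "(A * real p)\<^sup>2 \<le> \<rho>"
      and GV: "real B * (2 ^ J * real (p * p) powr (2 * real J / real n)) \<le> real (p * p) ^ J"
      and bb: "\<forall>e\<in>T. 0 < b1 e \<and> 0 < b2 e \<and> b1 e * b2 e \<le> B"
      and one1: "\<forall>e\<in>T - F1. b1 e = 1" and one2: "\<forall>e\<in>T - F2. b2 e = 1"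
    obtain c where c: "\<And>i j. i < B \<Longrightarrow> j < J \<Longrightarrow> c i j < p * p"
      "\<And>i i'. i < B \<Longrightarrow> i' < B \<Longrightarrow> i \<noteq> i' \<Longrightarrow> 2 * J \<le> n * card {j\<in>{..<J}. c i j \<noteq> c i' j}"
    proof -
      have "p * p > 0" using p by simp
      from gilbert_varshamov[OF this n GV] show ?thesis using that by blast
    qed
    obtain \<phi>1 where \<phi>1: "\<And>m e. m < (\<Prod>e\<in>T. b1 e) \<Longrightarrow> e \<in> T \<Longrightarrow> \<phi>1 m e < b1 e"
      "\<And>m l. m < (\<Prod>e\<in>T. b1 e) \<Longrightarrow> l < (\<Prod>e\<in>T. b1 e) \<Longrightarrow> m \<noteq> l \<Longrightarrow> \<exists>e\<in>T. \<phi>1 m e \<noteq> \<phi>1 l e"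
      using PiE_index[OF T] by blast
    obtain \<phi>2 where \<phi>2: "\<And>m e. m < (\<Prod>e\<in>T. b2 e) \<Longrightarrow> e \<in> T \<Longrightarrow> \<phi>2 m e < b2 e"
      "\<And>m l. m < (\<Prod>e\<in>T. b2 e) \<Longrightarrow> l < (\<Prod>e\<in>T. b2 e) \<Longrightarrow> m \<noteq> l \<Longrightarrow> \<exists>e\<in>T. \<phi>2 m e \<noteq> \<phi>2 l e"
      using PiE_index[OF T] by blast
    \<comment> \<open>On each stream the parts of the two messages are two digits of one codeword
      index; a change of either digit changes the index, whatever the other one does.\<close>
    define idx where "idx e m1 m2 = \<phi>1 m1 e + b1 e * \<phi>2 m2 e" for e m1 m2
    have idx: "idx e m1 m2 < B" if "m1 < (\<Prod>e\<in>T. b1 e)" "m2 < (\<Prod>e\<in>T. b2 e)" "e \<in> T" for e m1 m2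
    proof -
      have "idx e m1 m2 < b1 e * Suc (\<phi>2 m2 e)" using \<phi>1(1)[OF that(1,3)] by (simp add: idx_def)
      also have "\<dots> \<le> b1 e * b2 e" using \<phi>2(1)[OF that(2,3)] by (intro mult_le_mono2) simp
      also have "\<dots> \<le> B" using bb that(3) by blast
      finally show ?thesis .
    qed
    have mods: "idx e m1 m2 mod b1 e = \<phi>1 m1 e" "idx e m1 m2 div b1 e = \<phi>2 m2 e"
      if "m1 < (\<Prod>e\<in>T. b1 e)" "e \<in> T" for e m1 m2
      using \<phi>1(1)[OF that] by (auto simp: idx_def)
    define enc where "enc m1 m2 j = (\<Sum>e\<in>T. (complex_of_real \<Delta> * qam p (c (idx e m1 m2) j)) *s b e)" for m1 m2 j
    define u where "u m1 m2 l1 l2 j e = complex_of_real \<Delta> * (qam p (c (idx e m1 m2) j) - qam p (c (idx e l1 l2) j))" for m1 m2 l1 l2 j e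
    have diff: "enc m1 m2 j - enc l1 l2 j = (\<Sum>e\<in>T. u m1 m2 l1 l2 j e *s b e)" for m1 m2 l1 l2 j
      by (simp add: enc_def u_def sum_subtractf[symmetric] vec.scale_left_diff_distrib[symmetric] right_diff_distrib[symmetric])
    have u\<Delta>: "\<Delta> \<le> norm (u m1 m2 l1 l2 j e)" if "c (idx e m1 m2) j \<noteq> c (idx e l1 l2) j" for m1 m2 l1 l2 j e
      using mult_left_mono[OF qam_separated[OF that, of p], of \<Delta>] \<Delta> by (simp add: u_def norm_mult)
    have inV: "vis \<sigma>1 U1 (enc m1 m2 j - enc l1 l2 j) \<in> V1" "vis \<sigma>2 U2 (enc m1 m2 j - enc l1 l2 j) \<in> V2" for m1 m2 l1 l2 j
      unfolding V1_def V2_def diff using F1(4) F2(4) by (auto intro!: vis_streams_in_span T)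
    show "code_exists \<sigma>1 U1 \<sigma>2 U2 PJ \<rho> J (\<Prod>e\<in>T. b1 e) (\<Prod>e\<in>T. b2 e) ((1 / 2) ^ J)"
    proof (rule code_exists_of_separated[OF _ _ V p1 p2 t(2)])
      show "(\<Prod>e\<in>T. b1 e) > 0" "(\<Prod>e\<in>T. b2 e) > 0" using bb by (auto intro!: prod_pos)
    next
      fix m1 m2 assume m: "m1 < (\<Prod>e\<in>T. b1 e)" "m2 < (\<Prod>e\<in>T. b2 e)"
      have "(norm (enc m1 m2 j))\<^sup>2 \<le> \<rho>" if "j < J" for j
      proof -
        have "norm (enc m1 m2 j) \<le> (\<Sum>e\<in>T. (\<Delta> * (2 * real p)) * norm (b e))"
          unfolding enc_def
        proof (intro order_trans[OF norm_sum] sum_mono)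
          fix e assume "e \<in> T"
          then have "norm (qam p (c (idx e m1 m2) j)) \<le> 2 * real p" using m that by (intro norm_qam_le c idx)
          then show "norm ((complex_of_real \<Delta> * qam p (c (idx e m1 m2) j)) *s b e) \<le> (\<Delta> * (2 * real p)) * norm (b e)"
            using \<Delta> unfolding norm_vec_smult norm_mult norm_of_real by (intro mult_right_mono mult_mono) auto
        qed
        also have "\<dots> \<le> A * real p" unfolding A_def sum_distrib_left[symmetric] by (simp add: algebra_simps)
        finally have "(norm (enc m1 m2 j))\<^sup>2 \<le> (A * real p)\<^sup>2" by (rule power_mono) simp
        then show ?thesis using \<rho> by linarith
      qed
      then have "(\<Sum>j<J. (norm (enc m1 m2 j))\<^sup>2) \<le> (\<Sum>j<J. \<rho>)" by (intro sum_mono) auto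
      then show "(\<Sum>j<J. (norm (enc m1 m2 j))\<^sup>2) / real J \<le> \<rho>" using J by (simp add: divide_le_eq mult.commute)
    next
      fix m1 m2 l1 l2 assume m: "m1 < (\<Prod>e\<in>T. b1 e)" "m2 < (\<Prod>e\<in>T. b2 e)" "l1 < (\<Prod>e\<in>T. b1 e)" "l2 < (\<Prod>e\<in>T. b2 e)"
      have card: "2 * J \<le> n * card {j\<in>{..<J}. c (idx e m1 m2) j \<noteq> c (idx e l1 l2) j}" if "e \<in> T" "idx e m1 m2 \<noteq> idx e l1 l2" for e
        using that m by (intro c(2) idx)
      {
        assume "l1 \<noteq> m1"
        then obtain e where e: "e \<in> T" "\<phi>1 m1 e \<noteq> \<phi>1 l1 e" using \<phi>1(2) m by metis
        have "e \<in> F1"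
        proof (rule ccontr)
          \<comment> \<open>A stream outside \<open>F1\<close> offers user 1 a single value, so two
            messages of user 1 cannot differ there.\<close>
          assume "e \<notin> F1"
          then have "b1 e = 1" using e(1) one1 by simp
          then show False using e \<phi>1(1)[OF m(1) e(1)] \<phi>1(1)[OF m(3) e(1)] by simp
        qed
        have ne: "idx e m1 m2 \<noteq> idx e l1 l2" using e mods(1)[OF m(1) e(1)] mods(1)[OF m(3) e(1)] by metis
        have "2 * t \<le> \<kappa> * norm (vis \<sigma>1 U1 (enc m1 m2 j - enc l1 l2 j))" if "c (idx e m1 m2) j \<noteq> c (idx e l1 l2) j" for j
          using order_trans[OF u\<Delta>[OF that] K1(2)[OF \<open>e \<in> F1\<close>, of "u m1 m2 l1 l2 j"]] unfolding diff by (intro D1) auto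
        then show "\<exists>S\<subseteq>{..<J}. 2 * J \<le> n * card S \<and> (\<forall>j\<in>S. vis \<sigma>1 U1 (enc m1 m2 j - enc l1 l2 j) \<in> V1 \<and> 2 * t \<le> \<kappa> * norm (vis \<sigma>1 U1 (enc m1 m2 j - enc l1 l2 j)))"
          using card[OF e(1) ne] inV by (intro exI[of _ "{j\<in>{..<J}. c (idx e m1 m2) j \<noteq> c (idx e l1 l2) j}"]) auto
      }
      {
        assume "l2 \<noteq> m2"
        then obtain e where e: "e \<in> T" "\<phi>2 m2 e \<noteq> \<phi>2 l2 e" using \<phi>2(2) m by metis
        have "e \<in> F2"
        proof (rule ccontr)
          assume "e \<notin> F2"
          then have "b2 e = 1" using e(1) one2 by simp
          then show False using e \<phi>2(1)[OF m(2) e(1)] \<phi>2(1)[OF m(4) e(1)] by simp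
        qed
        have ne: "idx e m1 m2 \<noteq> idx e l1 l2" using e mods(2)[OF m(1) e(1)] mods(2)[OF m(3) e(1)] by metis
        have "2 * t \<le> \<kappa> * norm (vis \<sigma>2 U2 (enc m1 m2 j - enc l1 l2 j))" if "c (idx e m1 m2) j \<noteq> c (idx e l1 l2) j" for j
          using order_trans[OF u\<Delta>[OF that] K2(2)[OF \<open>e \<in> F2\<close>, of "u m1 m2 l1 l2 j"]] unfolding diff by (intro D2) auto
        then show "\<exists>S\<subseteq>{..<J}. 2 * J \<le> n * card S \<and> (\<forall>j\<in>S. vis \<sigma>2 U2 (enc m1 m2 j - enc l1 l2 j) \<in> V2 \<and> 2 * t \<le> \<kappa> * norm (vis \<sigma>2 U2 (enc m1 m2 j - enc l1 l2 j)))"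
          using card[OF e(1) ne] inV by (intro exI[of _ "{j\<in>{..<J}. c (idx e m1 m2) j \<noteq> c (idx e l1 l2) j}"]) auto
      }
    qed
  qed
qed

end

section \<open>Rates and degrees of freedom of the stream scheme\<close>

lemma code_exists_mono:
  assumes "code_exists \<sigma>1 U1 \<sigma>2 U2 PJ \<rho> J L1 L2 \<epsilon>" "\<epsilon> \<le> \<epsilon>'"
  shows "code_exists \<sigma>1 U1 \<sigma>2 U2 PJ \<rho> J L1 L2 \<epsilon>'"
  using assms(1) unfolding code_exists_iff by (elim ex_forward conj_forward) (use assms(2) in auto)

text \<open>One message per user and constant decoders. It is the fallback point in
  \<open>dof_achievable\<close>.\<close>

lemma achievable_rate_zero:
  assumes "\<rho> > 0"
  shows "achievable_rate \<sigma>1 U1 \<sigma>2 U2 PJ \<rho> (0, 0)"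
proof -
  have "code_exists \<sigma>1 U1 \<sigma>2 U2 PJ \<rho> J 1 1 \<epsilon>" if "\<epsilon> > 0" for J \<epsilon>
    unfolding code_exists_iff
    by (intro exI[of _ "\<lambda>_ _ _. 0"] exI[of _ "\<lambda>_. 0"]) (use assms that in \<open>auto simp: err_event_def\<close>)
  then show ?thesis unfolding achievable_rate_def by (auto intro!: exI[of _ "1::nat"])
qed

lemma ceiling_exp_bounds:
  fixes x :: real
  assumes "x \<ge> 0"
  shows "exp x \<le> real (nat \<lceil>exp x\<rceil>)" "real (nat \<lceil>exp x\<rceil>) \<le> 2 * exp x" "nat \<lceil>exp x\<rceil> > 0"
proof -
  have 1: "exp x \<ge> 1" using assms by simp
  then have eq: "real (nat \<lceil>exp x\<rceil>) = of_int \<lceil>exp x\<rceil>" by simp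
  show "exp x \<le> real (nat \<lceil>exp x\<rceil>)" unfolding eq by (rule le_of_int_ceiling)
  show "real (nat \<lceil>exp x\<rceil>) \<le> 2 * exp x" unfolding eq using 1 of_int_ceiling_le_add_one[of "exp x"] by linarith
  show "nat \<lceil>exp x\<rceil> > 0" by simp
qed

context two_user_bc
begin

text \<open>The shares \<open>\<alpha>1 e\<close> and \<open>\<alpha>2 e\<close> divide stream
  \<open>e\<close> between the users. The power allows \<open>p\<close> of order
  \<open>sqrt \<rho>\<close>, hence an alphabet of order \<open>\<rho>\<close> and one degree of
  freedom per stream, of which the code keeps the fraction \<open>1 - 2 / n\<close>.\<close>

lemma stream_rates:
  fixes T F1 F2 :: "(complex^'m) set" and \<alpha>1 \<alpha>2 :: "complex^'m \<Rightarrow> real"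
  assumes T: "finite T"
    and dual: "\<And>e e'. e \<in> T \<Longrightarrow> e' \<in> T \<Longrightarrow> hip e' (b e) = (if e' = e then 1 else 0)"
    and F1: "F1 \<subseteq> T" "F1 \<subseteq> vec.span (columns U1)" "card F1 \<le> CARD('n1)" "\<And>e. e \<in> T - F1 \<Longrightarrow> cadj U1 *v b e = 0"
    and F2: "F2 \<subseteq> T" "F2 \<subseteq> vec.span (columns U2)" "card F2 \<le> CARD('n2)" "\<And>e. e \<in> T - F2 \<Longrightarrow> cadj U2 *v b e = 0"
    and \<alpha>: "\<And>e. e \<in> T \<Longrightarrow> \<alpha>1 e \<ge> 0" "\<And>e. e \<in> T \<Longrightarrow> \<alpha>2 e \<ge> 0" "\<And>e. e \<in> T \<Longrightarrow> \<alpha>1 e + \<alpha>2 e \<le> 1"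
      "\<And>e. e \<in> T - F1 \<Longrightarrow> \<alpha>1 e = 0" "\<And>e. e \<in> T - F2 \<Longrightarrow> \<alpha>2 e = 0"
    and n: "n \<ge> 2"
  shows "\<exists>C. \<forall>\<rho>\<ge>1. \<forall>r\<ge>0. r \<le> (1 - 2 / real n) * ln \<rho> - C \<longrightarrow>
    achievable_rate \<sigma>1 U1 \<sigma>2 U2 PJ \<rho> (r * (\<Sum>e\<in>T. \<alpha>1 e), r * (\<Sum>e\<in>T. \<alpha>2 e))"
proof -
  have n0: "n > 0" using n by simp
  obtain A where A: "A > 0" and code: "\<And>p J \<rho> B b1 b2. p > 0 \<Longrightarrow> J > 0 \<Longrightarrow> (A * real p)\<^sup>2 \<le> \<rho> \<Longrightarrow>
     real B * (2 ^ J * real (p * p) powr (2 * real J / real n)) \<le> real (p * p) ^ J \<Longrightarrow>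
     (\<forall>e\<in>T. 0 < b1 e \<and> 0 < b2 e \<and> b1 e * b2 e \<le> B) \<Longrightarrow> (\<forall>e\<in>T - F1. b1 e = 1) \<Longrightarrow> (\<forall>e\<in>T - F2. b2 e = 1) \<Longrightarrow>
     code_exists \<sigma>1 U1 \<sigma>2 U2 PJ \<rho> J (\<Prod>e\<in>T. b1 e) (\<Prod>e\<in>T. b2 e) ((1 / 2) ^ J)"
  proof -
    have "\<exists>A>0. \<forall>p>0. \<forall>J>0. \<forall>\<rho> B b1 b2. (A * real p)\<^sup>2 \<le> \<rho> \<longrightarrow>
     real B * (2 ^ J * real (p * p) powr (2 * real J / real n)) \<le> real (p * p) ^ J \<longrightarrow>
     (\<forall>e\<in>T. 0 < b1 e \<and> 0 < b2 e \<and> b1 e * b2 e \<le> B) \<longrightarrow> (\<forall>e\<in>T - F1. b1 e = 1) \<longrightarrow> (\<forall>e\<in>T - F2. b2 e = 1) \<longrightarrow>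
     code_exists \<sigma>1 U1 \<sigma>2 U2 PJ \<rho> J (\<Prod>e\<in>T. b1 e) (\<Prod>e\<in>T. b2 e) ((1 / 2) ^ J)"
      by (rule stream_code[OF T _ F1(1-3) _ F2(1-3) _ n0, where b=b]) (auto simp: dual F1(4) F2(4))
    then show ?thesis by (elim exE conjE) (rule that, blast+)
  qed
  define g where "g = 1 - 2 / real n"
  have g: "0 \<le> g" "g \<le> 1" using n by (auto simp: g_def field_simps)
  \<comment> \<open>\<open>ln 8\<close> covers the factor \<open>2 ^ J\<close> in the ball size and
    the factor 4 from rounding up two message counts; the other term covers the spacing and the
    rounding of \<open>p\<close>.\<close>
  define C where "C = ln 8 + \<bar>2 * ln (2 * A)\<bar>"
  show ?thesis
  proof (intro exI[of _ C] allI impI)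
    fix \<rho> r :: real assume \<rho>: "1 \<le> \<rho>" and r: "0 \<le> r" "r \<le> (1 - 2 / real n) * ln \<rho> - C"
    have r': "r \<le> g * ln \<rho> - C" using r by (simp add: g_def)
    have "g * ln \<rho> \<le> 1 * ln \<rho>" using g \<rho> by (intro mult_right_mono) auto
    \<comment> \<open>A nonnegative admissible \<open>r\<close> forces the SNR to be large, which
      makes \<open>s\<close> at least 2 and rounding it down harmless.\<close>
    then have lnC: "C \<le> ln \<rho>" using r r' by linarith
    define s where "s = sqrt \<rho> / A"
    have lns: "2 * ln (s / 2) = ln \<rho> - 2 * ln (2 * A)"
      using A \<rho> by (simp add: s_def ln_div ln_sqrt ln_mult)
    have s0: "s > 0" using A \<rho> by (simp add: s_def)
    have "0 \<le> 2 * ln (s / 2)" unfolding lns using lnC ln_ge_zero[of "8::real"] unfolding C_def by linarith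
    then have s2: "s / 2 \<ge> 1" using s0 by (metis half_gt_zero ln_ge_zero_iff mult_le_cancel_left_pos mult_zero_right zero_less_numeral)
    define p where "p = nat \<lfloor>s\<rfloor>"
    have ps: "real p \<le> s" "s / 2 \<le> real p"
    proof -
      have "real p = of_int \<lfloor>s\<rfloor>" using s2 by (simp add: p_def)
      then show "real p \<le> s" "s / 2 \<le> real p" using s2 floor_correct[of s] by linarith+
    qed
    have p: "p > 0" using ps s2 by (cases p) auto
    have pow: "(A * real p)\<^sup>2 \<le> \<rho>"
    proof -
      have "A * real p \<le> A * s" using ps A by (intro mult_left_mono) auto
      also have "\<dots> = sqrt \<rho>" using A by (simp add: s_def)
      finally have "(A * real p)\<^sup>2 \<le> (sqrt \<rho>)\<^sup>2" using A by (intro power_mono) auto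
      then show ?thesis using \<rho> by simp
    qed
    define q where "q = p * p"
    have q: "q > 0" using p by (simp add: q_def)
    have lnq: "ln (real q) \<ge> ln \<rho> - 2 * ln (2 * A)"
    proof -
      have "ln (s / 2) \<le> ln (real p)" using ps s2 by (intro ln_mono) auto
      moreover have "ln (real q) = 2 * ln (real p)" using p by (simp add: q_def ln_mult)
      ultimately show ?thesis using lns by linarith
    qed
    have rq: "r \<le> g * ln (real q) - ln 8"
    proof -
      have "g * (ln \<rho> - 2 * ln (2 * A)) \<le> g * ln (real q)" using g lnq by (intro mult_left_mono)
      moreover have "g * (2 * ln (2 * A)) \<le> \<bar>2 * ln (2 * A)\<bar>"
      proof -
        have "g * (2 * ln (2 * A)) \<le> g * \<bar>2 * ln (2 * A)\<bar>" using g by (intro mult_left_mono) auto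
        also have "\<dots> \<le> 1 * \<bar>2 * ln (2 * A)\<bar>" using g by (intro mult_right_mono) auto
        finally show ?thesis by simp
      qed
      ultimately show ?thesis using r' unfolding C_def right_diff_distrib by linarith
    qed
    show "achievable_rate \<sigma>1 U1 \<sigma>2 U2 PJ \<rho> (r * (\<Sum>e\<in>T. \<alpha>1 e), r * (\<Sum>e\<in>T. \<alpha>2 e))"
      unfolding achievable_rate_def
    proof (intro conjI allI impI)
      show "0 \<le> fst (r * (\<Sum>e\<in>T. \<alpha>1 e), r * (\<Sum>e\<in>T. \<alpha>2 e))" "0 \<le> snd (r * (\<Sum>e\<in>T. \<alpha>1 e), r * (\<Sum>e\<in>T. \<alpha>2 e))"
        using r(1) \<alpha>(1,2) by (auto intro!: mult_nonneg_nonneg sum_nonneg)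
      fix \<epsilon> :: real assume "\<epsilon> > 0"
      then obtain J0 where J0: "(1 / 2 :: real) ^ J0 < \<epsilon>" using real_arch_pow_inv[of \<epsilon> "1/2"] by auto
      show "\<exists>J0. \<forall>J\<ge>J0. 0 < J \<longrightarrow> (\<exists>L1 L2. exp (real J * fst (r * (\<Sum>e\<in>T. \<alpha>1 e), r * (\<Sum>e\<in>T. \<alpha>2 e))) \<le> real L1 \<and>
          exp (real J * snd (r * (\<Sum>e\<in>T. \<alpha>1 e), r * (\<Sum>e\<in>T. \<alpha>2 e))) \<le> real L2 \<and> code_exists \<sigma>1 U1 \<sigma>2 U2 PJ \<rho> J L1 L2 \<epsilon>)"
      proof (rule exI[of _ J0], intro allI impI)
        fix J :: nat assume J: "J0 \<le> J" "0 < J"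
        have "(1 / 2 :: real) ^ J \<le> (1 / 2) ^ J0" using J(1) by (intro power_decreasing) auto
        then have \<epsilon>: "(1 / 2) ^ J \<le> \<epsilon>" using J0 by linarith
        define b1 where "b1 e = nat \<lceil>exp (real J * r * \<alpha>1 e)\<rceil>" for e
        define b2 where "b2 e = nat \<lceil>exp (real J * r * \<alpha>2 e)\<rceil>" for e
        \<comment> \<open>The largest size permitted by the Gilbert--Varshamov condition: multiplied
          by the ball bound it equals \<open>q ^ J\<close>.\<close>
        define y where "y = exp (real J * (g * ln (real q) - ln 2))"
        define B where "B = nat \<lfloor>y\<rfloor>"
        have x0: "real J * r * \<alpha>1 e \<ge> 0" "real J * r * \<alpha>2 e \<ge> 0" if "e \<in> T" for e using r(1) \<alpha>(1,2)[OF that] by auto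
        have bB: "b1 e * b2 e \<le> B" if e: "e \<in> T" for e
        proof -
          have "real (b1 e * b2 e) \<le> (2 * exp (real J * r * \<alpha>1 e)) * (2 * exp (real J * r * \<alpha>2 e))"
            unfolding b1_def b2_def of_nat_mult by (intro mult_mono ceiling_exp_bounds x0 e of_nat_0_le_iff) simp
          also have "\<dots> = 4 * exp (real J * r * (\<alpha>1 e + \<alpha>2 e))" by (simp add: exp_add distrib_left)
          also have "\<dots> \<le> 4 * exp (real J * r)" using \<alpha>(3)[OF e] r(1) mult_left_mono[of "\<alpha>1 e + \<alpha>2 e" 1 "real J * r"] by simp
          also have "\<dots> \<le> exp (real J * ln 4) * exp (real J * r)"
          proof (rule mult_right_mono)
            have "exp (1 * ln 4) \<le> exp (real J * ln (4::real))" using J(2) unfolding exp_le_cancel_iff by (intro mult_right_mono) auto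
            then show "4 \<le> exp (real J * ln (4::real))" by simp
          qed simp
          also have "\<dots> = exp (real J * (r + ln 4))" by (simp add: exp_add distrib_left mult.commute)
          also have "\<dots> \<le> y"
          proof -
            have "ln (8::real) = ln 2 + ln 4" using ln_mult[of 2 "4::real"] by simp
            then have "r + ln 4 \<le> g * ln (real q) - ln 2" using rq by linarith
            then show ?thesis unfolding y_def exp_le_cancel_iff by (intro mult_left_mono) auto
          qed
          finally have "real (b1 e * b2 e) \<le> y" .
          then show ?thesis unfolding B_def by (rule le_nat_floor)
        qed
        have GV: "real B * (2 ^ J * real (p * p) powr (2 * real J / real n)) \<le> real (p * p) ^ J"
        proof -
          have e2: "(2::real) ^ J = exp (real J * ln 2)" by (simp add: exp_of_nat_mult)
          have eq: "real q powr (2 * real J / real n) = exp (real J * ((1 - g) * ln (real q)))"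
            using q by (simp add: powr_def g_def)
          have eqJ: "real q ^ J = exp (real J * ln (real q))" using q by (simp add: exp_of_nat_mult)
          have "real B \<le> y" unfolding B_def y_def by (simp add: of_nat_floor)
          then have "real B * (2 ^ J * real q powr (2 * real J / real n)) \<le> y * (2 ^ J * real q powr (2 * real J / real n))"
            by (rule mult_right_mono) simp
          also have "\<dots> = real q ^ J"
            unfolding e2 eq eqJ y_def exp_add[symmetric] by (simp add: algebra_simps)
          finally show ?thesis by (simp only: q_def)
        qed
        have "code_exists \<sigma>1 U1 \<sigma>2 U2 PJ \<rho> J (\<Prod>e\<in>T. b1 e) (\<Prod>e\<in>T. b2 e) ((1 / 2) ^ J)"
        proof (rule code[OF p J(2) pow GV])
          show "\<forall>e\<in>T. 0 < b1 e \<and> 0 < b2 e \<and> b1 e * b2 e \<le> B" using bB by (simp add: b1_def b2_def)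
          show "\<forall>e\<in>T - F1. b1 e = 1" "\<forall>e\<in>T - F2. b2 e = 1" by (simp_all add: b1_def b2_def \<alpha>(4,5))
        qed
        then have "code_exists \<sigma>1 U1 \<sigma>2 U2 PJ \<rho> J (\<Prod>e\<in>T. b1 e) (\<Prod>e\<in>T. b2 e) \<epsilon>" using \<epsilon> by (rule code_exists_mono)
        moreover have "exp (real J * (r * (\<Sum>e\<in>T. \<alpha>1 e))) \<le> real (\<Prod>e\<in>T. b1 e)"
        proof -
          have "exp (real J * (r * (\<Sum>e\<in>T. \<alpha>1 e))) = (\<Prod>e\<in>T. exp (real J * r * \<alpha>1 e))"
            unfolding exp_sum[OF T, symmetric] sum_distrib_left by (simp add: mult.assoc)
          also have "\<dots> \<le> (\<Prod>e\<in>T. real (b1 e))" unfolding b1_def by (intro prod_mono conjI ceiling_exp_bounds x0) auto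
          finally show ?thesis by simp
        qed
        moreover have "exp (real J * (r * (\<Sum>e\<in>T. \<alpha>2 e))) \<le> real (\<Prod>e\<in>T. b2 e)"
        proof -
          have "exp (real J * (r * (\<Sum>e\<in>T. \<alpha>2 e))) = (\<Prod>e\<in>T. exp (real J * r * \<alpha>2 e))"
            unfolding exp_sum[OF T, symmetric] sum_distrib_left by (simp add: mult.assoc)
          also have "\<dots> \<le> (\<Prod>e\<in>T. real (b2 e))" unfolding b2_def by (intro prod_mono conjI ceiling_exp_bounds x0) auto
          finally show ?thesis by simp
        qed
        ultimately show "\<exists>L1 L2. exp (real J * fst (r * (\<Sum>e\<in>T. \<alpha>1 e), r * (\<Sum>e\<in>T. \<alpha>2 e))) \<le> real L1 \<and>
          exp (real J * snd (r * (\<Sum>e\<in>T. \<alpha>1 e), r * (\<Sum>e\<in>T. \<alpha>2 e))) \<le> real L2 \<and> code_exists \<sigma>1 U1 \<sigma>2 U2 PJ \<rho> J L1 L2 \<epsilon>"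
          unfolding fst_conv snd_conv by blast
      qed
    qed
  qed
qed

end

text \<open>The constant \<open>C\<close> depends on \<open>n\<close> without control, so
  \<open>n\<close> cannot simply be tied to \<open>\<rho>\<close>. Instead each
  \<open>\<rho>\<close> gets a nearly largest admissible multiplier \<open>r\<close>; for every
  fixed \<open>n\<close> it is eventually close to \<open>(1 - 2 / n) * ln \<rho>\<close> or above
  it.\<close>

lemma dof_achievable:
  assumes d: "0 \<le> d1" "0 \<le> d2"
    and ach: "\<And>n. n \<ge> 2 \<Longrightarrow> \<exists>C. \<forall>\<rho>\<ge>1. \<forall>r\<ge>0. r \<le> (1 - 2 / real n) * ln \<rho> - C \<longrightarrow>
      achievable_rate \<sigma>1 U1 \<sigma>2 U2 PJ \<rho> (r * d1, r * d2)"
  shows "(d1, d2) \<in> dof_region \<sigma>1 U1 \<sigma>2 U2 PJ"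
proof -
  \<comment> \<open>Capping at \<open>ln \<rho>\<close> bounds the set and keeps the limiting ratio
    from exceeding 1.\<close>
  define S where "S \<rho> = {r \<in> {0..ln \<rho>}. achievable_rate \<sigma>1 U1 \<sigma>2 U2 PJ \<rho> (r * d1, r * d2)}" for \<rho>
  have bdd: "bdd_above (S \<rho>)" for \<rho> by (rule bdd_aboveI[of _ "ln \<rho>"]) (simp add: S_def)
  have ne: "S \<rho> \<noteq> {}" if "\<rho> \<ge> 1" for \<rho>
    using that achievable_rate_zero[of \<rho> \<sigma>1 U1 \<sigma>2 U2 PJ] by (auto simp: S_def intro!: exI[of _ 0])
  \<comment> \<open>A multiplier within 1 of the supremum suffices, since division by
    \<open>ln \<rho>\<close> removes the difference.\<close>
  have "\<exists>r\<in>S \<rho>. Sup (S \<rho>) - 1 < r" if "\<rho> \<ge> 1" for \<rho>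
    using less_cSup_iff[OF ne[OF that] bdd, of "Sup (S \<rho>) - 1"] by simp
  then obtain \<tau> where \<tau>: "\<And>\<rho>. \<rho> \<ge> 1 \<Longrightarrow> \<tau> \<rho> \<in> S \<rho>" "\<And>\<rho>. \<rho> \<ge> 1 \<Longrightarrow> Sup (S \<rho>) - 1 < \<tau> \<rho>" by metis
  have lim: "((\<lambda>\<rho>. \<tau> \<rho> / ln \<rho>) \<longlongrightarrow> 1) at_top"
  proof (rule tendstoI)
    fix \<epsilon> :: real assume \<epsilon>: "\<epsilon> > 0"
    obtain n0 :: nat where n0: "4 / \<epsilon> < real n0" using reals_Archimedean2 by blast
    define n where "n = max 2 n0"
    have n: "n \<ge> 2" "4 / \<epsilon> < real n" using n0 by (auto simp: n_def)
    then have n\<epsilon>: "2 / real n < \<epsilon> / 2" using \<epsilon> by (simp add: field_simps)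
    obtain C0 where C0: "\<And>\<rho> r. \<rho> \<ge> 1 \<Longrightarrow> r \<ge> 0 \<Longrightarrow> r \<le> (1 - 2 / real n) * ln \<rho> - C0 \<Longrightarrow>
      achievable_rate \<sigma>1 U1 \<sigma>2 U2 PJ \<rho> (r * d1, r * d2)" using ach[OF n(1)] by blast
    define C where "C = \<bar>C0\<bar>"
    have g: "0 \<le> 1 - 2 / real n" "1 - 2 / real n \<le> 1" using n(1) by (auto simp: field_simps)
    have ev: "\<forall>\<^sub>F \<rho>::real in at_top. ln \<rho> > 2 * (C + 1) / \<epsilon>" by (rule filterlim_at_top_dense[THEN iffD1, rule_format, OF ln_at_top])
    show "\<forall>\<^sub>F \<rho> in at_top. dist (\<tau> \<rho> / ln \<rho>) 1 < \<epsilon>"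
      using ev eventually_gt_at_top[of "1::real"]
    proof eventually_elim
      case (elim \<rho>)
      have ln0: "ln \<rho> > 0" using elim by simp
      have up: "\<tau> \<rho> \<le> ln \<rho>" and \<tau>0: "\<tau> \<rho> \<ge> 0" using \<tau>(1)[of \<rho>] elim by (auto simp: S_def)
      have low: "(1 - 2 / real n) * ln \<rho> - C - 1 \<le> \<tau> \<rho>"
      proof (cases "(1 - 2 / real n) * ln \<rho> - C \<ge> 0")
        case True
        have "(1 - 2 / real n) * ln \<rho> \<le> 1 * ln \<rho>" using g ln0 by (intro mult_right_mono) auto
        then have "(1 - 2 / real n) * ln \<rho> - C \<le> ln \<rho>" unfolding C_def by linarith
        moreover have "achievable_rate \<sigma>1 U1 \<sigma>2 U2 PJ \<rho> (((1 - 2 / real n) * ln \<rho> - C) * d1, ((1 - 2 / real n) * ln \<rho> - C) * d2)"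
          using True elim by (intro C0) (auto simp: C_def)
        ultimately have "(1 - 2 / real n) * ln \<rho> - C \<in> S \<rho>"
          unfolding S_def using True by simp
        then have "(1 - 2 / real n) * ln \<rho> - C \<le> Sup (S \<rho>)" by (rule cSup_upper[OF _ bdd])
        then show ?thesis using \<tau>(2)[of \<rho>] elim by linarith
      next
        case False
        then show ?thesis using \<tau>0 by linarith
      qed
      have "C + 1 < \<epsilon> / 2 * ln \<rho>" using elim \<epsilon> by (simp add: field_simps)
      moreover have "2 / real n * ln \<rho> < \<epsilon> / 2 * ln \<rho>" using n\<epsilon> ln0 by (rule mult_strict_right_mono)
      ultimately have "(1 - \<epsilon>) * ln \<rho> < \<tau> \<rho>" using low unfolding left_diff_distrib by linarith
      then have "1 - \<epsilon> < \<tau> \<rho> / ln \<rho>" using ln0 by (simp add: less_divide_eq)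
      moreover have "\<tau> \<rho> / ln \<rho> \<le> 1" using up ln0 by (simp add: divide_le_eq)
      ultimately show ?case by (simp add: dist_real_def)
    qed
  qed
  \<comment> \<open>The definition of \<open>dof_region\<close> asks for a point of the capacity
    region at every positive SNR, so zero rates fill in below 1.\<close>
  define R where "R \<rho> = (if \<rho> \<ge> 1 then (\<tau> \<rho> * d1, \<tau> \<rho> * d2) else (0, 0))" for \<rho>
  have cap: "R \<rho> \<in> capacity_region \<sigma>1 U1 \<sigma>2 U2 PJ \<rho>" if "\<rho> > 0" for \<rho>
  proof -
    have "achievable_rate \<sigma>1 U1 \<sigma>2 U2 PJ \<rho> (R \<rho>)"
      using \<tau>(1)[of \<rho>] achievable_rate_zero[OF that] by (auto simp: R_def S_def)
    then show ?thesis unfolding capacity_region_def using closure_subset by blast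
  qed
  have ev1: "\<forall>\<^sub>F \<rho>::real in at_top. \<rho> \<ge> 1" by (rule eventually_ge_at_top)
  have m1: "((\<lambda>\<rho>. \<tau> \<rho> / ln \<rho> * d1) \<longlongrightarrow> 1 * d1) at_top" by (intro tendsto_mult lim tendsto_const)
  have e1: "\<forall>\<^sub>F \<rho> in at_top. \<tau> \<rho> / ln \<rho> * d1 = fst (R \<rho>) / ln \<rho>" using ev1 by eventually_elim (simp add: R_def)
  have l1: "((\<lambda>\<rho>. fst (R \<rho>) / ln \<rho>) \<longlongrightarrow> d1) at_top" using Lim_transform_eventually[OF m1 e1] by simp
  have m2: "((\<lambda>\<rho>. \<tau> \<rho> / ln \<rho> * d2) \<longlongrightarrow> 1 * d2) at_top" by (intro tendsto_mult lim tendsto_const)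
  have e2: "\<forall>\<^sub>F \<rho> in at_top. \<tau> \<rho> / ln \<rho> * d2 = snd (R \<rho>) / ln \<rho>" using ev1 by eventually_elim (simp add: R_def)
  have l2: "((\<lambda>\<rho>. snd (R \<rho>) / ln \<rho>) \<longlongrightarrow> d2) at_top" using Lim_transform_eventually[OF m2 e2] by simp
  show ?thesis unfolding dof_region_def using cap l1 l2 by blast
qed

context two_user_bc
begin

lemma dof_streams:
  fixes T F1 F2 :: "(complex^'m) set" and \<alpha>1 \<alpha>2 :: "complex^'m \<Rightarrow> real"
  assumes T: "finite T"
    and dual: "\<And>e e'. e \<in> T \<Longrightarrow> e' \<in> T \<Longrightarrow> hip e' (b e) = (if e' = e then 1 else 0)"
    and F1: "F1 \<subseteq> T" "F1 \<subseteq> vec.span (columns U1)" "card F1 \<le> CARD('n1)" "\<And>e. e \<in> T - F1 \<Longrightarrow> cadj U1 *v b e = 0"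
    and F2: "F2 \<subseteq> T" "F2 \<subseteq> vec.span (columns U2)" "card F2 \<le> CARD('n2)" "\<And>e. e \<in> T - F2 \<Longrightarrow> cadj U2 *v b e = 0"
    and \<alpha>: "\<And>e. e \<in> T \<Longrightarrow> \<alpha>1 e \<ge> 0" "\<And>e. e \<in> T \<Longrightarrow> \<alpha>2 e \<ge> 0" "\<And>e. e \<in> T \<Longrightarrow> \<alpha>1 e + \<alpha>2 e \<le> 1"
      "\<And>e. e \<in> T - F1 \<Longrightarrow> \<alpha>1 e = 0" "\<And>e. e \<in> T - F2 \<Longrightarrow> \<alpha>2 e = 0"
  shows "(\<Sum>e\<in>T. \<alpha>1 e, \<Sum>e\<in>T. \<alpha>2 e) \<in> dof_region \<sigma>1 U1 \<sigma>2 U2 PJ"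
proof (rule dof_achievable)
  show "0 \<le> (\<Sum>e\<in>T. \<alpha>1 e)" "0 \<le> (\<Sum>e\<in>T. \<alpha>2 e)" using \<alpha> by (auto intro: sum_nonneg)
  fix n :: nat assume n: "n \<ge> 2"
  show "\<exists>C. \<forall>\<rho>\<ge>1. \<forall>r\<ge>0. r \<le> (1 - 2 / real n) * ln \<rho> - C \<longrightarrow>
      achievable_rate \<sigma>1 U1 \<sigma>2 U2 PJ \<rho> (r * (\<Sum>e\<in>T. \<alpha>1 e), r * (\<Sum>e\<in>T. \<alpha>2 e))"
    by (rule stream_rates[OF T _ F1(1-3) _ F2(1-3), where b=b]) (use dual F1(4) F2(4) \<alpha> n in auto)
qed

text \<open>In the first case every stream of the adapted basis is used: each user fills its private
  streams and puts the excess on the common ones. In the second case the private streams alone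
  suffice, and each user occupies as many as it has antennas.\<close>

lemma dof_direct:
  defines "r0 \<equiv> vec.dim (vec.span (columns U1) \<inter> vec.span (columns U2))"
  assumes d: "0 \<le> d1" "0 \<le> d2" "d1 \<le> real (min CARD('n1) CARD('r1))" "d2 \<le> real (min CARD('n2) CARD('r2))"
      "d1 + d2 \<le> real CARD('r1) + real CARD('r2) - real r0"
    and dims: "CARD('r1) \<le> CARD('n1) \<and> CARD('r2) \<le> CARD('n2) \<or>
      real CARD('n1) \<le> real CARD('r1) - real r0 \<and> real CARD('n2) \<le> real CARD('r2) - real r0"
  shows "(d1, d2) \<in> dof_region \<sigma>1 U1 \<sigma>2 U2 PJ"
proof -
  have UU: "cadj U1 ** U1 = mat 1" "cadj U2 ** U2 = mat 1" using stats1 stats2 by (auto simp: valid_stats_def)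
  obtain B A1 A2 where A: "B \<inter> A1 = {}" "B \<inter> A2 = {}" "A1 \<inter> A2 = {}"
    "vec.independent (B \<union> A1 \<union> A2)" "vec.span (B \<union> A1) = vec.span (columns U1)" "vec.span (B \<union> A2) = vec.span (columns U2)"
    "card B = r0" "card (B \<union> A1) = CARD('r1)" "card (B \<union> A2) = CARD('r2)"
    using adapted_basis[of "vec.span (columns U1)" "vec.span (columns U2)"]
    unfolding dim_span_columns[OF UU(1)] dim_span_columns[OF UU(2)] r0_def by (metis vec.subspace_span)
  have fin: "finite (B \<union> A1 \<union> A2)" using A(4) vec.finiteI_independent by blast
  then have f: "finite B" "finite A1" "finite A2" by auto
  have cA: "real (card A1) = real CARD('r1) - real r0" "real (card A2) = real CARD('r2) - real r0"
    using card_Un_disjoint[OF f(1,2) A(1)] card_Un_disjoint[OF f(1,3) A(2)] A(7-9) by linarith+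
  obtain b where b: "\<And>e e'. e \<in> B \<union> A1 \<union> A2 \<Longrightarrow> e' \<in> B \<union> A1 \<union> A2 \<Longrightarrow> hip e' (b e) = (if e' = e then 1 else 0)"
    using dual_family[OF A(4)] by blast
  have inv1: "cadj U1 *v b e = 0" if "e \<in> A2" for e
    by (rule cadj_dual_eq_0[of "B \<union> A1 \<union> A2" b "B \<union> A1"]) (use b A that in auto)
  have inv2: "cadj U2 *v b e = 0" if "e \<in> A1" for e
    by (rule cadj_dual_eq_0[of "B \<union> A1 \<union> A2" b "B \<union> A2"]) (use b A that in auto)
  have sp: "B \<union> A1 \<subseteq> vec.span (columns U1)" "B \<union> A2 \<subseteq> vec.span (columns U2)"
    using vec.span_superset[of "B \<union> A1"] vec.span_superset[of "B \<union> A2"] A(5,6) by auto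
  \<comment> \<open>For empty \<open>X\<close> the quotient is zero by convention, which is right
    because \<open>x\<close> is then zero.\<close>
  have share: "\<exists>\<alpha>\<ge>0. \<alpha> \<le> 1 \<and> real (card X) * \<alpha> = x" if "0 \<le> x" "x \<le> real (card X)" for x and X :: "(complex^'m) set"
    using that by (intro exI[of _ "x / real (card X)"]) (auto simp: field_simps)
  from dims show ?thesis
  proof
    assume le: "CARD('r1) \<le> CARD('n1) \<and> CARD('r2) \<le> CARD('n2)"
    \<comment> \<open>\<open>x1\<close> and \<open>x2\<close> go to private streams,
      \<open>y1\<close> and \<open>y2\<close> are the excess. If both users exceed, the sum bound
      keeps the total excess below \<open>r0\<close>; if one does, its single-user bound
      does.\<close>
    define x1 where "x1 = min d1 (real (card A1))"
    define x2 where "x2 = min d2 (real (card A2))"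
    define y1 where "y1 = d1 - x1"
    define y2 where "y2 = d2 - x2"
    have y: "0 \<le> y1" "0 \<le> y2" "y1 + y2 \<le> real (card B)"
      using d cA A(7) by (auto simp: x1_def x2_def y1_def y2_def)
    obtain a1 where a1: "a1 \<ge> 0" "a1 \<le> 1" "real (card A1) * a1 = x1" using share[of x1 A1] d by (auto simp: x1_def)
    obtain a2 where a2: "a2 \<ge> 0" "a2 \<le> 1" "real (card A2) * a2 = x2" using share[of x2 A2] d by (auto simp: x2_def)
    \<comment> \<open>Without common streams the excess is zero and so is the quotient, by the
      convention for division by zero.\<close>
    define c1 where "c1 = y1 / real (card B)"
    define c2 where "c2 = y2 / real (card B)"
    have c: "c1 \<ge> 0" "c2 \<ge> 0" "c1 + c2 \<le> 1" "real (card B) * c1 = y1" "real (card B) * c2 = y2"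
      using y by (auto simp: c1_def c2_def add_divide_distrib[symmetric] divide_le_eq)
    define \<alpha>1 where "\<alpha>1 e = (if e \<in> A1 then a1 else if e \<in> B then c1 else 0)" for e
    define \<alpha>2 where "\<alpha>2 e = (if e \<in> A2 then a2 else if e \<in> B then c2 else 0)" for e
    have disj: "(B \<union> A1) \<inter> A2 = {}" using A by auto
    have s1: "(\<Sum>e\<in>B \<union> A1 \<union> A2. \<alpha>1 e) = d1"
    proof -
      have "(\<Sum>e\<in>B. \<alpha>1 e) = (\<Sum>e\<in>B. c1)" "(\<Sum>e\<in>A1. \<alpha>1 e) = (\<Sum>e\<in>A1. a1)" "(\<Sum>e\<in>A2. \<alpha>1 e) = (\<Sum>e\<in>A2. 0)"
        by (rule sum.cong; use A(1-3) in \<open>auto simp: \<alpha>1_def\<close>)+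
      then show ?thesis using f A(1) disj c a1 by (simp add: sum.union_disjoint y1_def)
    qed
    have s2: "(\<Sum>e\<in>B \<union> A1 \<union> A2. \<alpha>2 e) = d2"
    proof -
      have "(\<Sum>e\<in>B. \<alpha>2 e) = (\<Sum>e\<in>B. c2)" "(\<Sum>e\<in>A1. \<alpha>2 e) = (\<Sum>e\<in>A1. 0)" "(\<Sum>e\<in>A2. \<alpha>2 e) = (\<Sum>e\<in>A2. a2)"
        by (rule sum.cong; use A(1-3) in \<open>auto simp: \<alpha>2_def\<close>)+
      then show ?thesis using f A(1) disj c a2 by (simp add: sum.union_disjoint y2_def)
    qed
    have "(\<Sum>e\<in>B \<union> A1 \<union> A2. \<alpha>1 e, \<Sum>e\<in>B \<union> A1 \<union> A2. \<alpha>2 e) \<in> dof_region \<sigma>1 U1 \<sigma>2 U2 PJ"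
    proof (rule dof_streams[OF fin, of b "B \<union> A1" "B \<union> A2"])
      fix e assume "e \<in> B \<union> A1 \<union> A2"
      then show "\<alpha>1 e \<ge> 0" "\<alpha>2 e \<ge> 0" "\<alpha>1 e + \<alpha>2 e \<le> 1"
        using A(1-3) a1 a2 c by (auto simp: \<alpha>1_def \<alpha>2_def)
    qed (use b sp inv1 inv2 le A in \<open>auto simp: \<alpha>1_def \<alpha>2_def\<close>)
    then show ?thesis unfolding s1 s2 .
  next
    assume le: "real CARD('n1) \<le> real CARD('r1) - real r0 \<and> real CARD('n2) \<le> real CARD('r2) - real r0"
    then have "CARD('n1) \<le> card A1" "CARD('n2) \<le> card A2" using cA by linarith+
    \<comment> \<open>Exactly as many private streams as antennas, so that each receiver can invert
      the fading on its own streams; the others are not transmitted.\<close>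
    then obtain T1 T2 where T: "T1 \<subseteq> A1" "card T1 = CARD('n1)" "T2 \<subseteq> A2" "card T2 = CARD('n2)"
      by (meson obtain_subset_with_card_n)
    have fT: "finite T1" "finite T2" using T f finite_subset by blast+
    have disj: "T1 \<inter> T2 = {}" using T A(3) by blast
    have "d1 \<le> real (card T1)" "d2 \<le> real (card T2)"
      using d(3,4) T by (auto simp: of_nat_min)
    then obtain a1 a2 where a1: "a1 \<ge> 0" "a1 \<le> 1" "real (card T1) * a1 = d1"
      and a2: "a2 \<ge> 0" "a2 \<le> 1" "real (card T2) * a2 = d2"
      using share[of d1 T1] share[of d2 T2] d(1,2) by auto
    define \<alpha>1 where "\<alpha>1 e = (if e \<in> T1 then a1 else 0)" for e
    define \<alpha>2 where "\<alpha>2 e = (if e \<in> T2 then a2 else 0)" for e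
    have s1: "(\<Sum>e\<in>T1 \<union> T2. \<alpha>1 e) = d1"
    proof -
      have "(\<Sum>e\<in>T1. \<alpha>1 e) = (\<Sum>e\<in>T1. a1)" "(\<Sum>e\<in>T2. \<alpha>1 e) = (\<Sum>e\<in>T2. 0)"
        by (rule sum.cong; use disj in \<open>auto simp: \<alpha>1_def\<close>)+
      then show ?thesis using fT disj a1 by (simp add: sum.union_disjoint)
    qed
    have s2: "(\<Sum>e\<in>T1 \<union> T2. \<alpha>2 e) = d2"
    proof -
      have "(\<Sum>e\<in>T1. \<alpha>2 e) = (\<Sum>e\<in>T1. 0)" "(\<Sum>e\<in>T2. \<alpha>2 e) = (\<Sum>e\<in>T2. a2)"
        by (rule sum.cong; use disj in \<open>auto simp: \<alpha>2_def\<close>)+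
      then show ?thesis using fT disj a2 by (simp add: sum.union_disjoint)
    qed
    have "(\<Sum>e\<in>T1 \<union> T2. \<alpha>1 e, \<Sum>e\<in>T1 \<union> T2. \<alpha>2 e) \<in> dof_region \<sigma>1 U1 \<sigma>2 U2 PJ"
    proof (rule dof_streams[of "T1 \<union> T2" b T1 T2])
      fix e e' assume "e \<in> T1 \<union> T2" "e' \<in> T1 \<union> T2"
      then show "hip e' (b e) = (if e' = e then 1 else 0)" using T by (intro b) auto
    next
      fix e assume "e \<in> T1 \<union> T2"
      then show "\<alpha>1 e \<ge> 0" "\<alpha>2 e \<ge> 0" "\<alpha>1 e + \<alpha>2 e \<le> 1"
        using disj a1 a2 by (auto simp: \<alpha>1_def \<alpha>2_def)
    qed (use fT T sp inv1 inv2 in \<open>auto simp: \<alpha>1_def \<alpha>2_def\<close>)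
    then show ?thesis unfolding s1 s2 .
  qed
qed

end

theorem theorem2:
  fixes \<sigma>1 :: "'r1::finite \<Rightarrow> real" and U1 :: "complex^'r1^'m::finite"
    and \<sigma>2 :: "'r2::finite \<Rightarrow> real" and U2 :: "complex^'r2^'m"
    and PG1 :: "(complex^'r1^'n1::finite) measure" and PG2 :: "(complex^'r2^'n2::finite) measure"
    and PJ :: "((complex^'r1^'n1) \<times> (complex^'r2^'n2)) measure"
  assumes stats1: "valid_stats \<sigma>1 U1 PG1"
    and stats2: "valid_stats \<sigma>2 U2 PG2"
    and joint: "prob_space PJ" "sets PJ = sets borel"
    and marg1: "distr PJ borel fst = PG1"
    and marg2: "distr PJ borel snd = PG2"
  defines "r1 \<equiv> CARD('r1)" and "r2 \<equiv> CARD('r2)"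
    and "N1 \<equiv> CARD('n1)" and "N2 \<equiv> CARD('n2)"
    and "r0 \<equiv> vec.dim (vec.span (columns U1) \<inter> vec.span (columns U2))"
  shows "(\<forall>(d1, d2) \<in> dof_region \<sigma>1 U1 \<sigma>2 U2 PJ.
            d1 \<le> real (min N1 r1) \<and> d2 \<le> real (min N2 r2) \<and>
            d1 + d2 \<le> min (real r1 + real r2 - real r0) (real N1 + real N2))
       \<and> (((r1 \<le> N1 \<and> r2 \<le> N2) \<or> (real N1 \<le> real r1 - real r0 \<and> real N2 \<le> real r2 - real r0)) \<longrightarrow>
            dof_region \<sigma>1 U1 \<sigma>2 U2 PJ =
              {(d1, d2). d1 \<ge> 0 \<and> d2 \<ge> 0 \<and>
                 d1 \<le> real (min N1 r1) \<and> d2 \<le> real (min N2 r2) \<and>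
                 d1 + d2 \<le> min (real r1 + real r2 - real r0) (real N1 + real N2)})"
proof -
  interpret two_user_bc \<sigma>1 U1 \<sigma>2 U2 PG1 PG2 PJ
    by (rule two_user_bc.intro[OF stats1 stats2 joint marg1 marg2])
  have conv: "d1 \<le> real (min N1 r1) \<and> d2 \<le> real (min N2 r2) \<and>
      d1 + d2 \<le> min (real r1 + real r2 - real r0) (real N1 + real N2)"
    if "(d1, d2) \<in> dof_region \<sigma>1 U1 \<sigma>2 U2 PJ" for d1 d2
    using dof_converse[OF that] unfolding r1_def r2_def N1_def N2_def r0_def by blast
  have direct: "(d1, d2) \<in> dof_region \<sigma>1 U1 \<sigma>2 U2 PJ"
    if "0 \<le> d1" "0 \<le> d2" "d1 \<le> real (min N1 r1)" "d2 \<le> real (min N2 r2)"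
      "d1 + d2 \<le> min (real r1 + real r2 - real r0) (real N1 + real N2)"
      "(r1 \<le> N1 \<and> r2 \<le> N2) \<or> (real N1 \<le> real r1 - real r0 \<and> real N2 \<le> real r2 - real r0)" for d1 d2
    using that unfolding r1_def r2_def N1_def N2_def r0_def by (intro dof_direct) auto
  show ?thesis
  proof (intro conjI impI)
    show "\<forall>(d1, d2) \<in> dof_region \<sigma>1 U1 \<sigma>2 U2 PJ. d1 \<le> real (min N1 r1) \<and> d2 \<le> real (min N2 r2) \<and>
        d1 + d2 \<le> min (real r1 + real r2 - real r0) (real N1 + real N2)"
      unfolding split_beta by (intro ballI conv) (simp only: prod.collapse)
    assume dims: "(r1 \<le> N1 \<and> r2 \<le> N2) \<or> (real N1 \<le> real r1 - real r0 \<and> real N2 \<le> real r2 - real r0)"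
    show "dof_region \<sigma>1 U1 \<sigma>2 U2 PJ = {(d1, d2). d1 \<ge> 0 \<and> d2 \<ge> 0 \<and>
        d1 \<le> real (min N1 r1) \<and> d2 \<le> real (min N2 r2) \<and>
        d1 + d2 \<le> min (real r1 + real r2 - real r0) (real N1 + real N2)}"
      unfolding set_eq_iff split_paired_All mem_Collect_eq prod.case
    proof (intro allI iffI)
      fix d1 d2 assume m: "(d1, d2) \<in> dof_region \<sigma>1 U1 \<sigma>2 U2 PJ"
      show "d1 \<ge> 0 \<and> d2 \<ge> 0 \<and> d1 \<le> real (min N1 r1) \<and> d2 \<le> real (min N2 r2) \<and>
          d1 + d2 \<le> min (real r1 + real r2 - real r0) (real N1 + real N2)"
        by (intro conjI[OF dof_nonneg(1)[OF m] conjI[OF dof_nonneg(2)[OF m] conv[OF m]]])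
    qed (elim conjE, rule direct[OF _ _ _ _ _ dims])
  qed
qed

end
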